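(* Let $\Omega\subset\mathbb{R}^2$ be one of the following three kinds of domains: (i) an eccentric circle annular domain; (ii) a smooth exterior petal-like domain with an even number of axes of symmetry, such that the symmetry axes are perpendicular in pairs and the exterior boundary has nonzero curvature; (iii) an annular domain whose interior and exterior boundaries are both ellipses. Let $f(u)\ge 0$ be a decreasing and real analytic function and let $u$ be a non-constant solution of $$\Delta u+f(u)=0\ \text{ in }\Omega,\qquad u=0\ \text{ on }\partial\Omega .$$ Then on each symmetry axis of $\Omega$ the function $u$ has exactly two critical points.
   Context: The function $f:\mathbb{R}\to\mathbb{R}$ satisfies $f\ge 0$; "decreasing" is meant in the sense $f'\le 0$ (constants are allowed). Solutions are understood in the classical sense. A critical point of $u$ is a point of $\Omega$ at which $\nabla u=0$. An annular domain is a bounded planar domain bounded by two disjoint simple closed curves, the interior boundary $\gamma_I$ and the exterior boundary $\gamma_E$, with $\gamma_I$ lying inside $\gamma_E$. $\Omega_{\gamma_E}$ denotes the domain bounded by $\gamma_E$. Eccentric circle annular domain: up to rigid motion, $\gamma_I$ is the circle of radius $r$ centered at $(a,0)$ with $a>0$, and $\gamma_E$ is the circle of radius $R$ centered at $(0,0)$, with $a+r<R$. Exterior petal-like domain: a concentric annular domain with interior boundary $\gamma_I$ and exterior boundary $\gamma_E$ such that $\gamma_E$ is not a circle and: (1) $\gamma_E$ has $k\ge 2$ symmetry axes $l_1,\dots,l_k$, and these are equiangular; (2) $\Omega_{\gamma_E}$ is $l_i$-convex for every $i=1,\dots,k$, i.e. convex in the direction of $l_i$ (every segment parallel to $l_i$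 with endpoints in $\Omega_{\gamma_E}$ lies in $\Omega_{\gamma_E}$); (3) $\gamma_E$ satisfies the inner (interior) cone condition; (4) $\gamma_I$ is a circle whose center coincides with the center of $\Omega_{\gamma_E}$. *)

theory Defs
  imports "HOL-Analysis.Analysis"
begin

section \<open>Annular domains\<close>

definition simple_closed_curve :: "'a::topological_space set \<Rightarrow> bool" where
  "simple_closed_curve S \<longleftrightarrow>
     (\<exists>g. simple_path g \<and> pathfinish g = pathstart g \<and> path_image g = S)"

definition annular_domain :: "(real^2) set \<Rightarrow> (real^2) set \<Rightarrow> (real^2) set \<Rightarrow> bool" where
  "annular_domain \<gamma>\<^sub>I \<gamma>\<^sub>E \<Omega> \<longleftrightarrow>
     simple_closed_curve \<gamma>\<^sub>I \<and> simple_closed_curve \<gamma>\<^sub>E \<and>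
     \<gamma>\<^sub>I \<subseteq> inside \<gamma>\<^sub>E \<and> \<Omega> = inside \<gamma>\<^sub>E \<inter> outside \<gamma>\<^sub>I"

definition rigid_motion :: "(real^2 \<Rightarrow> real^2) \<Rightarrow> bool" where
  "rigid_motion T \<longleftrightarrow> (\<exists>A b. orthogonal_transformation A \<and> T = (\<lambda>x. A x + b))"

definition eccentric_circle_annular_domain ::
    "(real^2) set \<Rightarrow> (real^2) set \<Rightarrow> (real^2) set \<Rightarrow> bool" where
  "eccentric_circle_annular_domain \<gamma>\<^sub>I \<gamma>\<^sub>E \<Omega> \<longleftrightarrow>
     annular_domain \<gamma>\<^sub>I \<gamma>\<^sub>E \<Omega> \<and>
     (\<exists>T a r R. rigid_motion T \<and> a > 0 \<and> r > 0 \<and> a + r < R \<and>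
        \<gamma>\<^sub>I = T ` sphere (vector [a, 0]) r \<and> \<gamma>\<^sub>E = T ` sphere 0 R)"

text \<open>A circle counts as an ellipse (\<open>a = b\<close>).\<close>

definition is_ellipse :: "(real^2) set \<Rightarrow> bool" where
  "is_ellipse S \<longleftrightarrow>
     (\<exists>T a b. rigid_motion T \<and> a > 0 \<and> b > 0 \<and>
        S = T ` {x. (x $ 1 / a)\<^sup>2 + (x $ 2 / b)\<^sup>2 = 1})"


section \<open>Symmetry axes\<close>

definition line_through :: "real^2 \<Rightarrow> real^2 \<Rightarrow> (real^2) set" where
  "line_through p v = range (\<lambda>t. p + t *\<^sub>R v)"

text \<open>The reflection across \<open>line_through p v\<close>, for \<open>v \<noteq> 0\<close>.\<close>

definition line_reflection :: "real^2 \<Rightarrow> real^2 \<Rightarrow> real^2 \<Rightarrow> real^2" where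
  "line_reflection p v x = p + (2 * ((x - p) \<bullet> v) / (v \<bullet> v)) *\<^sub>R v - (x - p)"

definition symmetry_axis :: "(real^2) set \<Rightarrow> (real^2) set \<Rightarrow> bool" where
  "symmetry_axis l S \<longleftrightarrow>
     (\<exists>p v. v \<noteq> 0 \<and> l = line_through p v \<and> line_reflection p v ` S = S)"

definition symmetry_axes :: "(real^2) set \<Rightarrow> (real^2) set set" where
  "symmetry_axes S = {l. symmetry_axis l S}"

definition perpendicular_lines :: "(real^2) set \<Rightarrow> (real^2) set \<Rightarrow> bool" where
  "perpendicular_lines l m \<longleftrightarrow>
     (\<forall>p\<in>l. \<forall>q\<in>l. \<forall>p'\<in>m. \<forall>q'\<in>m. (q - p) \<bullet> (q' - p') = 0)"

definition axes_perpendicular_in_pairs :: "(real^2) set \<Rightarrow> bool" where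
  "axes_perpendicular_in_pairs S \<longleftrightarrow>
     (\<forall>l\<in>symmetry_axes S. \<exists>m\<in>symmetry_axes S. perpendicular_lines l m)"

text \<open>The \<open>k\<close> lines through \<open>c\<close> for which adjacent ones meet at angle \<open>\<pi> / k\<close>.\<close>

definition equiangular_lines :: "real^2 \<Rightarrow> nat \<Rightarrow> (real^2) set set \<Rightarrow> bool" where
  "equiangular_lines c k L \<longleftrightarrow>
     (\<exists>\<theta>. L = (\<lambda>i. line_through c
                 (vector [cos (\<theta> + real i * pi / real k), sin (\<theta> + real i * pi / real k)])) ` {..<k})"


section \<open>Exterior petal-like domains\<close>

text \<open>Two points of \<open>S\<close> span a segment parallel to the line \<open>l\<close> iff their difference is a
  difference of points of \<open>l\<close>.\<close>

definition convex_in_direction :: "(real^2) set \<Rightarrow> (real^2) set \<Rightarrow> bool" where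
  "convex_in_direction l S \<longleftrightarrow>
     (\<forall>x\<in>S. \<forall>y\<in>S. (\<exists>p\<in>l. \<exists>q\<in>l. y - x = q - p) \<longrightarrow> closed_segment x y \<subseteq> S)"

text \<open>Uniform version: one aperture \<open>\<theta>\<close> and one height \<open>h\<close> serve all boundary points.\<close>

definition interior_cone_condition :: "(real^2) set \<Rightarrow> bool" where
  "interior_cone_condition \<gamma> \<longleftrightarrow>
     (\<exists>\<theta> h. 0 < \<theta> \<and> \<theta> < pi / 2 \<and> h > 0 \<and>
        (\<forall>x\<in>\<gamma>. \<exists>v. norm v = 1 \<and>
           (\<forall>y. 0 < norm y \<and> norm y < h \<and> y \<bullet> v > cos \<theta> * norm y \<longrightarrow> x + y \<in> inside \<gamma>)))"

text \<open>\<open>k\<close> is the number of all symmetry axes of \<open>\<gamma>\<^sub>E\<close> (\<open>card\<close> is \<open>0\<close> on infinite sets, so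
  \<open>k \<ge> 2\<close> includes finiteness). The centre of the domain bounded by \<open>\<gamma>\<^sub>E\<close> is the common point
  \<open>c\<close> of these axes.\<close>

definition exterior_petal_like_domain ::
    "(real^2) set \<Rightarrow> (real^2) set \<Rightarrow> (real^2) set \<Rightarrow> bool" where
  "exterior_petal_like_domain \<gamma>\<^sub>I \<gamma>\<^sub>E \<Omega> \<longleftrightarrow>
     annular_domain \<gamma>\<^sub>I \<gamma>\<^sub>E \<Omega> \<and>
     \<not> (\<exists>p R. R > 0 \<and> \<gamma>\<^sub>E = sphere p R) \<and>
     (\<exists>c k. k = card (symmetry_axes \<gamma>\<^sub>E) \<and> k \<ge> 2 \<and>
        equiangular_lines c k (symmetry_axes \<gamma>\<^sub>E) \<and>
        (\<exists>r>0. \<gamma>\<^sub>I = sphere c r)) \<and>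
     (\<forall>l\<in>symmetry_axes \<gamma>\<^sub>E. convex_in_direction l (inside \<gamma>\<^sub>E)) \<and>
     interior_cone_condition \<gamma>\<^sub>E"


section \<open>Smooth curves and curvature\<close>

definition velocity :: "(real \<Rightarrow> real^2) \<Rightarrow> real \<Rightarrow> real^2" where
  "velocity c = (\<lambda>t. vector_derivative c (at t))"

text \<open>Regular \<open>C\<^sup>\<infinity>\<close> parametrisation of the closed curve \<open>S\<close>, periodic with period \<open>1\<close>, so that
  it is also smooth at the point where the curve closes up.\<close>

definition smooth_closed_parametrization :: "(real \<Rightarrow> real^2) \<Rightarrow> (real^2) set \<Rightarrow> bool" where
  "smooth_closed_parametrization c S \<longleftrightarrow>
     (\<forall>n t. (velocity ^^ n) c differentiable (at t)) \<and>
     (\<forall>t. velocity c t \<noteq> 0) \<and>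
     (\<forall>t. c (t + 1) = c t) \<and> inj_on c {0..<1} \<and> range c = S"

definition curvature :: "(real \<Rightarrow> real^2) \<Rightarrow> real \<Rightarrow> real" where
  "curvature c t =
     (velocity c t $ 1 * velocity (velocity c) t $ 2 - velocity c t $ 2 * velocity (velocity c) t $ 1)
       / norm (velocity c t) ^ 3"

definition smooth_nonzero_curvature :: "(real^2) set \<Rightarrow> bool" where
  "smooth_nonzero_curvature S \<longleftrightarrow>
     (\<exists>c. smooth_closed_parametrization c S \<and> (\<forall>t. curvature c t \<noteq> 0))"


section \<open>The boundary value problem\<close>

definition real_analytic :: "(real \<Rightarrow> real) \<Rightarrow> bool" where
  "real_analytic f \<longleftrightarrow> (\<forall>x. \<exists>F. (\<lambda>h. f (x + h)) has_fps_expansion F)"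

text \<open>Meant for open \<open>S\<close>: \<open>g\<close> is the gradient and \<open>H\<close> the Hessian of \<open>u\<close>.\<close>

definition C2_on :: "('a::euclidean_space \<Rightarrow> real) \<Rightarrow> 'a set \<Rightarrow> bool" where
  "C2_on u S \<longleftrightarrow>
     (\<exists>g H. (\<forall>x\<in>S. GDERIV u x :> g x) \<and>
            (\<forall>x\<in>S. (g has_derivative H x) (at x)) \<and>
            (\<forall>v. continuous_on S (\<lambda>x. H x v)))"

text \<open>The sum of the second derivatives along the coordinate directions.\<close>

definition laplacian :: "('a::euclidean_space \<Rightarrow> real) \<Rightarrow> 'a \<Rightarrow> real" where
  "laplacian u x = (\<Sum>b\<in>Basis. deriv (deriv (\<lambda>t. u (x + t *\<^sub>R b))) 0)"

definition classical_solution ::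
    "('a::euclidean_space) set \<Rightarrow> (real \<Rightarrow> real) \<Rightarrow> ('a \<Rightarrow> real) \<Rightarrow> bool" where
  "classical_solution \<Omega> f u \<longleftrightarrow>
     C2_on u \<Omega> \<and> continuous_on (closure \<Omega>) u \<and>
     (\<forall>x\<in>\<Omega>. laplacian u x + f (u x) = 0) \<and>
     (\<forall>x\<in>frontier \<Omega>. u x = 0)"

definition critical_points :: "('a::euclidean_space \<Rightarrow> real) \<Rightarrow> 'a set \<Rightarrow> 'a set" where
  "critical_points u \<Omega> = {x\<in>\<Omega>. GDERIV u x :> 0}"

end

theory Submission
  imports Defs
begin

text \<open>Extend \<open>u\<close> by zero to \<open>U\<close> and take the symmetry axis as the horizontal coordinate axis. In the
  three families the domain is \<open>E - H\<close> with \<open>E\<close> and \<open>H\<close> symmetric in the axis and, on each horizontal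
  line, symmetric intervals about the abscissae \<open>c\<close> and \<open>k\<close>; one may assume \<open>k \<le> c\<close>. The difference
  \<open>W h x = U (x + h e\<^sub>1) - U x\<close> satisfies a maximum principle since \<open>f\<close> is decreasing, so each of its nodal
  components reaches a point where only one of the two summands is positive; reflection in the line
  \<open>x\<^sub>1 = k\<close> gives \<open>W h \<ge> 0\<close> on \<open>x\<^sub>1 = k - h/2\<close>, which tells the negative components on the two sides of \<open>H\<close> apart.
  A planar crossing argument in the upper half plane then shows that on each of the two segments in which the
  axis meets the domain, \<open>\<partial>u/\<partial>x\<^sub>1\<close> cannot be negative and later positive. A touching zero would, by the strong
  maximum principle, make it vanish on a subsegment; unique continuation for the first-order system attached to \<open>W h\<close>
  would then make \<open>U\<close> vanish inside the domain. So \<open>\<partial>u/\<partial>x\<^sub>1\<close> has exactly one zero on each segment,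
  and \<open>\<partial>u/\<partial>x\<^sub>2 = 0\<close> there by symmetry.\<close>

section \<open>Twice differentiable functions and the maximum principle\<close>

text \<open>Horizontal differences replace the derivative because the solution is assumed twice
  differentiable and no more: its derivative has no Laplacian to which a maximum principle applies,
  while \<open>W h\<close> is as regular as the solution, and by the mean value theorem
  \<open>W h / h\<close> is a nearby value of the derivative. Hence \<open>h\<close> is chosen last,
  after all radii and thresholds. Extended by zero, \<open>W h\<close> also makes sense across the
  boundary, where its sign is known from the positions of a point and its translate. The obstacle is
  that \<open>E\<close> and \<open>H\<close> may have different centres: no symmetry perpendicular
  to the axis is available, and a negative component could leave on either side of \<open>H\<close>.
  The sign of the derivative is established in a full ball around a point of the axis, not just on
  the axis, since the strong maximum principle needs an open set. A Lipschitz bound for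
  \<open>f\<close>, drawn from analyticity, turns the equation for \<open>W h\<close> into a linear
  differential inequality, the setting of both Hopf's barrier and the Carleman argument.
  Non-constancy enters as \<open>f 0 > 0\<close>, which makes the solution positive.\<close>

definition trace2 :: "(real^2 \<Rightarrow> real^2) \<Rightarrow> real" where
  "trace2 L = L (axis 1 1) $ 1 + L (axis 2 1) $ 2"

text \<open>Gradient and Hessian are carried explicitly, so that differences, isometric changes of
  variable and barriers come with their second-order data. The gradient acts from the left, whereas
  \<open>GDERIV\<close> has it on the right.\<close>

definition C2_data ::
    "(real^2 \<Rightarrow> real) \<Rightarrow> (real^2 \<Rightarrow> real^2) \<Rightarrow> (real^2 \<Rightarrow> real^2 \<Rightarrow> real^2) \<Rightarrow> (real^2) set \<Rightarrow> bool" where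
  "C2_data u g H D \<longleftrightarrow>
     (\<forall>x\<in>D. (u has_derivative (\<lambda>v. g x \<bullet> v)) (at x)) \<and>
     (\<forall>x\<in>D. (g has_derivative H x) (at x)) \<and>
     (\<forall>v. continuous_on D (\<lambda>x. H x v))"

text \<open>The trace of the Hessian is the Laplacian. Boundary values are kept apart, so that the
  notion passes to subsets and to translated or reflected domains.\<close>

definition solves :: "(real^2) set \<Rightarrow> (real \<Rightarrow> real) \<Rightarrow> (real^2 \<Rightarrow> real) \<Rightarrow> bool" where
  "solves D f u \<longleftrightarrow> (\<exists>g H. C2_data u g H D \<and> (\<forall>x\<in>D. trace2 (H x) = - f (u x)))"

lemma C2_dataD:
  assumes "C2_data u g H D" "x \<in> D"
  shows "(u has_derivative (\<lambda>v. g x \<bullet> v)) (at x)" "(g has_derivative H x) (at x)"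
  using assms by (auto simp: C2_data_def)

lemma C2_data_linear: "C2_data u g H D \<Longrightarrow> x \<in> D \<Longrightarrow> linear (H x)"
  by (meson C2_dataD(2) has_derivative_linear)

lemma C2_data_mono: "C2_data u g H D \<Longrightarrow> D' \<subseteq> D \<Longrightarrow> C2_data u g H D'"
  unfolding C2_data_def by (meson continuous_on_subset subsetD)

lemma solves_mono: "solves D f u \<Longrightarrow> D' \<subseteq> D \<Longrightarrow> solves D' f u"
  unfolding solves_def using C2_data_mono by blast

lemma C2_data_diff:
  assumes "C2_data u g H D" "C2_data v k K D"
  shows "C2_data (\<lambda>x. u x - v x) (\<lambda>x. g x - k x) (\<lambda>x w. H x w - K x w) D"
  using assms unfolding C2_data_def
  by (auto intro!: continuous_intros derivative_eq_intros simp: inner_diff_left)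

lemma trace2_diff: "trace2 (\<lambda>w. H w - K w) = trace2 H - trace2 K"
  by (simp add: trace2_def)

lemma C2_data_cont: "C2_data u g H D \<Longrightarrow> continuous_on D u" "C2_data u g H D \<Longrightarrow> continuous_on D g"
  unfolding C2_data_def
  by (meson continuous_at_imp_continuous_on has_derivative_continuous)+

lemma vec2_eq: "(x::real^2) = y \<longleftrightarrow> x$1 = y$1 \<and> x$2 = y$2"
  by (simp add: vec_eq_iff forall_2)

lemma axis2_simps [simp]:
  "(axis 1 a :: real^2) $ 1 = a" "(axis 1 a :: real^2) $ 2 = 0"
  "(axis 2 a :: real^2) $ 1 = 0" "(axis 2 a :: real^2) $ 2 = a"
  by (auto simp: axis_def)

lemma inner2: "(x::real^2) \<bullet> y = x$1 * y$1 + x$2 * y$2"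
  by (simp add: inner_vec_def sum_2)

lemma norm2_sq: "(norm (x::real^2))\<^sup>2 = (x$1)\<^sup>2 + (x$2)\<^sup>2"
  unfolding power2_norm_eq_inner by (simp add: inner2 power2_eq_square)

lemma directional_derivatives:
  fixes g :: "real^2 \<Rightarrow> real^2"
  assumes "open D" "x \<in> D"
    and du: "\<And>y. y \<in> D \<Longrightarrow> (w has_derivative (\<lambda>v. g y \<bullet> v)) (at y)"
    and dg: "(g has_derivative H) (at x)"
  obtains d where "d > 0" "\<And>t. \<bar>t\<bar> < d \<Longrightarrow> x + t *\<^sub>R b \<in> D"
    "\<And>t. \<bar>t\<bar> < d \<Longrightarrow> ((\<lambda>t. w (x + t *\<^sub>R b)) has_real_derivative g (x + t *\<^sub>R b) \<bullet> b) (at t)"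
    "((\<lambda>t. g (x + t *\<^sub>R b) \<bullet> b) has_real_derivative H b \<bullet> b) (at 0)"
proof -
  have "linear H" using dg has_derivative_linear by blast
  have "open ((\<lambda>t. x + t *\<^sub>R b) -` D)"
    by (intro open_vimage \<open>open D\<close> continuous_intros)
  moreover have "0 \<in> (\<lambda>t. x + t *\<^sub>R b) -` D" using \<open>x \<in> D\<close> by simp
  ultimately obtain d where d: "d > 0" "ball 0 d \<subseteq> (\<lambda>t. x + t *\<^sub>R b) -` D"
    unfolding open_contains_ball by blast
  then have inD: "x + t *\<^sub>R b \<in> D" if "\<bar>t\<bar> < d" for t using that by (auto simp: subset_eq)
  have "((\<lambda>t. w (x + t *\<^sub>R b)) has_real_derivative g (x + t *\<^sub>R b) \<bullet> b) (at t)" if "\<bar>t\<bar> < d" for t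
  proof -
    have "((\<lambda>t. w (x + t *\<^sub>R b)) has_derivative (\<lambda>s. g (x + t *\<^sub>R b) \<bullet> (s *\<^sub>R b))) (at t)"
      by (rule has_derivative_compose[where f="\<lambda>t. x + t *\<^sub>R b" and g=w, OF _ du[OF inD[OF that]]])
        (auto intro!: derivative_eq_intros)
    then show ?thesis unfolding has_field_derivative_def by (simp add: mult_commute_abs)
  qed
  moreover have "((\<lambda>t. g (x + t *\<^sub>R b) \<bullet> b) has_real_derivative H b \<bullet> b) (at 0)"
  proof -
    have "((\<lambda>t. g (x + t *\<^sub>R b)) has_derivative (\<lambda>s. H (s *\<^sub>R b))) (at 0)"
      by (rule has_derivative_compose[where f="\<lambda>t. x + t *\<^sub>R b" and g=g])
        (use dg in \<open>auto intro!: derivative_eq_intros\<close>)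
    from has_derivative_inner_left[OF this, of b] show ?thesis unfolding has_field_derivative_def
      using \<open>linear H\<close> by (simp add: linear_cmul mult_commute_abs)
  qed
  ultimately show ?thesis using that d(1) inD by blast
qed

text \<open>Along a line through the maximum the first derivative vanishes at 0; a positive second
  derivative would make it positive just after 0, and the mean value theorem would produce a larger
  value.\<close>

lemma local_max_second_derivative:
  fixes g :: "real^2 \<Rightarrow> real^2"
  assumes "open D" "x \<in> D"
    and du: "\<And>y. y \<in> D \<Longrightarrow> (w has_derivative (\<lambda>v. g y \<bullet> v)) (at y)"
    and dg: "(g has_derivative H) (at x)"
    and mx: "\<And>y. y \<in> D \<Longrightarrow> w y \<le> w x"
  shows "H b \<bullet> b \<le> 0"
proof (rule ccontr)
  assume neg: "\<not> H b \<bullet> b \<le> 0"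
  define \<phi> where "\<phi> t = w (x + t *\<^sub>R b)" for t
  define \<psi> where "\<psi> t = g (x + t *\<^sub>R b) \<bullet> b" for t
  obtain d where d: "d > 0" "\<And>t. \<bar>t\<bar> < d \<Longrightarrow> x + t *\<^sub>R b \<in> D"
    and d\<phi>: "\<And>t. \<bar>t\<bar> < d \<Longrightarrow> (\<phi> has_real_derivative \<psi> t) (at t)"
    and d\<psi>: "(\<psi> has_real_derivative H b \<bullet> b) (at 0)"
    using directional_derivatives[OF assms(1,2) du dg, where b=b]
    unfolding \<phi>_def[abs_def, symmetric] \<psi>_def[symmetric] by blast
  have "\<psi> 0 = 0"
  proof (rule DERIV_local_max[OF d\<phi>[of 0] \<open>d > 0\<close>])
    show "\<forall>y. \<bar>0 - y\<bar> < d \<longrightarrow> \<phi> y \<le> \<phi> 0" using mx d(2) by (auto simp: \<phi>_def)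
  qed (use d in auto)
  obtain e where e: "e > 0" "\<And>h. 0 < h \<Longrightarrow> h < e \<Longrightarrow> \<psi> 0 < \<psi> h"
    using DERIV_pos_inc_right[OF d\<psi>] neg by auto
  define t where "t = min d e / 2"
  have t: "0 < t" "t < d" "t < e" using d e by (auto simp: t_def)
  have "\<exists>z. 0 < z \<and> z < t \<and> \<phi> t - \<phi> 0 = (t - 0) * \<psi> z"
    by (rule MVT2) (use t d\<phi> in auto)
  then obtain z where "0 < z" "z < t" "\<phi> t - \<phi> 0 = t * \<psi> z" by auto
  then have "\<phi> t > \<phi> 0" using e(2)[of z] t \<open>\<psi> 0 = 0\<close> by (auto intro: mult_pos_pos simp: algebra_simps)
  moreover have "\<phi> t \<le> \<phi> 0" using mx[OF d(2)[of t]] t by (simp add: \<phi>_def)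
  ultimately show False by simp
qed

lemma trace2_inner: "trace2 L = L (axis 1 1) \<bullet> axis 1 1 + L (axis 2 1) \<bullet> axis 2 1"
  by (simp add: trace2_def inner2)

text \<open>Subharmonicity is asked for where \<open>w > 0\<close>, which is where a difference of
  two solutions has it when \<open>f\<close> decreases. Strictness is gained by adding a small
  multiple of the squared norm.\<close>

lemma maximum_principle:
  fixes w :: "real^2 \<Rightarrow> real"
  assumes "open D" "bounded D"
    and cont: "continuous_on (closure D) w"
    and C2: "C2_data w g H D"
    and sub: "\<And>x. x \<in> D \<Longrightarrow> w x > 0 \<Longrightarrow> trace2 (H x) \<ge> 0"
    and bd: "\<And>x. x \<in> frontier D \<Longrightarrow> w x \<le> 0"
    and "x \<in> D"
  shows "w x \<le> 0"
proof (rule ccontr)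
  assume "\<not> w x \<le> 0"
  then have wx: "w x > 0" by simp
  obtain R where R: "R > 0" "\<And>y. y \<in> closure D \<Longrightarrow> norm y \<le> R"
    using bounded_closure[OF \<open>bounded D\<close>] unfolding bounded_pos by auto
  \<comment> \<open>The perturbation is at most \<open>w x / 2\<close> on the closure, too little to
    lift a point with \<open>w \<le> 0\<close> to the height of \<open>x\<close>. So the maximum of
    \<open>v\<close> lies in \<open>D\<close> at a point with \<open>w > 0\<close>.\<close>
  define \<delta> where "\<delta> = w x / (2 * R\<^sup>2)"
  have \<delta>: "\<delta> > 0" "\<delta> * R\<^sup>2 < w x" using wx R by (auto simp: \<delta>_def)
  define v where "v y = w y + \<delta> * (norm y)\<^sup>2" for y
  have "compact (closure D)" using \<open>bounded D\<close> by auto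
  moreover have "continuous_on (closure D) v" unfolding v_def by (intro continuous_intros cont)
  moreover have "closure D \<noteq> {}" using \<open>x \<in> D\<close> by auto
  ultimately obtain z where z: "z \<in> closure D" "\<And>y. y \<in> closure D \<Longrightarrow> v y \<le> v z"
    using continuous_attains_sup by metis
  have nz: "(norm z)\<^sup>2 \<le> R\<^sup>2" using R(2)[OF z(1)] by (simp add: power_mono)
  have "w x \<le> v x" using \<delta> by (simp add: v_def)
  also have "\<dots> \<le> v z" using z(2) \<open>x \<in> D\<close> closure_subset by blast
  finally have "w x \<le> w z + \<delta> * R\<^sup>2" using nz \<delta>(1) unfolding v_def
    by (smt (verit) mult_left_mono)
  then have wz: "w z > 0" using \<delta> by simp
  have "z \<in> D" using z(1) bd wz \<open>open D\<close> by (force simp: frontier_def interior_open)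
  have dv: "(v has_derivative (\<lambda>h. (g y + (2 * \<delta>) *\<^sub>R y) \<bullet> h)) (at y)" if "y \<in> D" for y
    unfolding v_def power2_norm_eq_inner using C2_dataD(1)[OF C2 that]
    by (auto intro!: derivative_eq_intros simp: inner_add_left inner_commute algebra_simps)
  have dg: "((\<lambda>y. g y + (2 * \<delta>) *\<^sub>R y) has_derivative (\<lambda>h. H z h + (2 * \<delta>) *\<^sub>R h)) (at z)"
    using C2_dataD(2)[OF C2 \<open>z \<in> D\<close>] by (auto intro!: derivative_eq_intros)
  have "(H z b + (2 * \<delta>) *\<^sub>R b) \<bullet> b \<le> 0" for b
    by (rule local_max_second_derivative[OF \<open>open D\<close> \<open>z \<in> D\<close> dv dg]) (use z(2) closure_subset in blast)+
  from this[of "axis 1 1"] this[of "axis 2 1"] have "trace2 (H z) + 4 * \<delta> \<le> 0"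
    by (simp add: trace2_def inner2)
  moreover have "trace2 (H z) \<ge> 0" using sub \<open>z \<in> D\<close> wz by auto
  ultimately show False using \<delta> by simp
qed

text \<open>Where \<open>u - v > e \<ge> 0\<close>, monotonicity of \<open>f\<close> makes the
  Laplacian of \<open>u - v\<close>, which is \<open>f v - f u\<close>, nonnegative. The slack
  \<open>e\<close> serves the superlevel sets of \<open>W h\<close> at positive thresholds.\<close>

lemma comparison:
  assumes "open D" "bounded D"
    and cu: "continuous_on (closure D) u" and cv: "continuous_on (closure D) v"
    and "solves D f u" "solves D f v"
    and mono: "\<And>s t. s \<le> t \<Longrightarrow> f t \<le> f s"
    and bd: "\<And>x. x \<in> frontier D \<Longrightarrow> u x - v x \<le> e"
    and "e \<ge> 0" "x \<in> D"
  shows "u x - v x \<le> e"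
proof -
  obtain g H k K where u: "C2_data u g H D" "\<And>x. x \<in> D \<Longrightarrow> trace2 (H x) = - f (u x)"
    and v: "C2_data v k K D" "\<And>x. x \<in> D \<Longrightarrow> trace2 (K x) = - f (v x)"
    using assms(5,6) unfolding solves_def by metis
  have C: "C2_data (\<lambda>x. u x - v x - e) (\<lambda>x. g x - k x) (\<lambda>x w. H x w - K x w) D"
    using C2_data_diff[OF u(1) v(1)] has_derivative_diff[OF _ has_derivative_const[of e]]
    unfolding C2_data_def diff_zero by blast
  have "u x - v x - e \<le> 0"
  proof (rule maximum_principle[OF assms(1,2) _ C])
    show "continuous_on (closure D) (\<lambda>x. u x - v x - e)" by (intro continuous_intros cu cv)
    fix y assume y: "y \<in> D" "0 < u y - v y - e"
    then have "f (u y) \<le> f (v y)" using mono \<open>e \<ge> 0\<close> by simp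
    then show "0 \<le> trace2 (\<lambda>w. H y w - K y w)" using u v y by (simp add: trace2_diff)
  qed (use bd \<open>x \<in> D\<close> in auto)
  then show ?thesis by simp
qed

text \<open>In coordinates: the columns of \<open>A\<close> are orthonormal, hence so are the rows,
  and these are the coefficients that appear in the conjugated trace.\<close>

lemma orthogonal_transformation_trace2:
  assumes A: "orthogonal_transformation A" and L: "linear L"
  shows "trace2 (\<lambda>v. adjoint A (L (A v))) = trace2 L"
proof -
  have lA: "linear A" using A by (simp add: orthogonal_transformation_def)
  define a b c d where abcd: "a = A (axis 1 1) $ 1" "b = A (axis 1 1) $ 2" "c = A (axis 2 1) $ 1" "d = A (axis 2 1) $ 2"
  have *: "A v \<bullet> A w = v \<bullet> w" for v w using A by (simp add: orthogonal_transformation_def)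
  have 1: "a\<^sup>2 + b\<^sup>2 = 1" "c\<^sup>2 + d\<^sup>2 = 1" "a * c + b * d = 0"
    using *[of "axis 1 1" "axis 1 1"] *[of "axis 2 1" "axis 2 1"] *[of "axis 1 1" "axis 2 1"]
    by (auto simp: inner2 abcd power2_eq_square)
  have det: "(a * d - b * c)\<^sup>2 = 1"
  proof -
    have "(a * d - b * c)\<^sup>2 = (a\<^sup>2 + b\<^sup>2) * (c\<^sup>2 + d\<^sup>2) - (a * c + b * d)\<^sup>2" by (simp add: power2_eq_square algebra_simps)
    then show ?thesis using 1 by simp
  qed
  have cd: "c = - (a * d - b * c) * b" "d = (a * d - b * c) * a"
    using 1 by (algebra)+
  have 2: "a\<^sup>2 + c\<^sup>2 = 1" "b\<^sup>2 + d\<^sup>2 = 1" "a * b + c * d = 0"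
    using 1 by (algebra)+
  define P Q where PQ: "P = L (axis 1 1)" "Q = L (axis 2 1)"
  have Lv: "L v = v$1 *\<^sub>R P + v$2 *\<^sub>R Q" for v
  proof -
    have "v = v$1 *\<^sub>R axis 1 1 + v$2 *\<^sub>R axis 2 1" by (simp add: vec2_eq)
    then have "L v = L (v$1 *\<^sub>R axis 1 1 + v$2 *\<^sub>R axis 2 1)" by (rule arg_cong)
    then show ?thesis unfolding PQ by (simp only: linear_add[OF L] linear_cmul[OF L])
  qed
  have "trace2 (\<lambda>v. adjoint A (L (A v))) = L (A (axis 1 1)) \<bullet> A (axis 1 1) + L (A (axis 2 1)) \<bullet> A (axis 2 1)"
    unfolding trace2_inner using adjoint_works[OF lA] by (simp add: inner_commute)
  also have "\<dots> = (a\<^sup>2 + c\<^sup>2) * P$1 + (b\<^sup>2 + d\<^sup>2) * Q$2 + (a*b+c*d) * (Q$1 + P$2)"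
    unfolding Lv[of "A (axis 1 1)"] Lv[of "A (axis 2 1)"] abcd[symmetric] inner2
    by (simp add: abcd[symmetric] power2_eq_square algebra_simps)
  also have "\<dots> = trace2 L" using 2 by (simp add: trace2_def PQ)
  finally show ?thesis .
qed

lemma C2_data_isometry:
  assumes A: "orthogonal_transformation A" and C: "C2_data u g H D"
  shows "C2_data (\<lambda>x. u (A x + b)) (\<lambda>x. adjoint A (g (A x + b))) (\<lambda>x v. adjoint A (H (A x + b) (A v)))
           {x. A x + b \<in> D}"
proof -
  have lA: "linear A" using A by (simp add: orthogonal_transformation_def)
  have bl: "bounded_linear A" "bounded_linear (adjoint A)"
    using lA by (auto simp: linear_conv_bounded_linear[symmetric] adjoint_linear)
  have dT: "((\<lambda>x. A x + b) has_derivative A) (at x)" for x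
    using bounded_linear_imp_has_derivative[OF bl(1)] by (auto intro!: derivative_eq_intros)
  show ?thesis unfolding C2_data_def
  proof (intro conjI ballI allI)
    fix x assume "x \<in> {x. A x + b \<in> D}" then have x: "A x + b \<in> D" by simp
    show "((\<lambda>x. u (A x + b)) has_derivative (\<bullet>) (adjoint A (g (A x + b)))) (at x)"
    proof -
      have "(\<bullet>) (adjoint A (g (A x + b))) = (\<lambda>v. g (A x + b) \<bullet> A v)"
        using adjoint_clauses(2)[OF lA] by (intro ext)
      then show ?thesis using has_derivative_compose[OF dT C2_dataD(1)[OF C x]] by simp
    qed
    have "((\<lambda>x. g (A x + b)) has_derivative (\<lambda>v. H (A x + b) (A v))) (at x)"
      using has_derivative_compose[OF dT C2_dataD(2)[OF C x]] .
    then show "((\<lambda>x. adjoint A (g (A x + b))) has_derivative (\<lambda>v. adjoint A (H (A x + b) (A v)))) (at x)"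
      by (rule bounded_linear.has_derivative[OF bl(2)])
  next
    fix v
    have "continuous_on D (\<lambda>x. H x (A v))" using C by (simp add: C2_data_def)
    then have "continuous_on {x. A x + b \<in> D} (\<lambda>x. H (A x + b) (A v))"
      by (rule continuous_on_compose2) (auto intro!: continuous_intros bounded_linear.continuous_on[OF bl(1)])
    then show "continuous_on {x. A x + b \<in> D} (\<lambda>x. adjoint A (H (A x + b) (A v)))"
      by (intro bounded_linear.continuous_on[OF bl(2)])
  qed
qed

lemma solves_isometry:
  assumes A: "orthogonal_transformation A" and s: "solves D f u"
  shows "solves {x. A x + b \<in> D} f (\<lambda>x. u (A x + b))"
proof -
  obtain g H where C: "C2_data u g H D" "\<And>x. x \<in> D \<Longrightarrow> trace2 (H x) = - f (u x)"
    using s unfolding solves_def by metis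
  have "trace2 (\<lambda>v. adjoint A (H (A x + b) (A v))) = - f (u (A x + b))" if "A x + b \<in> D" for x
    using orthogonal_transformation_trace2[OF A C2_data_linear[OF C(1) that]] C(2)[OF that] by simp
  then show ?thesis unfolding solves_def using C2_data_isometry[OF A C(1), of b]
    by (intro exI conjI) auto
qed

lemma solves_translation: "solves D f u \<Longrightarrow> solves {x. x + b \<in> D} f (\<lambda>x. u (x + b))"
  using solves_isometry[of "\<lambda>x. x" D f u b] by simp

lemma solves_cong:
  assumes "open D" "\<And>x. x \<in> D \<Longrightarrow> u x = v x" "solves D f u"
  shows "solves D f v"
proof -
  obtain g H where C: "C2_data u g H D" "\<And>x. x \<in> D \<Longrightarrow> trace2 (H x) = - f (u x)"
    using assms(3) unfolding solves_def by metis
  have "C2_data v g H D" unfolding C2_data_def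
  proof (intro conjI ballI allI)
    fix x assume "x \<in> D"
    then show "(v has_derivative (\<bullet>) (g x)) (at x)"
      using has_derivative_transform_within_open[OF C2_dataD(1)[OF C(1)] assms(1)] assms(2) by blast
  qed (use C(1) in \<open>auto simp: C2_data_def\<close>)
  then show ?thesis unfolding solves_def using C(2) assms(2) by auto
qed

section \<open>Unique continuation for the Cauchy-Riemann operator\<close>

text \<open>The derivative in \<open>r\<close> of the mean of \<open>G\<close> over the circle of radius \<open>r\<close> is a mean of
  \<open>e\<^sup>-\<^sup>i\<^sup>t (G\<^sub>x + \<i> G\<^sub>y)\<close>, because the tangential derivative integrates to zero.\<close>

lemma dbar_circle_bound:
  fixes G :: "real^2 \<Rightarrow> complex"
  assumes dG: "\<And>x. x \<in> ball z R0 \<Longrightarrow> (G has_derivative G' x) (at x)"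
    and cont: "\<And>v. continuous_on (ball z R0) (\<lambda>x. G' x v)"
    and bd: "\<And>x. x \<in> ball z R0 \<Longrightarrow> norm (G' x (axis 1 1) + \<i> * G' x (axis 2 1)) \<le> B"
    and R: "0 < R" "R < R0"
    and zero: "\<And>x. dist z x = R \<Longrightarrow> G x = 0"
  shows "norm (G z) \<le> B * R"
proof -
  define E where "E t = (cos t) *\<^sub>R axis 1 1 + (sin t) *\<^sub>R (axis 2 1 :: real^2)" for t
  define a where "a r t = G' (z + r *\<^sub>R E t) (axis 1 1)" for r t
  define b where "b r t = G' (z + r *\<^sub>R E t) (axis 2 1)" for r t
  have nE: "norm (E t) = 1" for t
  proof -
    have "(norm (E t))\<^sup>2 = 1" unfolding norm2_sq by (simp add: E_def)
    then show ?thesis by (simp add: power2_eq_1_iff) (metis norm_ge_zero not_one_le_zero  neg_0_le_iff_le)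
  qed
  have inb: "z + r *\<^sub>R E t \<in> ball z R0" if "0 \<le> r" "r \<le> R" for r t
    using that R nE by (simp add: dist_norm)
  have contE: "continuous_on X (\<lambda>p. z + fst p *\<^sub>R E (snd p))" for X
    unfolding E_def by (intro continuous_intros)
  have conta: "continuous_on ({0..R} \<times> UNIV) (\<lambda>p. a (fst p) (snd p))"
    and contb: "continuous_on ({0..R} \<times> UNIV) (\<lambda>p. b (fst p) (snd p))"
    unfolding a_def b_def using inb
    by (auto intro!: continuous_on_compose2[OF cont contE])
  have linG: "linear (G' x)" if "x \<in> ball z R0" for x
    using dG[OF that] has_derivative_linear by blast
  define fr where "fr r t = cos t *\<^sub>R a r t + sin t *\<^sub>R b r t" for r t
  define ft where "ft r t = - sin t *\<^sub>R a r t + cos t *\<^sub>R b r t" for r t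
  have contfr: "continuous_on ({0..R} \<times> UNIV) (\<lambda>(r,t). fr r t)"
    unfolding fr_def case_prod_unfold by (intro continuous_intros conta contb)
  have contft: "continuous_on UNIV (ft r)" "continuous_on UNIV (fr r)" if "0 \<le> r" "r \<le> R" for r
  proof -
    have "continuous_on UNIV (\<lambda>t. a r t)" "continuous_on UNIV (\<lambda>t. b r t)"
      using continuous_on_compose2[OF conta, of UNIV "\<lambda>t. (r,t)"]
        continuous_on_compose2[OF contb, of UNIV "\<lambda>t. (r,t)"] that
        continuous_on_Pair[OF continuous_on_const continuous_on_id, of UNIV r]
      by (simp_all add: image_subset_iff)
    then show "continuous_on UNIV (ft r)" "continuous_on UNIV (fr r)"
      unfolding ft_def fr_def by (intro continuous_intros; simp)+
  qed
  define F where "F r t = G (z + r *\<^sub>R E t)" for r t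
  have dF: "((\<lambda>r. F r t) has_vector_derivative fr r t) (at r within {0..R})" if "0 \<le> r" "r \<le> R" for r t
  proof -
    have "((\<lambda>r. G (z + r *\<^sub>R E t)) has_derivative (\<lambda>s. G' (z + r *\<^sub>R E t) (s *\<^sub>R E t))) (at r)"
      by (rule has_derivative_compose[where f="\<lambda>r. z + r *\<^sub>R E t" and g=G, OF _ dG[OF inb[OF that]]])
        (auto intro!: derivative_eq_intros)
    moreover have "G' (z + r *\<^sub>R E t) (s *\<^sub>R E t) = s *\<^sub>R fr r t" for s
    proof -
      define X where "X = z + r *\<^sub>R E t"
      have "linear (G' X)" unfolding X_def by (rule linG[OF inb[OF that]])
      then have "G' X (s *\<^sub>R E t) = s *\<^sub>R (cos t *\<^sub>R G' X (axis 1 1) + sin t *\<^sub>R G' X (axis 2 1))"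
        unfolding E_def by (simp only: linear_cmul linear_add)
      then show ?thesis by (simp add: fr_def a_def b_def X_def)
    qed
    ultimately show ?thesis unfolding F_def has_vector_derivative_def
      using has_derivative_at_withinI by auto
  qed
  have dFt: "(F r has_vector_derivative r *\<^sub>R ft r t) (at t within X)" if "0 \<le> r" "r \<le> R" for r t X
  proof -
    have "((\<lambda>t. G (z + r *\<^sub>R E t)) has_derivative
        (\<lambda>s. G' (z + r *\<^sub>R E t) (r *\<^sub>R ((s * - sin t) *\<^sub>R axis 1 1 + (s * cos t) *\<^sub>R axis 2 1)))) (at t)"
      apply (rule has_derivative_compose[where f="\<lambda>t. z + r *\<^sub>R E t" and g=G, OF _ dG[OF inb[OF that]]])
      unfolding E_def by (auto intro!: derivative_eq_intros ext simp: mult.commute)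
    moreover have "G' (z + r *\<^sub>R E t) (r *\<^sub>R ((s * - sin t) *\<^sub>R axis 1 1 + (s * cos t) *\<^sub>R axis 2 1))
        = s *\<^sub>R r *\<^sub>R ft r t" for s
      by (simp only: linear_cmul[OF linG[OF inb[OF that]]] linear_add[OF linG[OF inb[OF that]]])
        (simp add: ft_def a_def b_def scaleR_add_right scaleR_diff_right ac_simps)
    ultimately show ?thesis unfolding F_def has_vector_derivative_def
      using has_derivative_at_withinI by auto
  qed
  define A where "A r = integral {0..2*pi} (F r)" for r
  have contF: "continuous_on X (F r)" if "0 \<le> r" "r \<le> R" for r X
    by (rule continuous_on_vector_derivative[OF dFt[OF that]])
  have dA: "(A has_vector_derivative integral {0..2*pi} (fr r)) (at r within {0..R})"
    if "0 \<le> r" "r \<le> R" for r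
  proof -
    have "((\<lambda>r. integral (cbox 0 (2*pi)) (F r)) has_vector_derivative
      integral (cbox 0 (2*pi)) (fr r)) (at r within {0..R})"
    proof (rule leibniz_rule_vector_derivative)
      show "continuous_on ({0..R} \<times> cbox 0 (2 * pi)) (\<lambda>(r, t). fr r t)"
        using contfr by (rule continuous_on_subset) auto
    qed (use dF that contF in \<open>auto intro!: integrable_continuous_interval\<close>)
    then show ?thesis by (simp add: A_def[abs_def])
  qed
  \<comment> \<open>Positive \<open>r\<close> here: the derivative of \<open>F r\<close> in the
    angle carries a factor \<open>r\<close>, which is divided out.\<close>
  have bound: "norm (integral {0..2*pi} (fr r)) \<le> B * (2*pi)" if "0 < r" "r \<le> R" for r
  proof -
    have "((\<lambda>t. r *\<^sub>R ft r t) has_integral F r (2*pi) - F r 0) {0..2*pi}"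
      by (rule fundamental_theorem_of_calculus) (use dFt that in auto)
    moreover have "F r (2*pi) = F r 0" by (simp add: F_def E_def)
    ultimately have "((\<lambda>t. (1/r) *\<^sub>R (r *\<^sub>R ft r t)) has_integral (1/r) *\<^sub>R 0) {0..2*pi}"
      by (intro has_integral_cmul) simp
    then have "((\<lambda>t. \<i> * ft r t) has_integral \<i> * 0) {0..2*pi}"
      using that by (intro has_integral_mult_right) simp
    then have h1: "((\<lambda>t. \<i> * ft r t) has_integral 0) {0..2*pi}" by simp
    have h2: "(fr r has_integral integral {0..2*pi} (fr r)) {0..2*pi}"
    proof (intro integrable_integral integrable_continuous_interval)
      show "continuous_on {0..2*pi} (fr r)"
        using continuous_on_subset[OF contft(2)[of r]] that by simp
    qed
    have "((\<lambda>t. fr r t + \<i> * ft r t) has_integral integral {0..2*pi} (fr r)) {0..2*pi}"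
      using has_integral_add[OF h2 h1] by simp
    moreover have "fr r t + \<i> * ft r t = cis (- t) * (a r t + \<i> * b r t)" for t
      by (simp add: fr_def ft_def complex_eq_iff algebra_simps)
    ultimately have h3: "((\<lambda>t. cis (- t) * (a r t + \<i> * b r t)) has_integral integral {0..2*pi} (fr r)) (cbox 0 (2*pi))"
      by simp
    have h4: "norm (cis (- t) * (a r t + \<i> * b r t)) \<le> B" for t
      using bd[OF inb[of r t]] that by (simp add: norm_mult a_def b_def)
    have "0 \<le> B" using h4[of 0] norm_ge_zero order_trans by blast
    from has_integral_bound[OF this h3 h4] show ?thesis by simp
  qed
  have contA: "continuous_on {0..R} A"
    by (rule continuous_on_vector_derivative) (use dA in auto)
  have "\<exists>r\<in>{0<..<R}. norm (A R - A 0) \<le> norm ((R - 0) *\<^sub>R integral {0..2*pi} (fr r))"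
  proof (rule mvt_general[OF R(1) contA])
    fix r assume r: "0 < r" "r < R"
    have "(A has_vector_derivative integral {0..2*pi} (fr r)) (at r within {0<..<R})"
      by (rule has_vector_derivative_within_subset[OF dA[of r]]) (use r in auto)
    moreover have "at r within {0<..<R} = at r" by (rule at_within_open) (use r in auto)
    ultimately show "(A has_derivative (\<lambda>s. s *\<^sub>R integral {0..2*pi} (fr r))) (at r)"
      unfolding has_vector_derivative_def by simp
  qed
  then obtain r where "0 < r" "r < R" "norm (A R - A 0) \<le> R * norm (integral {0..2*pi} (fr r))" using R by auto
  moreover have "R * norm (integral {0..2*pi} (fr r)) \<le> R * (B * (2*pi))"
    using bound[of r] R \<open>0 < r\<close> \<open>r < R\<close> by (intro mult_left_mono) auto
  ultimately have "norm (A R - A 0) \<le> R * (B * (2*pi))" by linarith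
  moreover have "A R = 0"
  proof -
    have "F R t = 0" for t unfolding F_def by (rule zero) (use nE R in \<open>simp add: dist_norm\<close>)
    then have "F R = (\<lambda>t. 0)" by auto
    then show ?thesis by (simp add: A_def)
  qed
  moreover have "A 0 = (2*pi) *\<^sub>R G z" by (simp add: A_def F_def[abs_def])
  ultimately have "2*pi * norm (G z) \<le> 2 * pi * (B * R)" by (simp add: algebra_simps)
  then show ?thesis using pi_gt_zero by (simp only: mult_le_cancel_left_pos)
qed

text \<open>A C1 step from 0 to 1 over the unit interval, the primitive of the hat function
  \<open>cutoff'\<close> of height 2 with its peak at 1/2. A first-order operator asks no more of a
  cut-off than a continuous derivative.\<close>

definition cutoff :: "real \<Rightarrow> real" where
  "cutoff s = 2 * (max 0 s)\<^sup>2 - 4 * (max 0 (s - 1/2))\<^sup>2 + 2 * (max 0 (s - 1))\<^sup>2"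

definition cutoff' :: "real \<Rightarrow> real" where
  "cutoff' s = 4 * max 0 s - 8 * max 0 (s - 1/2) + 4 * max 0 (s - 1)"

lemma cutoff_simps:
  "s \<le> 0 \<Longrightarrow> cutoff s = 0" "s \<ge> 1 \<Longrightarrow> cutoff s = 1"
  "s \<le> 0 \<Longrightarrow> cutoff' s = 0" "s \<ge> 1 \<Longrightarrow> cutoff' s = 0"
  by (auto simp: cutoff_def cutoff'_def max_def power2_eq_square algebra_simps)

lemma DERIV_max0_sq: "((\<lambda>s::real. (max 0 s)\<^sup>2) has_real_derivative 2 * max 0 s) (at s)"
proof (cases s "0::real" rule: linorder_cases)
  case less
  have "((\<lambda>s::real. 0) has_real_derivative 0) (at s)" by simp
  then have "((\<lambda>s::real. (max 0 s)\<^sup>2) has_real_derivative 0) (at s)"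
    by (rule has_field_derivative_transform_within_open[where S="{..<0}"]) (use less in auto)
  then show ?thesis using less by simp
next
  case equal
  have "((\<lambda>h::real. max 0 h) \<longlongrightarrow> max 0 0) (at 0)" by (intro tendsto_intros)
  then have "((\<lambda>h::real. ((max 0 (0 + h))\<^sup>2 - (max 0 0)\<^sup>2) / h) \<longlongrightarrow> 0) (at 0)"
    unfolding max.idem by (rule Lim_transform_eventually) (auto simp: max_def power2_eq_square intro!: always_eventually)
  then show ?thesis using equal by (simp add: DERIV_def)
next
  case greater
  have "((\<lambda>s::real. s\<^sup>2) has_real_derivative 2 * s) (at s)" by (auto intro!: derivative_eq_intros)
  then have "((\<lambda>s::real. (max 0 s)\<^sup>2) has_real_derivative 2 * s) (at s)"
    by (rule has_field_derivative_transform_within_open[where S="{0<..}"]) (use greater in auto)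
  then show ?thesis using greater by simp
qed

lemma DERIV_cutoff: "(cutoff has_real_derivative cutoff' s) (at s)"
proof -
  have *: "((\<lambda>s. (max 0 (s - c))\<^sup>2) has_real_derivative 2 * max 0 (s - c)) (at s)" for c :: real
  proof -
    have "((\<lambda>s. s - c) has_real_derivative 1) (at s)" by (auto intro!: derivative_eq_intros)
    from DERIV_chain2[where f="\<lambda>s. (max 0 s)\<^sup>2" and g="\<lambda>s. s - c", OF DERIV_max0_sq this]
    show ?thesis by simp
  qed
  show ?thesis unfolding cutoff_def cutoff'_def
    by (rule derivative_eq_intros *[of 0, simplified] *[of "1/2"] *[of 1] refl | simp)+
qed

definition to_complex :: "real^2 \<Rightarrow> complex" where "to_complex x = Complex (x$1) (x$2)"

lemma norm_to_complex [simp]: "norm (to_complex x) = norm x"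
  by (simp add: to_complex_def complex_norm norm_vec_def L2_set_def sum_2)

lemma bounded_linear_to_complex: "bounded_linear to_complex"
  by (intro bounded_linear_intro[where K=1]) (simp_all add: to_complex_def complex_eq_iff flip: norm_to_complex)

text \<open>A Carleman argument in the maximum norm: multiply a cut-off of \<open>F\<close> by \<open>(P / (z - \<eta>'))\<^sup>n\<close>, which is
  holomorphic, hence invisible to the Cauchy-Riemann operator. Where the cut-off is not constant and \<open>F \<noteq> 0\<close>,
  this weight is at most 1, while near \<open>\<zeta>\<close> it grows geometrically in \<open>n\<close>.\<close>

lemma dbar_unique_continuation:
  fixes F :: "bool \<Rightarrow> real^2 \<Rightarrow> complex"
  assumes dF: "\<And>b x. x \<in> ball \<zeta> r \<Longrightarrow> (F b has_derivative F' b x) (at x)"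
    and cont: "\<And>b v. continuous_on (ball \<zeta> r) (\<lambda>x. F' b x v)"
    and bd: "\<And>b x. x \<in> ball \<zeta> r \<Longrightarrow>
        norm (F' b x (axis 1 1) + \<i> * F' b x (axis 2 1)) \<le> C * norm (F (\<not> b) x)"
    and zero: "\<And>b x. x \<in> ball \<zeta> r \<Longrightarrow> dist \<eta> x < \<rho> \<Longrightarrow> F b x = 0"
    and "dist \<eta> \<zeta> = \<rho>" "\<rho> > 0" "r > 0" "C > 0"
  shows "\<exists>e>0. \<forall>x\<in>ball \<zeta> e. \<forall>b. F b x = 0"
proof -
  \<comment> \<open>Three demands: the working ball of radius \<open>4 * \<delta>\<close> stays in
    the given one; the pole \<open>\<eta>'\<close> of the weight, at distance
    \<open>\<rho>/2\<close> from \<open>\<zeta>\<close>, stays out of it; and the coupling term can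
    be absorbed, since \<open>2 * \<delta> * C \<le> 1/2\<close>.\<close>
  define \<delta> where "\<delta> = min (r/4) (min (\<rho>/16) (1 / (4 * C)))"
  have \<delta>: "\<delta> > 0" "4 * \<delta> \<le> r" "16 * \<delta> \<le> \<rho>" "2 * \<delta> * C \<le> 1/2"
  proof -
    have "\<delta> \<le> r/4" "\<delta> \<le> \<rho>/16" "\<delta> \<le> 1 / (4 * C)" by (auto simp: \<delta>_def)
    then show "4 * \<delta> \<le> r" "16 * \<delta> \<le> \<rho>" "2 * \<delta> * C \<le> 1/2"
      using \<open>C > 0\<close> by (auto simp: field_simps)
    show "\<delta> > 0" using assms by (simp add: \<delta>_def)
  qed
  \<comment> \<open>The circle about the midpoint through \<open>\<zeta>\<close> touches the circle
    of radius \<open>\<rho>\<close> about \<open>\<eta>\<close> from inside, so that off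
    \<open>\<zeta>\<close> every point outside the large circle is strictly farther from
    \<open>\<eta>'\<close> than \<open>\<zeta>\<close> is. The identity \<open>med\<close> is
    Apollonius' median formula and makes this quantitative.\<close>
  define \<eta>' where "\<eta>' = (1/2) *\<^sub>R (\<eta> + \<zeta>)"
  have med: "(dist \<eta>' x)\<^sup>2 = ((dist \<eta> x)\<^sup>2 + (dist \<zeta> x)\<^sup>2) / 2 - \<rho>\<^sup>2 / 4" for x
    unfolding \<open>dist \<eta> \<zeta> = \<rho>\<close>[symmetric] \<eta>'_def dist_norm norm2_sq
    by (simp add: power2_eq_square field_simps)
  have \<eta>'\<zeta>: "dist \<eta>' \<zeta> = \<rho>/2"
  proof (rule power2_eq_imp_eq)
    show "(dist \<eta>' \<zeta>)\<^sup>2 = (\<rho>/2)\<^sup>2"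
      unfolding med \<open>dist \<eta> \<zeta> = \<rho>\<close> by (simp add: power2_eq_square)
  qed (use \<open>\<rho> > 0\<close> in auto)
  \<comment> \<open>By \<open>med\<close>, \<open>P\<close> bounds \<open>dist \<eta>' x\<close>
    from below when \<open>dist \<eta> x \<ge> \<rho>\<close> and the squared distance of
    \<open>x\<close> from \<open>\<zeta>\<close> is at least \<open>\<delta>\<^sup>2 / 2\<close>.
    With \<open>P'\<close> strictly between \<open>\<rho>/2\<close> and \<open>P\<close>, the weight
    is at least \<open>q ^ n\<close> at points closer than \<open>P'\<close> to the pole.\<close>
  define P where "P = sqrt ((\<rho>/2)\<^sup>2 + \<delta>\<^sup>2/4)"
  have P: "P > \<rho>/2" unfolding P_def using \<delta> \<open>\<rho> > 0\<close> by (intro real_less_rsqrt) auto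
  define P' where "P' = (\<rho>/2 + P) / 2"
  have P': "P' > \<rho>/2" "P' < P" "P' > 0" using P \<open>\<rho> > 0\<close> by (auto simp: P'_def)
  define q where "q = P / P'"
  have q: "q > 1" using P' by (auto simp: q_def)
  define B where "B = ball \<zeta> (4 * \<delta>)"
  have Bsub: "B \<subseteq> ball \<zeta> r" using \<delta> by (auto simp: B_def)
  have nz: "to_complex (x - \<eta>') \<noteq> 0" if "x \<in> B" for x
  proof -
    have "dist \<zeta> x < 4 * \<delta>" using that by (simp add: B_def)
    then have "x \<noteq> \<eta>'" using \<eta>'\<zeta> \<delta> by (auto simp: dist_commute)
    then show ?thesis by (metis norm_to_complex norm_eq_zero right_minus_eq)
  qed
  define K where "K = 2 / \<delta>\<^sup>2"
  define s where "s x = 2 - K * ((x - \<zeta>) \<bullet> (x - \<zeta>))" for x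
  have s_le: "s x \<le> 0" if "dist \<zeta> x \<ge> \<delta>" for x
  proof -
    have "\<delta>\<^sup>2 \<le> (x - \<zeta>) \<bullet> (x - \<zeta>)" using that \<delta> power_mono[OF that, of 2]
      by (simp add: dist_norm norm_minus_commute flip: power2_norm_eq_inner)
    then show ?thesis using \<delta> by (simp add: s_def K_def field_simps)
  qed
  have s_ge: "s x \<ge> 1" if "(dist \<zeta> x)\<^sup>2 \<le> \<delta>\<^sup>2 / 2" for x
    using that \<delta> by (simp add: s_def K_def field_simps dist_norm norm_minus_commute flip: power2_norm_eq_inner)
  have ds: "(s has_derivative (\<lambda>v. - 2 * K * ((x - \<zeta>) \<bullet> v))) (at x)" for x
    unfolding s_def by (auto intro!: derivative_eq_intros simp: inner_commute algebra_simps)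
  define cut where "cut x = complex_of_real (cutoff (s x))" for x
  define cut' where "cut' x v = complex_of_real (cutoff' (s x) * (- 2 * K * ((x - \<zeta>) \<bullet> v)))" for x v
  have dcut: "(cut has_derivative cut' x) (at x)" for x
  proof -
    have "(cutoff has_derivative (\<lambda>y. cutoff' (s x) * y)) (at (s x))"
      using DERIV_cutoff[of "s x"] by (simp add: has_field_derivative_def)
    from has_derivative_of_real[OF has_derivative_compose[OF ds this]]
    show ?thesis by (simp add: cut_def[abs_def] cut'_def[abs_def])
  qed
  have cont_s: "continuous_on X s" for X unfolding s_def by (intro continuous_intros)
  have cont_cut: "continuous_on X cutoff" "continuous_on X cutoff'" for X
    unfolding cutoff_def cutoff'_def by (intro continuous_intros)+
  have contcut: "continuous_on X cut" "continuous_on X (\<lambda>x. cut' x v)" for X v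
    unfolding cut_def cut'_def
    by (auto intro!: continuous_intros continuous_on_compose2[OF cont_cut(1)[of UNIV] cont_s]
        continuous_on_compose2[OF cont_cut(2)[of UNIV] cont_s])
  define dbcut where "dbcut x = cut' x (axis 1 1) + \<i> * cut' x (axis 2 1)" for x
  have contF: "continuous_on (ball \<zeta> r) (F b)" for b
    using dF by (meson continuous_at_imp_continuous_on has_derivative_continuous)
  have cb: "cball \<zeta> \<delta> \<subseteq> B" using \<delta> by (auto simp: B_def)
  obtain M where M: "M > 0" "\<And>b x. x \<in> cball \<zeta> \<delta> \<Longrightarrow> norm (dbcut x * F b x) \<le> M"
  proof -
    have "continuous_on (cball \<zeta> \<delta>) (\<lambda>x. dbcut x * F b x)" for b unfolding dbcut_def
      using cb Bsub by (intro continuous_intros contcut continuous_on_subset[OF contF]) auto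
    then have "bounded ((\<lambda>x. dbcut x * F b x) ` cball \<zeta> \<delta>)" for b
      by (intro compact_imp_bounded compact_continuous_image) auto
    then obtain m where m: "\<And>b. m b > 0 \<and> (\<forall>y\<in>(\<lambda>x. dbcut x * F b x) ` cball \<zeta> \<delta>. norm y \<le> m b)"
      unfolding bounded_pos by metis
    have "norm (dbcut x * F b x) \<le> max (m True) (m False)" if "x \<in> cball \<zeta> \<delta>" for b x
      using m[of b] that by (cases b) (auto simp: le_max_iff_disj)
    moreover have "max (m True) (m False) > 0" using m[of True] by (simp add: less_max_iff_disj)
    ultimately show ?thesis using that by blast
  qed
  have key: "norm (cut x * F b x * (of_real P / to_complex (x - \<eta>')) ^ n) \<le> 4 * \<delta> * M"
    if "x \<in> cball \<zeta> \<delta>" for b x n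
  proof -
    define m where "m x = (of_real P / to_complex (x - \<eta>')) ^ n" for x
    define k where "k x = of_nat n * (of_real P / to_complex (x - \<eta>')) ^ (n - 1) * (- of_real P / (to_complex (x - \<eta>'))\<^sup>2)" for x
    have dm: "(m has_derivative (\<lambda>v. k x * to_complex v)) (at x)" if "x \<in> B" for x
    proof -
      have 1: "((\<lambda>z. (of_real P / z) ^ n) has_field_derivative k x) (at (to_complex (x - \<eta>')))"
      proof -
        have "((\<lambda>z. of_real P / z) has_field_derivative - of_real P / (to_complex (x - \<eta>'))\<^sup>2) (at (to_complex (x - \<eta>')))"
          using nz[OF that] by (auto intro!: derivative_eq_intros simp: power2_eq_square)
        from DERIV_power[OF this, of n] show ?thesis by (simp add: k_def algebra_simps)
      qed
      have 2: "((\<lambda>x. to_complex (x - \<eta>')) has_derivative to_complex) (at x)"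
        by (rule bounded_linear.has_derivative[OF bounded_linear_to_complex, THEN has_derivative_eq_rhs])
          (auto intro!: derivative_eq_intros)
      show ?thesis using has_derivative_compose[OF 2 1[unfolded has_field_derivative_def]]
        by (simp add: m_def[abs_def])
    qed
    have contcx: "continuous_on X (\<lambda>x. to_complex (x - \<eta>'))" for X
      by (intro bounded_linear.continuous_on[OF bounded_linear_to_complex] continuous_intros)
    have contm: "continuous_on B m" "continuous_on B k"
      unfolding m_def k_def using nz by (auto intro!: continuous_intros contcx)
    define G where "G b x = cut x * F b x * m x" for b x
    define G' where "G' b x v = cut' x v * F b x * m x + cut x * F' b x v * m x + cut x * F b x * (k x * to_complex v)" for b x v
    have dG: "(G b has_derivative G' b x) (at x)" if "x \<in> B" for b x
    proof -
      have "x \<in> ball \<zeta> r" using that Bsub by auto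
      show ?thesis unfolding G_def[abs_def] G'_def[abs_def]
        by (rule has_derivative_eq_rhs[OF has_derivative_mult[OF has_derivative_mult[OF dcut dF[OF \<open>x \<in> ball \<zeta> r\<close>]] dm[OF that]]])
          (auto simp: algebra_simps)
    qed
    have contG': "continuous_on B (\<lambda>x. G' b x v)" for b v
      unfolding G'_def using Bsub
      by (intro continuous_intros contm contcut continuous_on_subset[OF contF] continuous_on_subset[OF cont])
    have contG: "continuous_on B (G b)" for b
      using dG by (meson continuous_at_imp_continuous_on has_derivative_continuous)
    have dbG: "G' b x (axis 1 1) + \<i> * G' b x (axis 2 1)
        = dbcut x * F b x * m x + cut x * m x * (F' b x (axis 1 1) + \<i> * F' b x (axis 2 1))" for b x
    proof -
      have "to_complex (axis 1 1) + \<i> * to_complex (axis 2 1) = 0" by (simp add: to_complex_def complex_eq_iff)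
      then have "cut x * F b x * k x * (to_complex (axis 1 1) + \<i> * to_complex (axis 2 1)) = 0" by simp
      then show ?thesis unfolding G'_def dbcut_def by (simp add: algebra_simps)
    qed
    \<comment> \<open>Each of the two functions is controlled by the other, so the maximum is taken
      over both at once.\<close>
    have "\<exists>x\<in>cball \<zeta> \<delta>. \<forall>y\<in>cball \<zeta> \<delta>. max (norm (G True y)) (norm (G False y)) \<le> max (norm (G True x)) (norm (G False x))"
    proof (rule continuous_attains_sup)
      show "continuous_on (cball \<zeta> \<delta>) (\<lambda>y. max (norm (G True y)) (norm (G False y)))"
        using cb by (intro continuous_intros continuous_on_subset[OF contG])
    qed (use \<delta> in auto)
    then obtain x0 where x0c: "x0 \<in> cball \<zeta> \<delta>"
      and mx: "\<And>y. y \<in> cball \<zeta> \<delta> \<Longrightarrow>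
        max (norm (G True y)) (norm (G False y)) \<le> max (norm (G True x0)) (norm (G False x0))" by blast
    define S where "S = max (norm (G True x0)) (norm (G False x0))"
    obtain c0 where "S = norm (G c0 x0)" unfolding S_def by (metis max_def)
    note x0 = x0c this
    have S: "norm (G b y) \<le> S" if "y \<in> cball \<zeta> \<delta>" for b y
      using mx[OF that] unfolding S_def[symmetric] by (cases b) auto
    have "S \<ge> 0" using x0 by simp
    have bnd: "norm (G' b x (axis 1 1) + \<i> * G' b x (axis 2 1)) \<le> C * S + M" if "x \<in> B" for b x
    proof (cases "dist \<zeta> x \<le> \<delta>")
      case False
      then have "s x \<le> 0" by (intro s_le) simp
      then have "cut x = 0" "dbcut x = 0" by (auto simp: cut_def dbcut_def cut'_def cutoff_simps)
      then show ?thesis using dbG \<open>S \<ge> 0\<close> M \<open>C > 0\<close> by (simp add: add_nonneg_nonneg)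
    next
      case True
      then have xc: "x \<in> cball \<zeta> \<delta>" by simp
      have "x \<in> ball \<zeta> r" using that Bsub by auto
      have "norm (cut x * m x * (F' b x (axis 1 1) + \<i> * F' b x (axis 2 1))) \<le> norm (cut x * m x) * (C * norm (F (\<not> b) x))"
        unfolding norm_mult[of "cut x * m x"] by (intro mult_left_mono bd \<open>x \<in> ball \<zeta> r\<close>) auto
      also have "\<dots> = C * norm (G (\<not> b) x)" by (simp add: G_def norm_mult)
      also have "\<dots> \<le> C * S" using S[OF xc] \<open>C > 0\<close> by simp
      finally have 1: "norm (cut x * m x * (F' b x (axis 1 1) + \<i> * F' b x (axis 2 1))) \<le> C * S" .
      have 2: "norm (dbcut x * F b x * m x) \<le> M"
      proof (cases "(dist \<zeta> x)\<^sup>2 \<le> \<delta>\<^sup>2 / 2 \<or> F b x = 0")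
        case True
        then have "dbcut x = 0 \<or> F b x = 0" using s_ge[of x] by (auto simp: dbcut_def cut'_def cutoff_simps)
        then show ?thesis using M by auto
      next
        case False
        then have "dist \<eta> x \<ge> \<rho>" using zero[OF \<open>x \<in> ball \<zeta> r\<close>] by force
        then have "\<rho>\<^sup>2 \<le> (dist \<eta> x)\<^sup>2" using \<open>\<rho> > 0\<close> by (intro power_mono) auto
        then have "P\<^sup>2 \<le> (dist \<eta>' x)\<^sup>2" using False unfolding med P_def
          by (simp add: power2_eq_square field_simps)
        then have "P \<le> dist \<eta>' x" by (rule power2_le_imp_le) simp
        moreover have "P > 0" using P \<open>\<rho> > 0\<close> by simp
        ultimately have "norm (of_real P / to_complex (x - \<eta>')) \<le> 1"
          by (auto simp: norm_divide dist_norm norm_minus_commute divide_le_eq)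
        then have "norm (m x) \<le> 1" unfolding m_def norm_power by (intro power_le_one) auto
        then have "norm (dbcut x * F b x) * norm (m x) \<le> M * 1"
          using M(2)[OF xc] M(1) by (intro mult_mono) auto
        then show ?thesis by (simp add: norm_mult)
      qed
      show ?thesis unfolding dbG using 1 2 norm_triangle_ineq[of "dbcut x * F b x * m x"] by (smt (verit))
    qed
    have sub: "ball x0 (5/2 * \<delta>) \<subseteq> B"
    proof
      fix y assume "y \<in> ball x0 (5/2 * \<delta>)"
      then have "dist x0 y < 5/2 * \<delta>" "dist \<zeta> x0 \<le> \<delta>" using x0 by auto
      then show "y \<in> B" using dist_triangle[of \<zeta> y x0] \<delta> by (simp add: B_def)
    qed
    \<comment> \<open>The circle of radius \<open>2 * \<delta>\<close> about \<open>x0\<close>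
      avoids the open ball of radius \<open>\<delta>\<close> about \<open>\<zeta>\<close>, so the
      cut-off vanishes on it. Absorbing half of \<open>S\<close> then leaves a bound independent of
      \<open>n\<close>.\<close>
    have "norm (G c0 x0) \<le> (C * S + M) * (2 * \<delta>)"
    proof (rule dbar_circle_bound[where ?R0.0="5/2 * \<delta>" and G'="G' c0"])
      fix x assume "dist x0 x = 2 * \<delta>"
      then have "dist \<zeta> x \<ge> \<delta>" using x0 dist_triangle[of x0 x \<zeta>] \<delta> by (simp add: dist_commute)
      then show "G c0 x = 0" using s_le by (simp add: G_def cut_def cutoff_simps)
    qed (use sub dG contG' bnd \<delta> continuous_on_subset in \<open>(auto; blast)+\<close>)
    then have "S \<le> 2 * \<delta> * C * S + 2 * \<delta> * M" using x0 by (simp add: algebra_simps)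
    also have "2 * \<delta> * C * S \<le> 1/2 * S" using \<delta> \<open>S \<ge> 0\<close> by (intro mult_right_mono) auto
    finally have "S \<le> 4 * \<delta> * M" by simp
    then show ?thesis using S[OF that, of b] by (simp add: G_def m_def)
  qed
  define e where "e = min (\<delta>/2) (P' - \<rho>/2)"
  have "e > 0" using \<delta> P' by (simp add: e_def)
  moreover have "F b x = 0" if "x \<in> ball \<zeta> e" for b x
  proof (rule ccontr)
    assume "F b x \<noteq> 0"
    have x: "dist \<zeta> x < \<delta>/2" "dist \<zeta> x < P' - \<rho>/2" using that by (auto simp: e_def)
    have "(dist \<zeta> x)\<^sup>2 \<le> (\<delta>/2)\<^sup>2" using x by (intro power_mono) auto
    also have "\<dots> \<le> \<delta>\<^sup>2/2" by (simp add: power2_eq_square)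
    finally have "cut x = 1" using s_ge[of x] by (simp add: cut_def cutoff_simps)
    have "dist \<eta>' x < P'" using dist_triangle[of \<eta>' x \<zeta>] \<eta>'\<zeta> x by simp
    moreover have "x \<in> B" using x \<delta> by (simp add: B_def)
    then have "dist \<eta>' x > 0" using nz[of x] by (auto simp: to_complex_def complex_eq_iff)
    ultimately have "q \<le> norm (of_real P / to_complex (x - \<eta>'))" using P P' \<open>\<rho> > 0\<close>
      by (auto simp: q_def norm_divide dist_norm norm_minus_commute intro!: divide_left_mono mult_pos_pos)
    then have "norm (F b x) * q ^ n \<le> 4 * \<delta> * M" for n
    proof -
      have "norm (F b x) * q ^ n \<le> norm (F b x) * norm (of_real P / to_complex (x - \<eta>')) ^ n"
        using \<open>q \<le> _\<close> q by (intro mult_left_mono power_mono) auto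
      also have "\<dots> = norm (cut x * F b x * (of_real P / to_complex (x - \<eta>')) ^ n)"
        using \<open>cut x = 1\<close> by (simp add: norm_mult norm_power)
      also have "\<dots> \<le> 4 * \<delta> * M" using key[of x b n] x \<delta> by simp
      finally show ?thesis .
    qed
    moreover obtain n where "4 * \<delta> * M / norm (F b x) < q ^ n"
      using real_arch_pow[OF q] by blast
    ultimately show False using \<open>F b x \<noteq> 0\<close> by (auto simp: field_simps) (smt (verit))
  qed
  ultimately show ?thesis by blast
qed

section \<open>Nodal components of horizontal differences\<close>

abbreviation pt :: "real \<Rightarrow> real \<Rightarrow> real^2" where "pt a b \<equiv> vector [a, b]"

lemma pt_eta [simp]: "pt (x$1) (x$2) = x"
  by (simp add: vec2_eq)

lemma pt_arith [simp]:
  "pt a b + pt c d = pt (a + c) (b + d)" "pt a b - pt c d = pt (a - c) (b - d)"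
  "r *\<^sub>R pt a b = pt (r * a) (r * b)" "- pt a b = pt (- a) (- b)" "pt 0 0 = 0"
  "pt a b = pt c d \<longleftrightarrow> a = c \<and> b = d"
  by (auto simp: vec2_eq)

lemma pt_collapse: "x$1 = a \<Longrightarrow> x$2 = b \<Longrightarrow> x = pt a b"
  by (simp add: vec2_eq)

lemma continuous_on_pt [continuous_intros]:
  assumes "continuous_on S a" "continuous_on S b"
  shows "continuous_on S (\<lambda>x. pt (a x) (b x))"
proof -
  have "(\<lambda>x. pt (a x) (b x)) = (\<lambda>x. a x *\<^sub>R pt 1 0 + b x *\<^sub>R pt 0 1)" by (simp add: fun_eq_iff)
  then show ?thesis using assms by (simp only:) (intro continuous_intros)
qed

text \<open>Both paths are enclosed in a box whose lower edge lies on the axis, so that their four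
  end points alternate along that edge and must be separated by a crossing:
  \<open>fashoda_interlace\<close>.\<close>

lemma half_plane_interlace:
  assumes X: "\<And>x. x \<in> X \<Longrightarrow> x$2 \<ge> 0" and Y: "\<And>x. x \<in> Y \<Longrightarrow> x$2 \<ge> 0"
    and pX: "path_component X (pt a 0) (pt c 0)" and pY: "path_component Y (pt b 0) (pt d 0)"
    and ord: "a < b" "b < c" "c < d"
  shows "X \<inter> Y \<noteq> {}"
proof -
  obtain p where p: "path p" "path_image p \<subseteq> X" "pathstart p = pt a 0" "pathfinish p = pt c 0"
    using pX unfolding path_component_def by auto
  obtain q where q: "path q" "path_image q \<subseteq> Y" "pathstart q = pt b 0" "pathfinish q = pt d 0"
    using pY unfolding path_component_def by auto
  have "bounded (path_image p \<union> path_image q)" using p q by (simp add: bounded_path_image)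
  then obtain m where m: "path_image p \<union> path_image q \<subseteq> cbox (- m) m"
    using bounded_subset_cbox_symmetric by blast
  define l where "l = pt (- (m$1)) 0"
  have sub: "path_image p \<subseteq> cbox l m" "path_image q \<subseteq> cbox l m"
    using m X Y p(2) q(2) by (force simp: mem_box_cart forall_2 l_def subset_iff)+
  obtain z where "z \<in> path_image p" "z \<in> path_image q"
    by (rule fashoda_interlace[OF p(1) q(1) sub]) (use p q ord in \<open>auto simp: l_def\<close>)
  then show ?thesis using p(2) q(2) by auto
qed

lemma path_component_segment: fixes a :: "real^2" shows "closed_segment a b \<subseteq> S \<Longrightarrow> path_component S a b"
  unfolding path_component_def by (intro exI[of _ "linepath a b"]) auto

text \<open>Since \<open>U\<close> turns out to be even in the second coordinate, folding preserves
  the values of \<open>W h\<close>; nodal components can thus be moved into the upper half plane,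
  where crossing arguments apply.\<close>

definition fold_up :: "real^2 \<Rightarrow> real^2" where "fold_up x = pt (x$1) \<bar>x$2\<bar>"

lemma path_component_fold_up:
  assumes "path_component X x y" and "\<And>x. x \<in> X \<Longrightarrow> fold_up x \<in> X"
  shows "path_component {x \<in> X. x$2 \<ge> 0} (fold_up x) (fold_up y)"
proof -
  obtain p where p: "path p" "path_image p \<subseteq> X" "pathstart p = x" "pathfinish p = y"
    using assms(1) unfolding path_component_def by auto
  have "continuous_on S fold_up" for S unfolding fold_up_def by (intro continuous_intros)
  then have "path (fold_up \<circ> p)" using p(1) path_continuous_image by blast
  moreover have "path_image (fold_up \<circ> p) \<subseteq> {x \<in> X. x$2 \<ge> 0}"
    using p(2) assms(2) by (auto simp: path_image_compose fold_up_def)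
  moreover have "pathstart (fold_up \<circ> p) = fold_up x" "pathfinish (fold_up \<circ> p) = fold_up y"
    using p by (auto simp: pathstart_compose pathfinish_compose)
  ultimately show ?thesis unfolding path_component_def by blast
qed

lemma closed_segment_horizontal:
  "z \<in> closed_segment (pt a y) (pt b y) \<Longrightarrow> \<exists>s. z = pt s y \<and> min a b \<le> s \<and> s \<le> max a b"
proof -
  assume "z \<in> closed_segment (pt a y) (pt b y)"
  then obtain t where t: "0 \<le> t" "t \<le> 1" "z = (1 - t) *\<^sub>R pt a y + t *\<^sub>R pt b y"
    by (auto simp: closed_segment_def)
  have "(1 - t) * a + t * b \<in> closed_segment a b" using t by (auto simp: closed_segment_def)
  then show ?thesis using t unfolding closed_segment_eq_real_ivl
    by (intro exI[of _ "(1 - t) * a + t * b"]) (auto simp: algebra_simps split: if_splits)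
qed

lemma closed_segment_vertical:
  "z \<in> closed_segment (pt x a) (pt x b) \<Longrightarrow> \<exists>s. z = pt x s \<and> min a b \<le> s \<and> s \<le> max a b"
proof -
  assume "z \<in> closed_segment (pt x a) (pt x b)"
  then obtain t where t: "0 \<le> t" "t \<le> 1" "z = (1 - t) *\<^sub>R pt x a + t *\<^sub>R pt x b"
    by (auto simp: closed_segment_def)
  have "(1 - t) * a + t * b \<in> closed_segment a b" using t by (auto simp: closed_segment_def)
  then show ?thesis using t unfolding closed_segment_eq_real_ivl
    by (intro exI[of _ "(1 - t) * a + t * b"]) (auto simp: algebra_simps split: if_splits)
qed

lemma orthogonal_flips:
  "orthogonal_transformation (\<lambda>x::real^2. pt (x$1) (- x$2))"
  "orthogonal_transformation (\<lambda>x::real^2. pt (- x$1) (x$2))"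
  by (auto simp: orthogonal_transformation_def inner2 linear_iff vec2_eq)

text \<open>\<open>E\<close> is the region inside the outer boundary, \<open>H\<close> the closed
  hole, and the symmetry axis is horizontal. By \<open>xE\<close> and \<open>xH\<close> horizontal
  sections are intervals centred at \<open>c\<close> and \<open>k\<close>; \<open>yH\<close> gives
  the hole vertical sections centred on the axis. \<open>kc\<close> is attained by a flip of the
  first coordinate.\<close>

locale annulus =
  fixes E H :: "(real^2) set" and c k :: real and f :: "real \<Rightarrow> real" and U :: "real^2 \<Rightarrow> real"
  assumes openE: "open E" and bddE: "bounded E" and compH: "compact H" and HE: "H \<subseteq> E" and Hne: "H \<noteq> {}"
    and symE: "\<And>x. x \<in> E \<Longrightarrow> pt (x$1) (- x$2) \<in> E"
    and xE: "\<And>x s. x \<in> E \<Longrightarrow> \<bar>s - c\<bar> \<le> \<bar>x$1 - c\<bar> \<Longrightarrow> pt s (x$2) \<in> E"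
    and xH: "\<And>x s. x \<in> H \<Longrightarrow> \<bar>s - k\<bar> \<le> \<bar>x$1 - k\<bar> \<Longrightarrow> pt s (x$2) \<in> H"
    and yH: "\<And>x s. x \<in> H \<Longrightarrow> \<bar>s\<bar> \<le> \<bar>x$2\<bar> \<Longrightarrow> pt (x$1) s \<in> H"
    and kc: "k \<le> c"
    and f_anti: "\<And>s t. s \<le> t \<Longrightarrow> f t \<le> f s" and f_nonneg: "\<And>s. f s \<ge> 0" and f_pos: "f 0 > 0"
    and f_lip: "\<And>M. \<exists>C>0. \<forall>s\<in>{0..M}. \<forall>t\<in>{0..M}. \<bar>f s - f t\<bar> \<le> C * \<bar>s - t\<bar>"
    and contU: "continuous_on UNIV U" and U0: "\<And>x. x \<notin> E - H \<Longrightarrow> U x = 0"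
    and solU: "solves (E - H) f U"
begin

section \<open>Sign and reflections of the solution\<close>

lemma symH: "x \<in> H \<Longrightarrow> pt (x$1) (- x$2) \<in> H"
  using yH[of x "- x$2"] by simp

lemma center_in_H: "pt k 0 \<in> H"
proof -
  obtain x where "x \<in> H" using Hne by blast
  from xH[OF this, of k] have "pt k (x$2) \<in> H" by simp
  from yH[OF this, of 0] show ?thesis by simp
qed

lemma open_dom: "open (E - H)" and bounded_dom: "bounded (E - H)"
  using openE compH bddE by (auto intro: open_Diff compact_imp_closed bounded_subset)

lemma continuous_U_compose [continuous_intros]: "continuous_on S g \<Longrightarrow> continuous_on S (\<lambda>x. U (g x))"
  by (rule continuous_on_compose2[OF contU]) auto

lemma U_frontier: "x \<in> frontier (E - H) \<Longrightarrow> U x = 0"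
  using U0 open_dom by (auto simp: frontier_def interior_open)

lemma U_nonneg: "U x \<ge> 0"
proof (cases "x \<in> E - H")
  case True
  obtain g K where C: "C2_data U g K (E - H)" "\<And>x. x \<in> E - H \<Longrightarrow> trace2 (K x) = - f (U x)"
    using solU unfolding solves_def by metis
  have C': "C2_data (\<lambda>x. - U x) (\<lambda>x. - g x) (\<lambda>x v. - K x v) (E - H)"
    using C(1) unfolding C2_data_def by (auto intro!: continuous_intros derivative_eq_intros)
  have "- U x \<le> 0"
  proof (rule maximum_principle[OF open_dom bounded_dom _ C' _ _ True])
    show "continuous_on (closure (E - H)) (\<lambda>x. - U x)" by (intro continuous_intros)
    fix y assume "y \<in> E - H"
    then show "0 \<le> trace2 (\<lambda>v. - K y v)" using C(2)[of y] f_nonneg[of "U y"] by (simp add: trace2_def)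
  qed (use U_frontier in auto)
  then show ?thesis by simp
qed (use U0 in simp)

text \<open>An interior zero would be a minimum with nonnegative Laplacian, against
  \<open>- f 0 < 0\<close>. Thus \<open>f 0 > 0\<close> takes the place of a strong maximum
  principle.\<close>

lemma U_pos: assumes "x \<in> E - H" shows "U x > 0"
proof (rule ccontr)
  assume "\<not> U x > 0"
  then have "U x = 0" using U_nonneg[of x] by simp
  obtain g K where C: "C2_data U g K (E - H)" "\<And>x. x \<in> E - H \<Longrightarrow> trace2 (K x) = - f (U x)"
    using solU unfolding solves_def by metis
  have "- K x b \<bullet> b \<le> 0" for b
  proof (rule local_max_second_derivative[OF open_dom assms, where w="\<lambda>x. - U x" and g="\<lambda>x. - g x" and H="\<lambda>v. - K x v"])
    fix y assume "y \<in> E - H"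
    then show "((\<lambda>x. - U x) has_derivative (\<bullet>) (- g y)) (at y)"
    proof -
      have "(\<bullet>) (- g y) = (\<lambda>v. - (g y \<bullet> v))" by auto
      then show ?thesis using has_derivative_minus[OF C2_dataD(1)[OF C(1) \<open>y \<in> E - H\<close>]] by simp
    qed
  next
    show "((\<lambda>x. - g x) has_derivative (\<lambda>v. - K x v)) (at x)"
      using has_derivative_minus[OF C2_dataD(2)[OF C(1) assms]] .
  qed (use \<open>U x = 0\<close> U_nonneg in auto)
  from this[of "axis 1 1"] this[of "axis 2 1"] have "trace2 (K x) \<ge> 0" by (simp add: trace2_inner)
  then show False using C(2)[OF assms] f_pos \<open>U x = 0\<close> by simp
qed

text \<open>Uniqueness in disguise: the reflected function solves the same boundary value problem.
  Applied to a point and to its mirror image this becomes the equality \<open>U_sym\<close>.\<close>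

lemma U_le_reflected: "x \<in> E - H \<Longrightarrow> U x \<le> U (pt (x$1) (- x$2))"
proof -
  assume x: "x \<in> E - H"
  have dom: "{x. pt (x$1) (- x$2) + 0 \<in> E - H} = E - H"
    using symE symH by (auto; metis minus_minus pt_eta vector_2)
  have "U x - U (pt (x$1) (- x$2)) \<le> 0"
  proof (rule comparison[OF open_dom bounded_dom _ _ solU _ f_anti _ _ x])
    show "solves (E - H) f (\<lambda>x. U (pt (x$1) (- x$2)))"
      using solves_isometry[OF orthogonal_flips(1) solU, of 0] unfolding dom by simp
  qed (use U_frontier U_nonneg in \<open>auto intro!: continuous_intros\<close>)
  then show ?thesis by simp
qed

lemma U_sym: "U (pt (x$1) (- x$2)) = U x"
proof (cases "x \<in> E - H")
  case True
  then have "pt (x$1) (- x$2) \<in> E - H" using symE symH[of "pt (x$1) (- x$2)"] by auto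
  from U_le_reflected[OF this] U_le_reflected[OF True] show ?thesis by simp
next
  case False
  then have "pt (x$1) (- x$2) \<notin> E - H" using symE[of "pt (x$1) (- x$2)"] symH by auto
  then show ?thesis using U0 False by simp
qed

text \<open>Reflection in the line with abscissa \<open>k\<close> maps the part of the domain to its
  left into the domain, because \<open>H\<close> is symmetric in that line and \<open>E\<close> is
  centred at \<open>c \<ge> k\<close>. On the frontier of that part either \<open>U\<close> vanishes
  or the point is fixed, so one comparison suffices.\<close>

lemma U_reflect: assumes "x$1 \<le> k" shows "U x \<le> U (pt (2 * k - x$1) (x$2))"
proof (cases "x \<in> E - H \<and> x$1 < k")
  case False
  then consider "x \<notin> E - H" | "x$1 = k" using assms by fastforce
  then show ?thesis by cases (use U0 U_nonneg in auto)
next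
  case True
  define G where "G = (E - H) \<inter> {x. x$1 < k}"
  define \<rho> where "\<rho> x = pt (- x$1) (x$2) + pt (2 * k) 0" for x :: "real^2"
  have \<rho>: "\<rho> x = pt (2 * k - x$1) (x$2)" for x by (simp add: \<rho>_def)
  have G: "open G" "bounded G" unfolding G_def
    using open_dom bounded_dom open_halfspace_component_lt_cart[of 1 k] by (auto intro: bounded_subset)
  have \<rho>G: "\<rho> x \<in> E - H" if "x \<in> G" for x
  proof -
    have x: "x \<in> E" "x \<notin> H" "x$1 < k" using that by (auto simp: G_def)
    have "\<rho> x \<in> E" unfolding \<rho> by (rule xE[OF x(1)]) (use x kc in auto)
    moreover have "\<rho> x \<notin> H" using xH[of "\<rho> x" "x$1"] x by (auto simp: \<rho>)
    ultimately show ?thesis by simp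
  qed
  have "U x - U (\<rho> x) \<le> 0"
  proof (rule comparison[OF G, where u=U and v="\<lambda>x. U (\<rho> x)" and f=f])
    show "solves G f U" by (rule solves_mono[OF solU]) (auto simp: G_def)
    show "solves G f (\<lambda>x. U (\<rho> x))"
      using solves_isometry[OF orthogonal_flips(2) solU, of "pt (2 * k) 0"] unfolding \<rho>_def[symmetric]
      by (rule solves_mono) (use \<rho>G in auto)
    show "x \<in> G" using True by (simp add: G_def)
  next
    fix y assume y: "y \<in> frontier G"
    have "y \<notin> G" using y interior_open[OF G(1)] by (simp add: frontier_def)
    have "closure G \<subseteq> closure {x. x$1 < k}" by (rule closure_mono) (auto simp: G_def)
    then have "y \<in> closure {x. x$1 < k}" using y by (auto simp: frontier_def)
    moreover have "closure {x::real^2. x$1 < k} \<subseteq> {x. x$1 \<le> k}"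
      by (rule closure_minimal) (auto simp: closed_halfspace_component_le_cart)
    ultimately have "y$1 \<le> k" by blast
    then consider "y \<notin> E - H" | "y$1 = k" using \<open>y \<notin> G\<close> unfolding G_def by fastforce
    then show "U y - U (\<rho> y) \<le> 0" by cases (use U0 U_nonneg in \<open>auto simp: \<rho>\<close>)
  qed (auto intro!: continuous_intros f_anti simp: \<rho>)
  then show ?thesis by (simp add: \<rho>)
qed

section \<open>Exit points of nodal components and their position\<close>

definition W :: "real \<Rightarrow> real^2 \<Rightarrow> real" where "W h x = U (x + pt h 0) - U x"

lemma continuous_W: "continuous_on S (W h)"
  unfolding W_def by (intro continuous_intros)

lemma W_sym: "W h (pt (x$1) (- x$2)) = W h x"
  using U_sym[of x] U_sym[of "x + pt h 0"] by (simp add: W_def)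

lemma W_fold_up: "W h (fold_up x) = W h x"
  using W_sym[of h x] by (cases "x$2 \<ge> 0") (auto simp: fold_up_def)

lemma solves_shift: "C \<subseteq> {x. x + b \<in> E - H} \<Longrightarrow> solves C f (\<lambda>x. U (x + b))"
  using solves_mono[OF solves_translation[OF solU, of b]] by auto

lemma bounded_shift: "bounded {x. x + b \<in> E - H}"
proof -
  have "{x. x + b \<in> E - H} = (\<lambda>x. x - b) ` (E - H)" by (auto simp: image_iff intro!: bexI[of _ "_ + b"])
  then show ?thesis using bounded_translation_minus[OF bounded_dom, of b] by simp
qed

text \<open>A component on which both functions solve the equation would contradict the comparison principle.\<close>

lemma component_exit:
  assumes "open S" "x0 \<in> S" "bounded S"
    and cv: "continuous_on UNIV v" and cw: "continuous_on UNIV w"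
    and S: "\<And>x. x \<in> S \<longleftrightarrow> v x - w x > e" and "e \<ge> 0"
    and sol: "solves A f v" "solves B f w"
  shows "\<exists>x. path_component S x0 x \<and> x \<notin> A \<inter> B"
proof (rule ccontr)
  assume *: "\<not> ?thesis"
  define C where "C = connected_component_set S x0"
  have C: "open C" "connected C" "x0 \<in> C" "C \<subseteq> S"
    using assms by (auto simp: C_def open_connected_component connected_component_subset)
  have CAB: "C \<subseteq> A \<inter> B"
    using * C path_component_of_subset path_connected_component[of C] connected_open_path_connected[of C]
    by (metis subsetI)
  have "v x0 - w x0 \<le> e"
  proof (rule comparison[OF C(1), where u=v and v=w and f=f])
    show "bounded C" using C \<open>bounded S\<close> bounded_subset by blast
    show "continuous_on (closure C) v" "continuous_on (closure C) w"
      using cv cw continuous_on_subset by blast+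
    show "solves C f v" "solves C f w" using sol CAB solves_mono by blast+
    fix x assume "x \<in> frontier C"
    moreover have "frontier C \<subseteq> frontier S"
      by (rule frontier_of_components_subset) (use assms(2) in \<open>auto simp: C_def components_def\<close>)
    ultimately have "x \<notin> S" using \<open>open S\<close> by (auto simp: frontier_def interior_open)
    then show "v x - w x \<le> e" using S by force
  qed (use C assms f_anti in auto)
  then show False using S assms(2) by force
qed

text \<open>Positivity of \<open>W h\<close> already forces \<open>x + pt h 0\<close> into the
  domain, so leaving the overlap means that \<open>x\<close> itself is not in it.\<close>

lemma W_positive_exit:
  assumes "W h x0 > e" "e \<ge> 0"
  shows "\<exists>x. path_component {x. W h x > e} x0 x \<and> x \<notin> E - H \<and> x + pt h 0 \<in> E - H"
proof -
  define S where "S = {x. W h x > e}"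
  have Ssub: "S \<subseteq> {x. x + pt h 0 \<in> E - H}"
    using U0 U_nonneg \<open>e \<ge> 0\<close> unfolding S_def W_def by (smt (verit) mem_Collect_eq subsetI)
  have "\<exists>x. path_component S x0 x \<and> x \<notin> {x. x + pt h 0 \<in> E - H} \<inter> (E - H)"
  proof (rule component_exit[where v="\<lambda>x. U (x + pt h 0)" and w=U and e=e])
    show "open S" unfolding S_def using continuous_W by (intro open_Collect_less continuous_intros)
    show "bounded S" using Ssub bounded_shift bounded_subset by blast
    show "solves {x. x + pt h 0 \<in> E - H} f (\<lambda>x. U (x + pt h 0))" by (rule solves_shift) simp
  qed (use assms solU in \<open>auto simp: S_def W_def intro!: continuous_intros\<close>)
  then obtain x where "path_component S x0 x" "x \<notin> {x. x + pt h 0 \<in> E - H} \<inter> (E - H)" by blast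
  moreover have "x \<in> S" using path_component_mem(2) calculation by blast
  ultimately show ?thesis using Ssub unfolding S_def by blast
qed

lemma W_negative_exit:
  assumes "W h x0 < - e" "e \<ge> 0"
  shows "\<exists>x. path_component {x. W h x < - e} x0 x \<and> x \<in> E - H \<and> x + pt h 0 \<notin> E - H"
proof -
  define S where "S = {x. W h x < - e}"
  have Ssub: "S \<subseteq> E - H"
    using U0 U_nonneg \<open>e \<ge> 0\<close> unfolding S_def W_def by (smt (verit) mem_Collect_eq subsetI)
  have "\<exists>x. path_component S x0 x \<and> x \<notin> (E - H) \<inter> {x. x + pt h 0 \<in> E - H}"
  proof (rule component_exit[where v=U and w="\<lambda>x. U (x + pt h 0)" and e=e])
    show "open S" unfolding S_def using continuous_W by (intro open_Collect_less continuous_intros)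
    show "bounded S" using Ssub bounded_dom bounded_subset by blast
    show "solves {x. x + pt h 0 \<in> E - H} f (\<lambda>x. U (x + pt h 0))" by (rule solves_shift) simp
  qed (use assms solU in \<open>auto simp: S_def W_def intro!: continuous_intros\<close>)
  then obtain x where "path_component S x0 x" "x \<notin> (E - H) \<inter> {x. x + pt h 0 \<in> E - H}" by blast
  moreover have "x \<in> S" using path_component_mem(2) calculation by blast
  ultimately show ?thesis using Ssub unfolding S_def by blast
qed

text \<open>A translation that leaves \<open>E\<close> increases the distance from the abscissa
  \<open>c\<close>, and one that enters \<open>H\<close> decreases the distance from
  \<open>k\<close>; this fixes the side of \<open>c - h/2\<close> or \<open>k - h/2\<close>.\<close>

lemma W_negative_exit_cases:
  assumes "h > 0" "y \<in> E - H" "y + pt h 0 \<notin> E - H"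
  shows "(y + pt h 0 \<notin> E \<and> y$1 > c - h/2) \<or> (y + pt h 0 \<in> H \<and> y$1 < k - h/2)"
proof (cases "y + pt h 0 \<in> E")
  case True
  then have H: "y + pt h 0 \<in> H" using assms by simp
  have "\<not> \<bar>y$1 - k\<bar> \<le> \<bar>y$1 + h - k\<bar>" using xH[OF H, of "y$1"] assms by auto
  then show ?thesis using H assms(1) by auto
next
  case False
  have "\<not> \<bar>y$1 + h - c\<bar> \<le> \<bar>y$1 - c\<bar>"
    using xE[of y "y$1 + h"] assms False pt_collapse[of "y + pt h 0" "y$1 + h" "y$2"] by auto
  then show ?thesis using False assms(1) by auto
qed

lemma W_positive_exit_cases:
  assumes "h > 0" "x \<notin> E - H" "x + pt h 0 \<in> E - H"
  shows "(x \<notin> E \<and> x$1 < c - h/2) \<or> (x \<in> H \<and> x$1 > k - h/2)"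
proof (cases "x \<in> E")
  case True
  then have H: "x \<in> H" using assms by simp
  have "\<not> \<bar>x$1 + h - k\<bar> \<le> \<bar>x$1 - k\<bar>"
    using xH[OF H, of "x$1 + h"] assms pt_collapse[of "x + pt h 0" "x$1 + h" "x$2"] by auto
  then show ?thesis using H assms(1) by auto
next
  case False
  have "\<not> \<bar>x$1 - c\<bar> \<le> \<bar>x$1 + h - c\<bar>"
    using xE[of "x + pt h 0" "x$1"] assms False by auto
  then show ?thesis using False assms(1) by auto
qed

text \<open>On this line the translation by \<open>h\<close> coincides with the reflection of
  \<open>U_reflect\<close>.\<close>

lemma W_barrier: assumes "h > 0" "x$1 = k - h/2" shows "W h x \<ge> 0"
proof -
  have "x + pt h 0 = pt (2 * k - x$1) (x$2)" using assms by (simp add: vec2_eq)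
  then show ?thesis using U_reflect[of x] assms by (simp add: W_def)
qed

text \<open>A path that changes sides would meet the line of \<open>W_barrier\<close>, where
  \<open>W h\<close> is nonnegative.\<close>

lemma W_negative_side:
  assumes "h > 0" "e \<ge> 0" "path_component {x. W h x < - e} x y"
  shows "x$1 > k - h/2 \<longleftrightarrow> y$1 > k - h/2" "x$1 < k - h/2 \<longleftrightarrow> y$1 < k - h/2"
proof -
  obtain p where p: "path p" "path_image p \<subseteq> {x. W h x < - e}" "pathstart p = x" "pathfinish p = y"
    using assms(3) unfolding path_component_def by auto
  have con: "connected (path_image p)" using p by auto
  have mem: "x \<in> path_image p" "y \<in> path_image p" using p by (metis pathstart_in_path_image pathfinish_in_path_image)+
  have no: "\<nexists>z. z \<in> path_image p \<and> z$1 = k - h/2"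
    using W_barrier[OF assms(1)] p(2) \<open>e \<ge> 0\<close> by (smt (verit) mem_Collect_eq subsetD)
  have "\<not> (a$1 \<le> k - h/2 \<and> k - h/2 \<le> b$1)" if "a \<in> path_image p" "b \<in> path_image p" for a b
    using connected_ivt_component_cart[OF con that, of 1 "k - h/2"] no by auto
  from this[OF mem] this[OF mem(2,1)] show "x$1 > k - h/2 \<longleftrightarrow> y$1 > k - h/2" "x$1 < k - h/2 \<longleftrightarrow> y$1 < k - h/2"
    using no mem by force+
qed

text \<open>The route from an exit point to a far point of the axis: horizontally away from the
  centre, then down beyond the extent of \<open>E\<close>. Sections of \<open>E\<close> being
  intervals about \<open>c\<close>, the translate stays outside \<open>E\<close> on the way.\<close>

lemma path_right:
  assumes "h > 0" "y$2 \<ge> 0" "y$1 > c - h/2" "y + pt h 0 \<notin> E" "y$1 \<le> R" "\<And>x. x \<in> E \<Longrightarrow> x$1 < R"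
  shows "path_component {x. x$2 \<ge> 0 \<and> x$1 > c - h/2 \<and> x + pt h 0 \<notin> E} y (pt R 0)"
    (is "path_component ?S _ _")
proof -
  have "closed_segment (pt (y$1) (y$2)) (pt R (y$2)) \<subseteq> ?S"
  proof
    fix z assume "z \<in> closed_segment (pt (y$1) (y$2)) (pt R (y$2))"
    from closed_segment_horizontal[OF this] obtain s where s: "z = pt s (y$2)" "y$1 \<le> s"
      using assms(5) by (auto simp: min_def split: if_splits)
    have "pt (s + h) (y$2) \<notin> E"
    proof
      assume "pt (s + h) (y$2) \<in> E"
      from xE[OF this, of "y$1 + h"] have "pt (y$1 + h) (y$2) \<in> E" using s assms by auto
      then show False using assms(4) pt_collapse[of "y + pt h 0" "y$1 + h" "y$2"] by simp
    qed
    then show "z \<in> ?S" using s assms by simp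
  qed
  from path_component_segment[OF this] have 1: "path_component ?S y (pt R (y$2))" by simp
  have "closed_segment (pt R (y$2)) (pt R 0) \<subseteq> ?S"
  proof
    fix z assume "z \<in> closed_segment (pt R (y$2)) (pt R 0)"
    from closed_segment_vertical[OF this] obtain s where s: "z = pt R s" "0 \<le> s"
      using assms(2) by (auto simp: min_def split: if_splits)
    have "pt (R + h) s \<notin> E" using assms(6)[of "pt (R + h) s"] assms(1) by auto
    then show "z \<in> ?S" using s assms by simp
  qed
  then have "path_component ?S (pt R (y$2)) (pt R 0)" by (rule path_component_segment)
  with 1 show ?thesis by (rule path_component_trans)
qed

lemma path_left:
  assumes "h > 0" "y$2 \<ge> 0" "y$1 < c - h/2" "y \<notin> E" "- R \<le> y$1" "\<And>x. x \<in> E \<Longrightarrow> - R < x$1"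
  shows "path_component {x. x$2 \<ge> 0 \<and> x$1 < c - h/2 \<and> x \<notin> E} y (pt (- R) 0)"
    (is "path_component ?S _ _")
proof -
  have "closed_segment (pt (y$1) (y$2)) (pt (- R) (y$2)) \<subseteq> ?S"
  proof
    fix z assume "z \<in> closed_segment (pt (y$1) (y$2)) (pt (- R) (y$2))"
    from closed_segment_horizontal[OF this] obtain s where s: "z = pt s (y$2)" "s \<le> y$1"
      using assms(5) by (auto simp: max_def)
    have "pt s (y$2) \<notin> E"
    proof
      assume "pt s (y$2) \<in> E"
      from xE[OF this, of "y$1"] show False using s assms by auto
    qed
    then show "z \<in> ?S" using s assms by simp
  qed
  from path_component_segment[OF this] have 1: "path_component ?S y (pt (- R) (y$2))" by simp
  have "closed_segment (pt (- R) (y$2)) (pt (- R) 0) \<subseteq> ?S"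
  proof
    fix z assume "z \<in> closed_segment (pt (- R) (y$2)) (pt (- R) 0)"
    from closed_segment_vertical[OF this] obtain s where s: "z = pt (- R) s" "0 \<le> s"
      using assms(2) by (auto simp: min_def split: if_splits)
    have "pt (- R) s \<notin> E" using assms(6)[of "pt (- R) s"] by auto
    then show "z \<in> ?S" using s assms by simp
  qed
  then have "path_component ?S (pt (- R) (y$2)) (pt (- R) 0)" by (rule path_component_segment)
  with 1 show ?thesis by (rule path_component_trans)
qed

text \<open>Vertical sections of \<open>H\<close> are intervals about the axis. For exits of
  positive components this is used with \<open>h = 0\<close>.\<close>

lemma path_down:
  assumes "y$2 \<ge> 0" "y + pt h 0 \<in> H"
  shows "path_component {x. x$2 \<ge> 0 \<and> x$1 = y$1 \<and> x + pt h 0 \<in> H} y (pt (y$1) 0)"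
proof -
  have "closed_segment (pt (y$1) (y$2)) (pt (y$1) 0) \<subseteq> {x. x$2 \<ge> 0 \<and> x$1 = y$1 \<and> x + pt h 0 \<in> H}"
  proof
    fix z assume "z \<in> closed_segment (pt (y$1) (y$2)) (pt (y$1) 0)"
    from closed_segment_vertical[OF this] obtain s where s: "z = pt (y$1) s" "0 \<le> s" "s \<le> y$2"
      using assms(1) by (auto simp: min_def max_def split: if_splits)
    have "pt ((y + pt h 0)$1) s \<in> H" by (rule yH[OF assms(2)]) (use s in auto)
    then show "z \<in> {x. x$2 \<ge> 0 \<and> x$1 = y$1 \<and> x + pt h 0 \<in> H}" using s by simp
  qed
  from path_component_segment[OF this] show ?thesis by simp
qed

lemma fold_up_in: "fold_up x \<in> E \<longleftrightarrow> x \<in> E" "fold_up x \<in> H \<longleftrightarrow> x \<in> H"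
  "fold_up x + pt h 0 \<in> E \<longleftrightarrow> x + pt h 0 \<in> E" "fold_up x + pt h 0 \<in> H \<longleftrightarrow> x + pt h 0 \<in> H"
proof -
  have *: "fold_up x \<in> E \<longleftrightarrow> x \<in> E" "fold_up x \<in> H \<longleftrightarrow> x \<in> H" for x
    using symE[of x] symH[of x] symE[of "pt (x$1) (- x$2)"] symH[of "pt (x$1) (- x$2)"]
    by (cases "x$2 \<ge> 0"; auto simp: fold_up_def)+
  have "fold_up x + pt h 0 = fold_up (x + pt h 0)" by (simp add: fold_up_def vec2_eq)
  then show "fold_up x \<in> E \<longleftrightarrow> x \<in> E" "fold_up x \<in> H \<longleftrightarrow> x \<in> H"
  "fold_up x + pt h 0 \<in> E \<longleftrightarrow> x + pt h 0 \<in> E" "fold_up x + pt h 0 \<in> H \<longleftrightarrow> x + pt h 0 \<in> H"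
    using * by auto
qed

text \<open>Were there a negative point \<open>n\<close> to the left of a positive point \<open>p\<close>, the nodal components of
  \<open>W h\<close> through them would leave the overlap of the domain with its translate. Folded into the upper half
  plane and prolonged outside the domain down to the axis, they become disjoint connected sets
  whose end points interlace on the axis.\<close>

lemma no_crossing:
  assumes h: "h > 0" and small: "\<And>x. x \<in> H \<Longrightarrow> x + pt h 0 \<in> E" "\<And>x. x \<in> H \<Longrightarrow> x - pt h 0 \<in> E"
    and e: "e \<ge> 0" "d \<ge> 0"
    and n: "W h n < - e" and p: "W h p > d" and np: "n$1 < p$1"
    and Vn: "\<And>s. 0 \<le> s \<Longrightarrow> s \<le> \<bar>n$2\<bar> \<Longrightarrow>
      pt (n$1) s \<in> E - H \<and> pt (n$1 + h) s \<in> E - H \<and> W h (pt (n$1) s) \<le> d"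
    and Vp: "\<And>s. 0 \<le> s \<Longrightarrow> s \<le> \<bar>p$2\<bar> \<Longrightarrow>
      pt (p$1) s \<in> E - H \<and> pt (p$1 + h) s \<in> E - H \<and> W h (pt (p$1) s) \<ge> - e"
    and side: "(\<forall>x. pt x 0 \<in> H \<longrightarrow> x < n$1) \<or> (\<forall>x. pt x 0 \<in> H \<longrightarrow> p$1 + h < x)"
  shows False
proof -
  obtain R0 where R0: "\<And>x. x \<in> E \<Longrightarrow> \<bar>x$1\<bar> < R0"
  proof -
    obtain B where "\<And>x. x \<in> E \<Longrightarrow> norm x < B" using bddE bounded_pos_less by blast
    then show ?thesis using that[of B] component_le_norm_cart order_le_less_trans by blast
  qed
  define R where "R = R0 + 1 + \<bar>c\<bar> + h"
  have R: "\<And>x. x \<in> E \<Longrightarrow> x$1 < R" "\<And>x. x \<in> E \<Longrightarrow> - R < x$1" "\<And>x. x + pt h 0 \<in> E \<Longrightarrow> - R < x$1"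
    using R0 h unfolding R_def by (smt (verit) vector_2(1) vector_add_component)+
  obtain y where y: "path_component {x. W h x < - e} n y" "y \<in> E - H" "y + pt h 0 \<notin> E - H"
    using W_negative_exit[OF n e(1)] by blast
  obtain x where x: "path_component {x. W h x > d} p x" "x \<notin> E - H" "x + pt h 0 \<in> E - H"
    using W_positive_exit[OF p e(2)] by blast
  \<comment> \<open>The feet that join the folded points \<open>n\<close> and \<open>p\<close> to
    the axis. The thresholds make them harmless: \<open>W h \<le> d\<close> on the foot of
    \<open>n\<close> keeps it off \<open>P\<close>, and \<open>W h \<ge> - e\<close> on the foot of
    \<open>p\<close> keeps it off \<open>N\<close>.\<close>
  define VN where "VN = {z::real^2. z$1 = n$1 \<and> 0 \<le> z$2 \<and> z$2 \<le> \<bar>n$2\<bar>}"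
  define VP where "VP = {z::real^2. z$1 = p$1 \<and> 0 \<le> z$2 \<and> z$2 \<le> \<bar>p$2\<bar>}"
  have VN: "z \<in> E - H" "z + pt h 0 \<in> E - H" "W h z \<le> d" if "z \<in> VN" for z
  proof -
    have "z = pt (n$1) (z$2)" "z + pt h 0 = pt (n$1 + h) (z$2)" using that by (auto simp: VN_def vec2_eq)
    then show "z \<in> E - H" "z + pt h 0 \<in> E - H" "W h z \<le> d" using Vn[of "z$2"] that by (auto simp: VN_def)
  qed
  have VP: "z \<in> E - H" "z + pt h 0 \<in> E - H" "W h z \<ge> - e" if "z \<in> VP" for z
  proof -
    have "z = pt (p$1) (z$2)" "z + pt h 0 = pt (p$1 + h) (z$2)" using that by (auto simp: VP_def vec2_eq)
    then show "z \<in> E - H" "z + pt h 0 \<in> E - H" "W h z \<ge> - e" using Vp[of "z$2"] that by (auto simp: VP_def)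
  qed
  \<comment> \<open>Prolongations beyond the exit points, \<open>XR\<close> and \<open>XL\<close>
    for the negative component, \<open>YE\<close> and \<open>YH\<close> for the positive one. The
    abscissa \<open>c - h/2\<close> separates \<open>XR\<close> from \<open>YE\<close>, the abscissa
    \<open>k - h/2\<close> separates \<open>XL\<close> from \<open>YH\<close>, and
    \<open>small\<close> settles the two mixed pairs.\<close>
  define XR where "XR = {x. x$2 \<ge> 0 \<and> x$1 > c - h/2 \<and> x + pt h 0 \<notin> E}"
  define XL where "XL = {x. x$2 \<ge> 0 \<and> x$1 < k - h/2 \<and> x + pt h 0 \<in> H}"
  define YE where "YE = {x. x$2 \<ge> 0 \<and> x$1 < c - h/2 \<and> x \<notin> E}"
  define YH where "YH = {x. x$2 \<ge> 0 \<and> x$1 > k - h/2 \<and> x \<in> H}"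
  define N where "N = {x. x$2 \<ge> 0 \<and> W h x < - e}"
  define P where "P = {x. x$2 \<ge> 0 \<and> W h x > d}"
  have startN: "path_component (VN \<union> N) (pt (n$1) 0) (fold_up y)"
  proof -
    have "path_component VN (pt (n$1) 0) (fold_up n)" unfolding fold_up_def
    proof (rule path_component_segment, rule subsetI)
      fix z assume "z \<in> closed_segment (pt (n$1) 0) (pt (n$1) \<bar>n$2\<bar>)"
      from closed_segment_vertical[OF this] show "z \<in> VN" by (auto simp: VN_def)
    qed
    moreover have "path_component {x \<in> {x. W h x < - e}. x$2 \<ge> 0} (fold_up n) (fold_up y)"
      by (rule path_component_fold_up[OF y(1)]) (simp add: W_fold_up)
    ultimately show ?thesis
      using path_component_of_subset[of VN "VN \<union> N"] path_component_of_subset[of "{x \<in> {x. W h x < - e}. x$2 \<ge> 0}" "VN \<union> N"]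
        path_component_trans by (fastforce simp: N_def)
  qed
  have startP: "path_component (VP \<union> P) (pt (p$1) 0) (fold_up x)"
  proof -
    have "path_component VP (pt (p$1) 0) (fold_up p)" unfolding fold_up_def
    proof (rule path_component_segment, rule subsetI)
      fix z assume "z \<in> closed_segment (pt (p$1) 0) (pt (p$1) \<bar>p$2\<bar>)"
      from closed_segment_vertical[OF this] show "z \<in> VP" by (auto simp: VP_def)
    qed
    moreover have "path_component {x \<in> {x. W h x > d}. x$2 \<ge> 0} (fold_up p) (fold_up x)"
      by (rule path_component_fold_up[OF x(1)]) (simp add: W_fold_up)
    ultimately show ?thesis
      using path_component_of_subset[of VP "VP \<union> P"] path_component_of_subset[of "{x \<in> {x. W h x > d}. x$2 \<ge> 0}" "VP \<union> P"]
        path_component_trans by (fastforce simp: P_def)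
  qed
  have fy: "(fold_up y)$2 \<ge> 0" "(fold_up y)$1 = y$1" and fx: "(fold_up x)$2 \<ge> 0" "(fold_up x)$1 = x$1"
    by (auto simp: fold_up_def)
  define X where "X = VN \<union> N \<union> XR \<union> XL"
  define Y where "Y = VP \<union> P \<union> YE \<union> YH"
  have disj: "X \<inter> Y = {}"
  proof -
    have 1: "N \<subseteq> E - H" "P \<subseteq> {x. x + pt h 0 \<in> E - H}"
      using U0 U_nonneg e unfolding N_def P_def W_def by (smt (verit) mem_Collect_eq subsetI)+
    have "z \<notin> Y" if "z \<in> VN" for z
      using VN[OF that] that np unfolding Y_def VP_def P_def YE_def YH_def VN_def by auto
    moreover have "z \<notin> Y" if "z \<in> N" for z
      using that 1(1) VP[of z] e unfolding Y_def N_def P_def YE_def YH_def by fastforce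
    moreover have "z \<notin> Y" if "z \<in> XR" for z
    proof -
      have "z \<notin> H" using small(1) that by (auto simp: XR_def)
      then show ?thesis using that 1(2) VP[of z] unfolding Y_def XR_def YE_def YH_def by auto
    qed
    moreover have "z \<notin> Y" if "z \<in> XL" for z
    proof -
      have "z \<in> E" using small(2)[of "z + pt h 0"] that by (auto simp: XL_def)
      then show ?thesis using that 1(2) VP[of z] unfolding Y_def XL_def YE_def YH_def by auto
    qed
    ultimately show ?thesis unfolding X_def by blast
  qed
  have upX: "z$2 \<ge> 0" if "z \<in> X" for z using that by (auto simp: X_def VN_def N_def XR_def XL_def)
  have upY: "z$2 \<ge> 0" if "z \<in> Y" for z using that by (auto simp: Y_def VP_def P_def YE_def YH_def)
  have endP: "(path_component Y (pt (p$1) 0) (pt (- R) 0)) \<or>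
      (x$1 > k - h/2 \<and> pt (x$1) 0 \<in> H \<and> path_component Y (pt (p$1) 0) (pt (x$1) 0))"
    using W_positive_exit_cases[OF h x(2,3)]
  proof
    assume *: "x \<notin> E \<and> x$1 < c - h/2"
    have pY: "path_component YE (fold_up x) (pt (- R) 0)" unfolding YE_def
      by (rule path_left[OF h]) (use * fx R x fold_up_in(1)[of x] in \<open>auto intro: less_imp_le\<close>)
    have "path_component Y (pt (p$1) 0) (pt (- R) 0)"
      by (rule path_component_trans[OF path_component_of_subset[OF _ startP] path_component_of_subset[OF _ pY]])
        (auto simp: Y_def)
    then show ?thesis by blast
  next
    assume *: "x \<in> H \<and> x$1 > k - h/2"
    have pc: "path_component {z. z$2 \<ge> 0 \<and> z$1 = (fold_up x)$1 \<and> z + pt 0 0 \<in> H} (fold_up x) (pt ((fold_up x)$1) 0)"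
      by (rule path_down) (use * fx fold_up_in(2)[of x] in auto)
    have sub: "{z. z$2 \<ge> 0 \<and> z$1 = (fold_up x)$1 \<and> z + pt 0 0 \<in> H} \<subseteq> YH"
      using * by (auto simp: YH_def fx)
    have pY: "path_component YH (fold_up x) (pt (x$1) 0)"
      using path_component_of_subset[OF sub pc] by (simp only: fx(2))
    have "pt (x$1) 0 \<in> H" using yH[of x 0] * by simp
    moreover have "path_component Y (pt (p$1) 0) (pt (x$1) 0)"
      by (rule path_component_trans[OF path_component_of_subset[OF _ startP] path_component_of_subset[OF _ pY]])
        (auto simp: Y_def)
    ultimately show ?thesis using * by blast
  qed
  from side show False
  proof
    \<comment> \<open>The hole lies left of \<open>n\<close>. The barrier sends the negative
      component out through the outer boundary on the right, while the positive one starts at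
      \<open>p\<close>, right of \<open>n\<close>, and ends left of \<open>n\<close>.\<close>
    assume right: "\<forall>x. pt x 0 \<in> H \<longrightarrow> x < n$1"
    then have "k < n$1" using center_in_H by blast
    then have "y$1 > k - h/2" using W_negative_side(1)[OF h e(1) y(1)] h by simp
    then have *: "y + pt h 0 \<notin> E \<and> y$1 > c - h/2" using W_negative_exit_cases[OF h y(2,3)] by auto
    have pX: "path_component XR (fold_up y) (pt R 0)" unfolding XR_def
      by (rule path_right[OF h]) (use * fy R y fold_up_in(3)[of y] in \<open>auto intro: less_imp_le\<close>)
    have endN: "path_component X (pt (n$1) 0) (pt R 0)"
      by (rule path_component_trans[OF path_component_of_subset[OF _ startN] path_component_of_subset[OF _ pX]])
        (auto simp: X_def)
    have "pt (p$1) 0 \<in> E" "pt (n$1) 0 \<in> E" using Vp[of 0] Vn[of 0] by auto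
    then have ord: "p$1 < R" "- R < n$1" using R(1,2) by force+
    from endP show False
    proof
      assume "path_component Y (pt (p$1) 0) (pt (- R) 0)"
      from half_plane_interlace[OF upY upX path_component_sym[OF this] endN] show False
        using ord np disj by auto
    next
      assume *: "x$1 > k - h/2 \<and> pt (x$1) 0 \<in> H \<and> path_component Y (pt (p$1) 0) (pt (x$1) 0)"
      then have "path_component Y (pt (x$1) 0) (pt (p$1) 0)" using path_component_sym by blast
      from half_plane_interlace[OF upY upX this endN] show False
        using ord np disj right * by auto
    qed
  next
    \<comment> \<open>The hole lies right of \<open>p\<close>. Now the negative component ends at
      the hole, right of \<open>p\<close>, while the positive one ends far left of \<open>n\<close>
      or, being beyond \<open>k - h/2\<close>, farther right in the hole.\<close>
    assume left: "\<forall>x. pt x 0 \<in> H \<longrightarrow> p$1 + h < x"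
    then have "p$1 + h < k" using center_in_H by blast
    then have "y$1 < k - h/2" using W_negative_side(2)[OF h e(1) y(1)] h np by simp
    then have *: "y + pt h 0 \<in> H \<and> y$1 < k - h/2" using W_negative_exit_cases[OF h y(2,3)] kc by auto
    have pc: "path_component {z. z$2 \<ge> 0 \<and> z$1 = (fold_up y)$1 \<and> z + pt h 0 \<in> H} (fold_up y) (pt ((fold_up y)$1) 0)"
      by (rule path_down) (use * fy fold_up_in(4)[of y] in auto)
    have sub: "{z. z$2 \<ge> 0 \<and> z$1 = (fold_up y)$1 \<and> z + pt h 0 \<in> H} \<subseteq> XL"
      using * by (auto simp: XL_def fy)
    have pX: "path_component XL (fold_up y) (pt (y$1) 0)"
      using path_component_of_subset[OF sub pc] by (simp only: fy(2))
    have endN: "path_component X (pt (n$1) 0) (pt (y$1) 0)"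
      by (rule path_component_trans[OF path_component_of_subset[OF _ startN] path_component_of_subset[OF _ pX]])
        (auto simp: X_def)
    have "pt (y$1 + h) 0 \<in> H" using yH[of "y + pt h 0" 0] * by simp
    then have ord: "p$1 < y$1" using left by force
    have "pt (n$1) 0 \<in> E" using Vn[of 0] by auto
    then have ord2: "- R < n$1" using R(2) by force
    from endP show False
    proof
      assume "path_component Y (pt (p$1) 0) (pt (- R) 0)"
      from half_plane_interlace[OF upY upX path_component_sym[OF this] endN] show False
        using ord ord2 np disj by auto
    next
      assume **: "x$1 > k - h/2 \<and> pt (x$1) 0 \<in> H \<and> path_component Y (pt (p$1) 0) (pt (x$1) 0)"
      then have "path_component Y (pt (p$1) 0) (pt (x$1) 0)" by blast
      from half_plane_interlace[OF upX upY endN this] show False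
        using ord np disj * ** by auto
    qed
  qed
qed

end

section \<open>The horizontal derivative on the axis\<close>

text \<open>The mean value theorem twice, first along \<open>a\<close> and then along
  \<open>b\<close>. The left side does not change when \<open>a\<close> and \<open>b\<close> are
  exchanged.\<close>

lemma second_difference_mean_value:
  assumes C: "C2_data u g H D" and sub: "ball x r \<subseteq> D" and t: "0 < t" "t * (norm a + norm b) < r"
  shows "\<exists>z. dist x z \<le> t * (norm a + norm b) \<and>
    u (x + t *\<^sub>R a + t *\<^sub>R b) - u (x + t *\<^sub>R a) - u (x + t *\<^sub>R b) + u x = t\<^sup>2 * (H z b \<bullet> a)"
proof -
  have inD: "x + s *\<^sub>R a + s' *\<^sub>R b \<in> D" "dist x (x + s *\<^sub>R a + s' *\<^sub>R b) \<le> t * (norm a + norm b)"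
    if "0 \<le> s" "s \<le> t" "0 \<le> s'" "s' \<le> t" for s s'
  proof -
    have "norm (s *\<^sub>R a + s' *\<^sub>R b) \<le> s * norm a + s' * norm b"
      using norm_triangle_ineq[of "s *\<^sub>R a" "s' *\<^sub>R b"] that by simp
    also have "\<dots> \<le> t * norm a + t * norm b" using that by (intro add_mono mult_right_mono) auto
    finally show d: "dist x (x + s *\<^sub>R a + s' *\<^sub>R b) \<le> t * (norm a + norm b)"
      using norm_minus_cancel[of "s *\<^sub>R a + s' *\<^sub>R b"] by (simp add: dist_norm algebra_simps)
    show "x + s *\<^sub>R a + s' *\<^sub>R b \<in> D" using sub d t(2) by auto
  qed
  define \<phi> where "\<phi> s = u (x + s *\<^sub>R a + t *\<^sub>R b) - u (x + s *\<^sub>R a)" for s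
  have "\<exists>\<xi>. 0 < \<xi> \<and> \<xi> < t \<and> \<phi> t - \<phi> 0 = (t - 0) * ((g (x + \<xi> *\<^sub>R a + t *\<^sub>R b) - g (x + \<xi> *\<^sub>R a)) \<bullet> a)"
  proof (rule MVT2[OF t(1)])
    fix s assume s: "0 \<le> s" "s \<le> t"
    have "((\<lambda>s. u (x + s *\<^sub>R a + c)) has_derivative (\<lambda>h. g (x + s *\<^sub>R a + c) \<bullet> (h *\<^sub>R a))) (at s)"
      if "x + s *\<^sub>R a + c \<in> D" for c
      by (rule has_derivative_compose[where f="\<lambda>s. x + s *\<^sub>R a + c" and g=u, OF _ C2_dataD(1)[OF C that]])
        (auto intro!: derivative_eq_intros)
    from has_derivative_diff[OF this[of "t *\<^sub>R b"] this[of 0]]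
    show "(\<phi> has_real_derivative (g (x + s *\<^sub>R a + t *\<^sub>R b) - g (x + s *\<^sub>R a)) \<bullet> a) (at s)"
      using inD(1)[OF s, of t] inD(1)[OF s, of 0] t(1)
      unfolding \<phi>_def has_field_derivative_def
      by (auto simp: inner_diff_left algebra_simps elim!: has_derivative_eq_rhs)
  qed
  then obtain \<xi> where \<xi>: "0 < \<xi>" "\<xi> < t"
    "\<phi> t - \<phi> 0 = t * ((g (x + \<xi> *\<^sub>R a + t *\<^sub>R b) - g (x + \<xi> *\<^sub>R a)) \<bullet> a)" by auto
  define \<psi> where "\<psi> s = g (x + \<xi> *\<^sub>R a + s *\<^sub>R b) \<bullet> a" for s
  have "\<exists>\<eta>. 0 < \<eta> \<and> \<eta> < t \<and> \<psi> t - \<psi> 0 = (t - 0) * (H (x + \<xi> *\<^sub>R a + \<eta> *\<^sub>R b) b \<bullet> a)"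
  proof (rule MVT2[OF t(1)])
    fix s assume s: "0 \<le> s" "s \<le> t"
    have inx: "x + \<xi> *\<^sub>R a + s *\<^sub>R b \<in> D" using inD(1)[of \<xi> s] \<xi> s by simp
    have "((\<lambda>s. g (x + \<xi> *\<^sub>R a + s *\<^sub>R b)) has_derivative (\<lambda>h. H (x + \<xi> *\<^sub>R a + s *\<^sub>R b) (h *\<^sub>R b))) (at s)"
      by (rule has_derivative_compose[where f="\<lambda>s. x + \<xi> *\<^sub>R a + s *\<^sub>R b" and g=g, OF _ C2_dataD(2)[OF C inx]])
        (auto intro!: derivative_eq_intros)
    from has_derivative_inner_left[OF this, of a]
    show "(\<psi> has_real_derivative H (x + \<xi> *\<^sub>R a + s *\<^sub>R b) b \<bullet> a) (at s)"
      unfolding \<psi>_def has_field_derivative_def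
      using linear_cmul[OF C2_data_linear[OF C inx]] by (simp add: mult_commute_abs)
  qed
  then obtain \<eta> where \<eta>: "0 < \<eta>" "\<eta> < t" "\<psi> t - \<psi> 0 = t * (H (x + \<xi> *\<^sub>R a + \<eta> *\<^sub>R b) b \<bullet> a)" by auto
  have "\<phi> t - \<phi> 0 = t\<^sup>2 * (H (x + \<xi> *\<^sub>R a + \<eta> *\<^sub>R b) b \<bullet> a)"
    using \<xi>(3) \<eta>(3) by (simp add: \<psi>_def inner_diff_left power2_eq_square)
  moreover have "\<phi> t - \<phi> 0 = u (x + t *\<^sub>R a + t *\<^sub>R b) - u (x + t *\<^sub>R a) - u (x + t *\<^sub>R b) + u x"
    by (simp add: \<phi>_def)
  ultimately show ?thesis using inD(2)[of \<xi> \<eta>] \<xi> \<eta> by (intro exI[of _ "x + \<xi> *\<^sub>R a + \<eta> *\<^sub>R b"]) auto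
qed

text \<open>Schwarz's theorem: the two evaluations of one mixed difference are compared for small
  \<open>t\<close>. It is what reduces the Cauchy-Riemann derivative of a gradient pair to the
  Laplacian.\<close>

lemma hessian_symmetric:
  assumes C: "C2_data u g H D" and "open D" "x \<in> D"
  shows "H x b \<bullet> a = H x a \<bullet> b"
proof (rule ccontr)
  assume neq: "H x b \<bullet> a \<noteq> H x a \<bullet> b"
  define \<epsilon> where "\<epsilon> = \<bar>H x b \<bullet> a - H x a \<bullet> b\<bar> / 2"
  have \<epsilon>: "\<epsilon> > 0" using neq by (simp add: \<epsilon>_def)
  have cont: "isCont (\<lambda>x. H x b \<bullet> a) x" "isCont (\<lambda>x. H x a \<bullet> b) x"
  proof -
    have "isCont (\<lambda>x. H x v) x" for v
      using C \<open>open D\<close> \<open>x \<in> D\<close> unfolding C2_data_def by (simp add: continuous_on_eq_continuous_at)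
    then show "isCont (\<lambda>x. H x b \<bullet> a) x" "isCont (\<lambda>x. H x a \<bullet> b) x" by (auto intro!: continuous_intros)
  qed
  obtain d1 where d1: "d1 > 0" "\<And>z. dist z x < d1 \<Longrightarrow> \<bar>H z b \<bullet> a - H x b \<bullet> a\<bar> < \<epsilon>"
    using cont(1) \<epsilon> unfolding continuous_at_eps_delta dist_real_def by meson
  obtain d2 where d2: "d2 > 0" "\<And>z. dist z x < d2 \<Longrightarrow> \<bar>H z a \<bullet> b - H x a \<bullet> b\<bar> < \<epsilon>"
    using cont(2) \<epsilon> unfolding continuous_at_eps_delta dist_real_def by meson
  obtain r where r: "r > 0" "ball x r \<subseteq> D" using assms open_contains_ball by meson
  define m where "m = min r (min d1 d2)"
  define t where "t = m / (2 * (norm a + norm b + 1))"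
  have m: "m > 0" using r d1 d2 by (simp add: m_def)
  have nn: "norm a + norm b + 1 > 0" using norm_ge_zero[of a] norm_ge_zero[of b] by linarith
  have t: "t > 0" using m nn by (simp add: t_def)
  have tm: "t * (norm a + norm b) < m"
  proof -
    have "t * (norm a + norm b) < t * (norm a + norm b + 1)" using t by simp
    also have "\<dots> = m / 2" using nn by (simp add: t_def field_simps)
    also have "\<dots> < m" using m by simp
    finally show ?thesis .
  qed
  obtain z1 where z1: "dist x z1 \<le> t * (norm a + norm b)"
    "u (x + t *\<^sub>R a + t *\<^sub>R b) - u (x + t *\<^sub>R a) - u (x + t *\<^sub>R b) + u x = t\<^sup>2 * (H z1 b \<bullet> a)"
    using second_difference_mean_value[OF C r(2) t, of a b] tm by (auto simp: m_def)
  obtain z2 where z2: "dist x z2 \<le> t * (norm b + norm a)"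
    "u (x + t *\<^sub>R b + t *\<^sub>R a) - u (x + t *\<^sub>R b) - u (x + t *\<^sub>R a) + u x = t\<^sup>2 * (H z2 a \<bullet> b)"
    using second_difference_mean_value[OF C r(2) t, of b a] tm by (auto simp: m_def add.commute)
  have sw: "x + t *\<^sub>R b + t *\<^sub>R a = x + t *\<^sub>R a + t *\<^sub>R b" by simp
  have "t\<^sup>2 * (H z1 b \<bullet> a) = t\<^sup>2 * (H z2 a \<bullet> b)"
    using z1(2) z2(2) unfolding sw by linarith
  then have "H z1 b \<bullet> a = H z2 a \<bullet> b" using t by simp
  moreover have "\<bar>H z1 b \<bullet> a - H x b \<bullet> a\<bar> < \<epsilon>" using d1(2)[of z1] z1(1) tm by (simp add: m_def dist_commute)
  moreover have "\<bar>H z2 a \<bullet> b - H x a \<bullet> b\<bar> < \<epsilon>" using d2(2)[of z2] z2(1) tm by (simp add: m_def dist_commute add.commute)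
  ultimately have "\<bar>H x b \<bullet> a - H x a \<bullet> b\<bar> < 2 * \<epsilon>" by linarith
  then show False by (simp add: \<epsilon>_def)
qed

section \<open>Differences of a solution with fixed gradient and Hessian\<close>

locale annulus_C2 = annulus +
  fixes g :: "real^2 \<Rightarrow> real^2" and K :: "real^2 \<Rightarrow> real^2 \<Rightarrow> real^2"
  assumes C2: "C2_data U g K (E - H)" and trK: "\<And>x. x \<in> E - H \<Longrightarrow> trace2 (K x) = - f (U x)"
begin

lemma dU_line:
  assumes "x + pt s 0 \<in> E - H"
  shows "((\<lambda>s. U (x + pt s 0)) has_real_derivative g (x + pt s 0) $ 1) (at s)"
proof -
  have ins: "x + s *\<^sub>R pt 1 0 \<in> E - H" using assms by simp
  have "((\<lambda>s. U (x + s *\<^sub>R pt 1 0)) has_derivative (\<lambda>h. g (x + s *\<^sub>R pt 1 0) \<bullet> (h *\<^sub>R pt 1 0))) (at s)"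
    by (rule has_derivative_compose[where f="\<lambda>s. x + s *\<^sub>R pt 1 0" and g=U, OF _ C2_dataD(1)[OF C2 ins]])
      (auto intro!: derivative_eq_intros simp del: pt_arith)
  then show ?thesis unfolding has_field_derivative_def by (simp add: inner2 mult_commute_abs)
qed

lemma W_mean_value:
  assumes "h > 0" "\<And>t. 0 \<le> t \<Longrightarrow> t \<le> h \<Longrightarrow> x + pt t 0 \<in> E - H"
  shows "\<exists>t. 0 < t \<and> t < h \<and> W h x = h * g (x + pt t 0) $ 1"
proof -
  have "\<exists>t. 0 < t \<and> t < h \<and> U (x + pt h 0) - U (x + pt 0 0) = (h - 0) * g (x + pt t 0) $ 1"
    by (rule MVT2[OF assms(1)]) (use assms dU_line in auto)
  then show ?thesis by (simp add: W_def)
qed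

lemma U_bounded: "\<exists>M. \<forall>x. 0 \<le> U x \<and> U x \<le> M"
proof -
  have "compact (closure (E - H))" using bounded_dom by simp
  then have "bounded (U ` closure (E - H))"
    by (intro compact_imp_bounded compact_continuous_image continuous_on_subset[OF contU]) auto
  then obtain M where M: "M > 0" "\<And>x. x \<in> closure (E - H) \<Longrightarrow> \<bar>U x\<bar> \<le> M" unfolding bounded_pos by auto
  have "U x \<le> M" for x
  proof (cases "x \<in> E - H")
    case True
    then show ?thesis using M(2)[of x] closure_subset[of "E - H"] by auto
  next
    case False
    then show ?thesis using U0 M(1) by simp
  qed
  then show ?thesis using U_nonneg by blast
qed

text \<open>The values of \<open>U\<close> fill a bounded range, so one Lipschitz constant of
  \<open>f\<close> serves all \<open>h\<close>. This uniformity lets the barrier be fixed before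
  \<open>h\<close>.\<close>

lemma f_difference_le_W: "\<exists>C>0. \<forall>h x. \<bar>f (U (x + pt h 0)) - f (U x)\<bar> \<le> C * \<bar>W h x\<bar>"
proof -
  obtain M where "\<And>x. 0 \<le> U x \<and> U x \<le> M" using U_bounded by blast
  then show ?thesis using f_lip[of M] unfolding W_def by (metis atLeastAtMost_iff)
qed

definition shift_dom :: "real \<Rightarrow> (real^2) set" where "shift_dom h = (E - H) \<inter> {x. x + pt h 0 \<in> E - H}"

lemma open_shift_dom: "open (shift_dom h)"
proof -
  have "open ((\<lambda>x. x + pt h 0) -` (E - H))" by (intro open_vimage open_dom continuous_intros)
  then show ?thesis unfolding shift_dom_def using open_dom by (intro open_Int) (auto simp: vimage_def)
qed

definition gW where "gW h x = g (x + pt h 0) - g x"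
definition KW where "KW h x v = K (x + pt h 0) v - K x v"

lemma C2_data_W: "C2_data (W h) (gW h) (KW h) (shift_dom h)"
proof -
  have "C2_data (\<lambda>x. U (x + pt h 0)) (\<lambda>x. g (x + pt h 0)) (\<lambda>x v. K (x + pt h 0) v) {x. x + pt h 0 \<in> E - H}"
    using C2_data_isometry[of "\<lambda>x. x" U g K "E - H" "pt h 0"] C2
      adjoint_unique[of "\<lambda>x::real^2. x" "\<lambda>x. x"] by simp
  from C2_data_diff[OF C2_data_mono[OF this] C2_data_mono[OF C2], of "shift_dom h"]
  show ?thesis unfolding W_def[abs_def] gW_def[abs_def] KW_def[abs_def] by (auto simp: shift_dom_def)
qed

lemma trace2_KW: "x \<in> shift_dom h \<Longrightarrow> trace2 (KW h x) = f (U x) - f (U (x + pt h 0))"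
  unfolding KW_def using trK[of x] trK[of "x + pt h 0"] by (simp add: trace2_diff shift_dom_def)

end

section \<open>The strong maximum principle for the horizontal derivative\<close>

lemma C2_data_gaussian:
  fixes y :: "real^2" and \<alpha> :: real
  defines "b \<equiv> \<lambda>x. exp (- \<alpha> * ((x - y) \<bullet> (x - y)))"
  shows "C2_data b (\<lambda>x. (- 2 * \<alpha> * b x) *\<^sub>R (x - y))
    (\<lambda>x v. (4 * \<alpha>\<^sup>2 * b x * ((x - y) \<bullet> v)) *\<^sub>R (x - y) + (- 2 * \<alpha> * b x) *\<^sub>R v) D"
proof -
  have db: "(b has_derivative (\<lambda>v. b x * (- 2 * \<alpha> * ((x - y) \<bullet> v)))) (at x)" for x
    unfolding b_def by (auto intro!: derivative_eq_intros simp: inner_commute algebra_simps)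
  have cb: "continuous_on X b" for X unfolding b_def by (intro continuous_intros)
  show ?thesis unfolding C2_data_def
  proof (intro conjI ballI allI)
    fix x
    have "(\<lambda>v. b x * (- 2 * \<alpha> * ((x - y) \<bullet> v))) = (\<bullet>) ((- 2 * \<alpha> * b x) *\<^sub>R (x - y))" by (auto simp: algebra_simps)
    with db[of x] show "(b has_derivative (\<bullet>) ((- 2 * \<alpha> * b x) *\<^sub>R (x - y))) (at x)" by simp
    show "((\<lambda>x. (- 2 * \<alpha> * b x) *\<^sub>R (x - y)) has_derivative
      (\<lambda>v. (4 * \<alpha>\<^sup>2 * b x * ((x - y) \<bullet> v)) *\<^sub>R (x - y) + (- 2 * \<alpha> * b x) *\<^sub>R v)) (at x)"
      by (rule derivative_eq_intros db refl)+ (auto simp: power2_eq_square algebra_simps)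
  next
    fix v show "continuous_on D (\<lambda>x. (4 * \<alpha>\<^sup>2 * b x * ((x - y) \<bullet> v)) *\<^sub>R (x - y) + (- 2 * \<alpha> * b x) *\<^sub>R v)"
      by (intro continuous_intros cb)
  qed
qed

lemma C2_data_combination:
  assumes "C2_data u g H D" "C2_data v k K D"
  shows "C2_data (\<lambda>x. m * (u x - c) - n * v x) (\<lambda>x. m *\<^sub>R g x - n *\<^sub>R k x) (\<lambda>x w. m *\<^sub>R H x w - n *\<^sub>R K x w) D"
  unfolding C2_data_def
proof (intro conjI ballI allI)
  fix x assume x: "x \<in> D"
  have "(\<lambda>h. m * (g x \<bullet> h) - n * (k x \<bullet> h)) = (\<bullet>) (m *\<^sub>R g x - n *\<^sub>R k x)" by (auto simp: inner_diff_left)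
  then show "((\<lambda>x. m * (u x - c) - n * v x) has_derivative (\<bullet>) (m *\<^sub>R g x - n *\<^sub>R k x)) (at x)"
    using C2_dataD(1)[OF assms(1) x] C2_dataD(1)[OF assms(2) x]
    by (auto intro!: derivative_eq_intros elim!: back_subst[of "\<lambda>d. (_ has_derivative d) _"])
  show "((\<lambda>x. m *\<^sub>R g x - n *\<^sub>R k x) has_derivative (\<lambda>w. m *\<^sub>R H x w - n *\<^sub>R K x w)) (at x)"
    using C2_dataD(2)[OF assms(1) x] C2_dataD(2)[OF assms(2) x] by (auto intro!: derivative_eq_intros)
next
  fix w show "continuous_on D (\<lambda>x. m *\<^sub>R H x w - n *\<^sub>R K x w)"
    using assms unfolding C2_data_def by (intro continuous_intros) auto
qed

lemma trace2_combination: "trace2 (\<lambda>w. m *\<^sub>R L w - n *\<^sub>R K w) = m * trace2 L - n * trace2 K"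
  by (simp add: trace2_def algebra_simps)

context annulus_C2
begin

lemma isCont_g: "x \<in> E - H \<Longrightarrow> isCont (\<lambda>x. g x $ 1) x"
  using C2_dataD(2)[OF C2, of x] has_derivative_continuous by (fastforce intro!: continuous_intros)

text \<open>Hopf's barrier is compared with \<open>W h\<close> instead of \<open>g $ 1\<close>, which need not be twice differentiable.\<close>

lemma gradient_strong_maximum_principle:
  assumes r: "r > 0" "ball z r \<subseteq> E - H" and sg: "sg = 1 \<or> sg = - 1"
    and nn: "\<And>x. x \<in> ball z r \<Longrightarrow> 0 \<le> sg * g x $ 1"
    and z: "g z $ 1 = 0" and y: "y \<in> ball z (r/2)"
  shows "g y $ 1 = 0"
proof (rule ccontr)
  assume "g y $ 1 \<noteq> 0"
  moreover have "sg * g y $ 1 \<ge> 0" by (rule nn) (use y r in auto)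
  ultimately have gy: "sg * g y $ 1 > 0" using sg by auto
  define \<sigma> where "\<sigma> = dist z y"
  \<comment> \<open>As \<open>dist z y < r/2\<close>, the ball of this radius about \<open>y\<close>
    stays inside the ball about \<open>z\<close> and contains \<open>z\<close>. The comparison takes
    place in the ring between the radii \<open>\<delta>\<close> and \<open>R\<close>, with
    \<open>z\<close> in its interior.\<close>
  define R where "R = r/2"
  have \<sigma>: "0 < \<sigma>" "\<sigma> < R" using gy z y by (auto simp: \<sigma>_def R_def)
  define \<kappa> where "\<kappa> = sg * g y $ 1 / 2"
  have \<kappa>: "\<kappa> > 0" using gy by (simp add: \<kappa>_def)
  have "y \<in> ball z r" using y r by auto
  then have "y \<in> E - H" using r by blast
  obtain \<delta>0 where \<delta>0: "\<delta>0 > 0" "\<And>x. dist x y < \<delta>0 \<Longrightarrow> \<bar>g x $ 1 - g y $ 1\<bar> < \<kappa>"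
    using isCont_g[OF \<open>y \<in> E - H\<close>] \<kappa> unfolding continuous_at_eps_delta dist_real_def by meson
  define \<delta> where "\<delta> = min (\<delta>0/2) (\<sigma>/2)"
  have \<delta>: "\<delta> > 0" "\<delta> < \<sigma>" "2 * \<delta> \<le> \<delta>0" using \<delta>0 \<sigma> by (auto simp: \<delta>_def)
  have near_y: "sg * g x $ 1 > \<kappa>" if "dist y x < 2 * \<delta>" for x
    using \<delta>0(2)[of x] that \<delta>(3) sg by (auto simp: \<kappa>_def dist_commute abs_if split: if_splits)
  obtain C where C: "C > 0" "\<And>h x. \<bar>f (U (x + pt h 0)) - f (U x)\<bar> \<le> C * \<bar>W h x\<bar>" using f_difference_le_W by blast
  \<comment> \<open>In the ring \<open>\<alpha> * (dist y x)\<^sup>2 \<ge> 2\<close>, so the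
    Laplacian of the Gaussian is at least \<open>4 * \<alpha> * b x\<close>, which dominates
    \<open>C * b x\<close>.\<close>
  define \<alpha> where "\<alpha> = 2 / \<delta>\<^sup>2 + C"
  have \<alpha>: "\<alpha> > 0" "\<alpha> \<ge> C" "\<alpha> * \<delta>\<^sup>2 \<ge> 2" using \<delta> C(1) by (auto simp: \<alpha>_def field_simps add_pos_pos)
  define b where "b x = exp (- \<alpha> * ((x - y) \<bullet> (x - y)))" for x
  define c0 where "c0 = exp (- \<alpha> * R\<^sup>2)"
  have bd: "b x = exp (- \<alpha> * (dist y x)\<^sup>2)" for x
    by (simp add: b_def dist_norm norm_minus_commute flip: power2_norm_eq_inner)
  have b1: "b x \<le> 1" "b x > 0" for x using \<alpha> by (auto simp: bd)
  have bz: "b z - c0 > 0" unfolding bd c0_def using \<sigma> \<alpha> by (auto simp: \<sigma>_def dist_commute power_strict_mono)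
  have "z \<in> ball z r" using r by simp
  then have "z \<in> E - H" using r by blast
  obtain d where d: "d > 0" "\<And>x. dist x z < d \<Longrightarrow> \<bar>g x $ 1 - g z $ 1\<bar> < \<kappa> * (b z - c0)"
    using isCont_g[OF \<open>z \<in> E - H\<close>] mult_pos_pos[OF \<kappa> bz] unfolding continuous_at_eps_delta dist_real_def by meson
  \<comment> \<open>The barrier and the difference both scale with \<open>h\<close>, so nothing
    fixed so far depends on it. The bound \<open>R - \<sigma>\<close> keeps translates in the ball
    about \<open>z\<close>.\<close>
  define h where "h = min \<delta> (min (R - \<sigma>) d) / 2"
  have h: "h > 0" "h < \<delta>" "h < R - \<sigma>" "h < d" using \<delta> \<sigma> d by (auto simp: h_def)
  have dpt: "dist x (x + pt t 0) = \<bar>t\<bar>" for x t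
    by (simp add: dist_norm norm_eq_sqrt_inner inner2)
  have inball: "x + pt t 0 \<in> ball z r" if "dist y x \<le> R" "0 \<le> t" "t \<le> h" for x t
  proof -
    have "dist z (x + pt t 0) \<le> dist z y + dist y x + dist x (x + pt t 0)"
      using dist_triangle[of z "x + pt t 0" y] dist_triangle[of y "x + pt t 0" x] by linarith
    then show ?thesis using that h dpt[of x t] by (simp add: \<sigma>_def R_def)
  qed
  have W0: "sg * W h x \<ge> 0" if x: "dist y x \<le> R" for x
  proof -
    have "\<exists>t. 0 < t \<and> t < h \<and> W h x = h * g (x + pt t 0) $ 1"
      by (rule W_mean_value[OF h(1)]) (use inball[OF x] r in blast)
    then obtain t where t: "0 < t" "t < h" "W h x = h * g (x + pt t 0) $ 1" by auto
    have "0 \<le> h * (sg * g (x + pt t 0) $ 1)" using nn[OF inball[OF x, of t]] t h(1) by simp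
    also have "\<dots> = sg * W h x" using t(3) by (simp only: mult.left_commute)
    finally show ?thesis .
  qed
  define A where "A = {x. \<delta> < dist y x} \<inter> {x. dist y x < R}"
  have A: "open A" "bounded A"
  proof -
    show "open A" unfolding A_def by (intro open_Int open_Collect_less continuous_intros)
    show "bounded A" by (rule bounded_subset[of "ball y R"]) (auto simp: A_def)
  qed
  have clA: "closure A \<subseteq> {x. \<delta> \<le> dist y x} \<inter> {x. dist y x \<le> R}"
    by (rule closure_minimal) (auto simp: A_def intro!: closed_Int closed_Collect_le continuous_intros)
  have Adom: "A \<subseteq> shift_dom h"
  proof
    fix x assume "x \<in> A"
    then show "x \<in> shift_dom h" using inball[of x 0] inball[of x h] h r by (auto simp: A_def shift_dom_def)
  qed
  \<comment> \<open>\<open>c0\<close> is the value of the Gaussian on the outer circle, where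
    nothing but the sign of \<open>W h\<close> is known. On the inner circle
    \<open>sg * W h \<ge> \<kappa> * h\<close> and \<open>b x - c0 \<le> 1\<close>. At
    \<open>z\<close> the resulting lower bound for \<open>W h z / h\<close> contradicts
    \<open>g z $ 1 = 0\<close>.\<close>
  define w where "w x = \<kappa> * h * (b x - c0) - sg * W h x" for x
  have C2w: "C2_data w (\<lambda>x. (\<kappa> * h) *\<^sub>R ((- 2 * \<alpha> * b x) *\<^sub>R (x - y)) - sg *\<^sub>R gW h x)
    (\<lambda>x v. (\<kappa> * h) *\<^sub>R ((4 * \<alpha>\<^sup>2 * b x * ((x - y) \<bullet> v)) *\<^sub>R (x - y) + (- 2 * \<alpha> * b x) *\<^sub>R v) - sg *\<^sub>R KW h x v) A"
    unfolding w_def[abs_def] b_def[abs_def]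
    by (rule C2_data_combination[OF C2_data_gaussian C2_data_mono[OF C2_data_W Adom]])
  have "w z \<le> 0"
  proof (rule maximum_principle[OF A _ C2w])
    show "continuous_on (closure A) w" unfolding w_def b_def by (intro continuous_intros continuous_W)
    show "z \<in> A" using \<delta> \<sigma> by (auto simp: A_def \<sigma>_def dist_commute)
  next
    fix x assume "x \<in> A" "w x > 0"
    then have xA: "\<delta> < dist y x" "dist y x < R" by (auto simp: A_def)
    have "sg * W h x \<ge> 0" using W0 xA by simp
    then have "\<bar>W h x\<bar> = sg * W h x" using sg by auto
    moreover have "sg * trace2 (KW h x) \<le> \<bar>f (U (x + pt h 0)) - f (U x)\<bar>"
      using trace2_KW[of x h] \<open>x \<in> A\<close> Adom sg by auto
    ultimately have "sg * trace2 (KW h x) \<le> C * (sg * W h x)"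
      using C(2)[where h=h and x=x] by simp
    also have "\<dots> \<le> C * (\<kappa> * h * (b x - c0))" using \<open>w x > 0\<close> C(1) by (simp add: w_def)
    also have "\<dots> \<le> C * (\<kappa> * h * b x)" using C(1) \<kappa> h by (simp add: c0_def)
    also have "\<dots> \<le> \<kappa> * h * (4 * \<alpha> * b x * (\<alpha> * (dist y x)\<^sup>2 - 1))"
    proof -
      have "\<alpha> * (dist y x)\<^sup>2 \<ge> \<alpha> * \<delta>\<^sup>2" using xA \<delta> \<alpha> by (intro mult_left_mono power_mono) auto
      then have "1 \<le> \<alpha> * (dist y x)\<^sup>2 - 1" using \<alpha>(3) by linarith
      then have "C * 1 \<le> 4 * \<alpha> * (\<alpha> * (dist y x)\<^sup>2 - 1)" using \<alpha>(1,2) C(1) by (intro mult_mono) linarith+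
      then have "(\<kappa> * h * b x) * (C * 1) \<le> (\<kappa> * h * b x) * (4 * \<alpha> * (\<alpha> * (dist y x)\<^sup>2 - 1))"
        using \<kappa> h b1(2)[of x] by (intro mult_left_mono) auto
      then show ?thesis by (simp add: algebra_simps)
    qed
    finally have 1: "sg * trace2 (KW h x) \<le> \<kappa> * h * (4 * \<alpha> * b x * (\<alpha> * (dist y x)\<^sup>2 - 1))" .
    have dsq: "(dist y x)\<^sup>2 = (x$1 - y$1)\<^sup>2 + (x$2 - y$2)\<^sup>2"
      unfolding dist_norm norm2_sq by (simp add: power2_commute)
    have trL: "trace2 (\<lambda>v. (4 * \<alpha>\<^sup>2 * b x * ((x - y) \<bullet> v)) *\<^sub>R (x - y) + (- 2 * \<alpha> * b x) *\<^sub>R v)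
        = 4 * \<alpha> * b x * (\<alpha> * (dist y x)\<^sup>2 - 1)"
      unfolding dsq by (simp add: trace2_def inner2 power2_eq_square algebra_simps)
    then show "0 \<le> trace2 (\<lambda>v. (\<kappa> * h) *\<^sub>R ((4 * \<alpha>\<^sup>2 * b x * ((x - y) \<bullet> v)) *\<^sub>R (x - y) + (- 2 * \<alpha> * b x) *\<^sub>R v) - sg *\<^sub>R KW h x v)"
      unfolding trace2_combination trL using 1 by simp
  next
    fix x assume "x \<in> frontier A"
    then have "x \<in> closure A" "x \<notin> A" using A by (auto simp: frontier_def interior_open)
    then consider "dist y x = \<delta>" | "dist y x = R" using clA by (force simp: A_def)
    then show "w x \<le> 0"
    proof cases
      case 1
      have "\<exists>t. 0 < t \<and> t < h \<and> W h x = h * g (x + pt t 0) $ 1"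
      proof (rule W_mean_value[OF h(1)])
        fix t assume "0 \<le> t" "t \<le> h"
        then show "x + pt t 0 \<in> E - H" using inball[of x t] 1 \<delta> \<sigma> r by auto
      qed
      then obtain t where t: "0 < t" "t < h" "W h x = h * g (x + pt t 0) $ 1" by blast
      have "dist y (x + pt t 0) < 2 * \<delta>" using dist_triangle[of y "x + pt t 0" x] dpt[of x t] t h 1 by simp
      from near_y[OF this] have "h * (sg * g (x + pt t 0) $ 1) \<ge> h * \<kappa>" using h(1) by simp
      then have "sg * W h x \<ge> h * \<kappa>" using t(3) by (simp add: algebra_simps)
      moreover have "\<kappa> * h * (b x - c0) \<le> \<kappa> * h * 1" using b1[of x] \<kappa> h by (intro mult_left_mono) (auto simp: c0_def add_increasing2 diff_le_eq)
      ultimately show ?thesis by (simp add: w_def mult.commute)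
    next
      case 2
      then have "b x = c0" by (simp add: bd c0_def)
      then show ?thesis using W0[of x] 2 by (simp add: w_def)
    qed
  qed
  moreover have "\<exists>t. 0 < t \<and> t < h \<and> W h z = h * g (z + pt t 0) $ 1"
  proof (rule W_mean_value[OF h(1)])
    fix t assume "0 \<le> t" "t \<le> h"
    then show "z + pt t 0 \<in> E - H" using inball[of z t] \<sigma> r by (auto simp: \<sigma>_def dist_commute)
  qed
  then obtain t where t: "0 < t" "t < h" "W h z = h * g (z + pt t 0) $ 1" by blast
  moreover have "\<bar>g (z + pt t 0) $ 1\<bar> < \<kappa> * (b z - c0)"
    using d(2)[of "z + pt t 0"] dpt[of z t] t h z by (simp add: dist_commute)
  then have "sg * g (z + pt t 0) $ 1 < \<kappa> * (b z - c0)" using sg by auto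
  then have "h * (sg * g (z + pt t 0) $ 1) < h * (\<kappa> * (b z - c0))" using h by simp
  ultimately show False by (simp add: w_def algebra_simps)
qed

text \<open>\<open>w = W h\<close> is turned into the pair \<open>(w\<^sub>x - \<i> w\<^sub>y, w)\<close>, whose Cauchy-Riemann derivatives are
  \<open>(\<Delta> w, w\<^sub>x + \<i> w\<^sub>y)\<close>, so that the second-order equation becomes a first-order inequality.\<close>

definition W_pair :: "real \<Rightarrow> bool \<Rightarrow> real^2 \<Rightarrow> complex" where
  "W_pair h b x = (if b then Complex (gW h x $ 1) (- gW h x $ 2) else of_real (W h x))"

definition W_pair' :: "real \<Rightarrow> bool \<Rightarrow> real^2 \<Rightarrow> real^2 \<Rightarrow> complex" where
  "W_pair' h b x v = (if b then Complex (KW h x v $ 1) (- KW h x v $ 2) else of_real (gW h x \<bullet> v))"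

lemma W_pair_derivative:
  assumes "x \<in> shift_dom h" shows "(W_pair h b has_derivative W_pair' h b x) (at x)"
proof (cases b)
  case True
  have d: "(gW h has_derivative KW h x) (at x)" by (rule C2_dataD(2)[OF C2_data_W assms])
  have c: "((\<lambda>x. gW h x $ i) has_derivative (\<lambda>v. KW h x v $ i)) (at x)" for i
    by (rule bounded_linear.has_derivative[OF bounded_linear_vec_nth d])
  have "((\<lambda>x. of_real (gW h x $ 1) + \<i> * of_real (- gW h x $ 2)) has_derivative
     (\<lambda>v. of_real (KW h x v $ 1) + \<i> * of_real (- KW h x v $ 2))) (at x)"
    by (intro has_derivative_add has_derivative_mult_right has_derivative_of_real has_derivative_minus c)
  then show ?thesis unfolding W_pair_def[abs_def] W_pair'_def[abs_def] using True by (simp add: Complex_eq)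
next
  case False
  then show ?thesis unfolding W_pair_def[abs_def] W_pair'_def[abs_def]
    using has_derivative_of_real[OF C2_dataD(1)[OF C2_data_W assms]] by simp
qed

lemma continuous_W_pair': "continuous_on (shift_dom h) (\<lambda>x. W_pair' h b x v)"
proof -
  have "continuous_on (shift_dom h) (\<lambda>x. KW h x v)" using C2_data_W by (simp add: C2_data_def)
  moreover have "continuous_on (shift_dom h) (gW h)" using C2_data_cont(2)[OF C2_data_W] .
  ultimately show ?thesis unfolding W_pair'_def Complex_eq by (cases b) (auto intro!: continuous_intros)
qed

text \<open>For the gradient component the imaginary part cancels by symmetry of the Hessian and the
  Laplacian remains, bounded by \<open>C\<close> times the modulus of \<open>W h\<close>. For the
  other component the two norms agree, whence \<open>max C 1\<close>.\<close>

lemma W_pair_dbar: "\<exists>C>0. \<forall>h b. \<forall>x\<in>shift_dom h.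
    norm (W_pair' h b x (axis 1 1) + \<i> * W_pair' h b x (axis 2 1)) \<le> C * norm (W_pair h (\<not> b) x)"
proof -
  obtain C where C: "C > 0" "\<And>h x. \<bar>f (U (x + pt h 0)) - f (U x)\<bar> \<le> C * \<bar>W h x\<bar>" using f_difference_le_W by blast
  have "norm (W_pair' h b x (axis 1 1) + \<i> * W_pair' h b x (axis 2 1)) \<le> max C 1 * norm (W_pair h (\<not> b) x)"
    if x: "x \<in> shift_dom h" for h b x
  proof (cases b)
    case True
    have "KW h x (axis 2 1) $ 1 = KW h x (axis 1 1) $ 2"
      using hessian_symmetric[OF C2_data_W open_shift_dom x, of "axis 2 1" "axis 1 1"] by (simp add: inner2)
    then have "W_pair' h b x (axis 1 1) + \<i> * W_pair' h b x (axis 2 1) = of_real (trace2 (KW h x))"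
      using True by (simp add: W_pair'_def complex_eq_iff trace2_def)
    then have "norm (W_pair' h b x (axis 1 1) + \<i> * W_pair' h b x (axis 2 1)) = \<bar>f (U (x + pt h 0)) - f (U x)\<bar>"
      by (simp only: norm_of_real trace2_KW[OF x] abs_minus_commute)
    also have "\<dots> \<le> C * \<bar>W h x\<bar>" by (rule C(2))
    also have "\<dots> \<le> max C 1 * \<bar>W h x\<bar>" by (intro mult_right_mono) auto
    finally show ?thesis using True by (simp add: W_pair_def)
  next
    case False
    have "norm (W_pair' h b x (axis 1 1) + \<i> * W_pair' h b x (axis 2 1)) = norm (W_pair h (\<not> b) x)"
      using False by (simp add: W_pair'_def W_pair_def inner2 complex_norm cmod_def)
    moreover have "1 * norm (W_pair h (\<not> b) x) \<le> max C 1 * norm (W_pair h (\<not> b) x)" by (intro mult_right_mono) auto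
    ultimately show ?thesis by simp
  qed
  then show ?thesis by (intro exI[of _ "max C 1"]) auto
qed

text \<open>Near a boundary point \<open>\<xi>\<close> of the open zero set \<open>V\<close> a point
  \<open>\<eta>\<close> of \<open>V\<close> is chosen, and \<open>\<zeta>\<close> is a nearest point
  to it outside \<open>V\<close>. Then \<open>W h\<close> vanishes on a ball whose boundary contains
  \<open>\<zeta>\<close>, the situation of \<open>dbar_unique_continuation\<close>.\<close>

lemma W_continuation:
  assumes S: "connected S" "S \<subseteq> shift_dom h" and z: "z \<in> S" "z \<in> interior {x. W h x = 0}"
  shows "S \<subseteq> interior {x. W h x = 0}"
proof (rule ccontr)
  assume not: "\<not> ?thesis"
  define V where "V = interior {x. W h x = 0}"
  have "S \<inter> frontier V \<noteq> {}"
    by (rule connected_Int_frontier[OF S(1)]) (use z not in \<open>auto simp: V_def\<close>)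
  then obtain \<xi> where \<xi>: "\<xi> \<in> S" "\<xi> \<in> closure V" "\<xi> \<notin> V" by (auto simp: frontier_def V_def)
  obtain r where r: "r > 0" "ball \<xi> r \<subseteq> shift_dom h"
    using open_shift_dom[of h] \<xi>(1) S(2) open_contains_ball by blast
  \<comment> \<open>Half of \<open>r\<close>, so that \<open>\<zeta>\<close>, no farther from
    \<open>\<eta>\<close> than \<open>\<xi>\<close> is, still lies in
    \<open>shift_dom h\<close>.\<close>
  obtain \<eta> where \<eta>: "\<eta> \<in> V" "dist \<eta> \<xi> < r/2" using \<xi>(2) r(1) closure_approachable[of \<xi> V] half_gt_zero by blast
  have "closed (- V)" by (simp add: V_def closed_Compl)
  moreover have "- V \<noteq> {}" using \<xi>(3) by auto
  ultimately obtain \<zeta> where \<zeta>: "\<zeta> \<in> - V" "\<And>y. y \<in> - V \<Longrightarrow> dist \<eta> \<zeta> \<le> dist \<eta> y"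
    using distance_attains_inf by metis
  define \<rho> where "\<rho> = dist \<eta> \<zeta>"
  have \<rho>: "\<rho> > 0" using \<zeta>(1) \<eta>(1) by (auto simp: \<rho>_def)
  have "dist \<eta> \<zeta> < r/2" using \<zeta>(2)[of \<xi>] \<xi>(3) \<eta>(2) by simp
  then have "dist \<xi> \<zeta> < r" using dist_triangle[of \<xi> \<zeta> \<eta>] \<eta>(2) by (simp add: dist_commute)
  then have "\<zeta> \<in> shift_dom h" using r by auto
  then obtain r' where r': "r' > 0" "ball \<zeta> r' \<subseteq> shift_dom h" using open_shift_dom[of h] open_contains_ball by blast
  obtain C where C: "C > 0" "\<And>h b x. x \<in> shift_dom h \<Longrightarrow>
    norm (W_pair' h b x (axis 1 1) + \<i> * W_pair' h b x (axis 2 1)) \<le> C * norm (W_pair h (\<not> b) x)" using W_pair_dbar by blast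
  have "\<exists>e>0. \<forall>x\<in>ball \<zeta> e. \<forall>b. W_pair h b x = 0"
  proof (rule dbar_unique_continuation[where F'="W_pair' h" and C=C and \<eta>=\<eta> and \<rho>=\<rho> and r=r'])
    fix b x assume x: "x \<in> ball \<zeta> r'" "dist \<eta> x < \<rho>"
    then have "x \<in> V" using \<zeta>(2)[of x] by (force simp: \<rho>_def)
    have "x \<in> shift_dom h" using x r' by blast
    have W0: "\<And>y. y \<in> V \<Longrightarrow> W h y = 0" unfolding V_def using interior_subset by blast
    have "open V" by (simp add: V_def)
    have "((\<lambda>x. 0) has_derivative (\<lambda>v. 0)) (at x)" by simp
    from has_derivative_transform_within_open[OF this \<open>open V\<close> \<open>x \<in> V\<close>, of "W h"]
    have "(W h has_derivative (\<lambda>v. 0)) (at x)" using W0 by simp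
    then have "(\<lambda>v. 0) = (\<bullet>) (gW h x)"
      using has_derivative_unique C2_dataD(1)[OF C2_data_W \<open>x \<in> shift_dom h\<close>] by blast
    then have "gW h x = 0" by (metis inner_eq_zero_iff)
    then show "W_pair h b x = 0" using W0[OF \<open>x \<in> V\<close>] by (simp add: W_pair_def complex_eq_iff)
  qed (use W_pair_derivative continuous_W_pair' C r' \<rho> continuous_on_subset in \<open>(auto simp: \<rho>_def; blast)+\<close>)
  then obtain e where e: "e > 0" "\<forall>x\<in>ball \<zeta> e. \<forall>b. W_pair h b x = 0" by blast
  have "W h x = 0" if "x \<in> ball \<zeta> e" for x
  proof -
    have "W_pair h False x = 0" using e(2) that by blast
    then show ?thesis by (simp add: W_pair_def)
  qed
  then have "ball \<zeta> e \<subseteq> {x. W h x = 0}" by blast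
  then have "\<zeta> \<in> V" unfolding V_def using e(1) by (meson centre_in_ball interior_maximal open_ball subsetD)
  then show False using \<zeta>(1) by simp
qed

lemma gradient_on_axis: assumes "pt s 0 \<in> E - H" shows "g (pt s 0) $ 2 = 0"
proof -
  have d: "((\<lambda>t. U (pt s 0 + t *\<^sub>R pt 0 1)) has_derivative (\<lambda>h. g (pt s 0) \<bullet> (h *\<^sub>R pt 0 1))) (at 0)"
    by (rule has_derivative_compose[where f="\<lambda>t. pt s 0 + t *\<^sub>R pt 0 1" and g=U])
      (use C2_dataD(1)[OF C2 assms] in \<open>auto intro!: derivative_eq_intros simp del: pt_arith(1,3)\<close>)
  have d1: "((\<lambda>t. U (pt s t)) has_real_derivative g (pt s 0) $ 2) (at 0)"
    using d unfolding has_field_derivative_def by (simp add: inner2 mult_commute_abs)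
  have d2: "((\<lambda>t. U (pt s (- t))) has_real_derivative - g (pt s 0) $ 2) (at 0)"
    using DERIV_mirror[of "\<lambda>t. U (pt s t)" "g (pt s 0) $ 2" 0] d1 by simp
  have "(\<lambda>t. U (pt s (- t))) = (\<lambda>t. U (pt s t))" using U_sym[of "pt s _"] by auto
  then have "g (pt s 0) $ 2 = - g (pt s 0) $ 2" using d1 d2 DERIV_unique by metis
  then show ?thesis by simp
qed

text \<open>The Cauchy data of \<open>W h\<close> vanish on the axis, so the pair remains differentiable when it is replaced
  by zero below the axis, and unique continuation applies across the axis.\<close>

lemma W_zero_near_axis:
  assumes "a < b" "h > 0" and flat: "\<And>s. a < s \<Longrightarrow> s < b \<Longrightarrow>
     pt s 0 \<in> shift_dom h \<and> W h (pt s 0) = 0 \<and> g (pt s 0) $ 1 = 0 \<and> g (pt (s + h) 0) $ 1 = 0"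
    and m: "a < m" "m < b"
  shows "pt m 0 \<in> interior {x. W h x = 0}"
proof -
  have g0: "gW h (pt s 0) = 0" if "a < s" "s < b" for s
    using flat[OF that] gradient_on_axis[of s] gradient_on_axis[of "s + h"] by (auto simp: gW_def vec2_eq shift_dom_def)
  \<comment> \<open>Differentiating the vanishing gradient along the axis kills the first column,
    symmetry the off-diagonal entry of the second, and the equation the last entry, because
    \<open>W h = 0\<close> makes the two values of \<open>f\<close> cancel.\<close>
  have K0: "KW h (pt s 0) v = 0" if s: "a < s" "s < b" for s v
  proof -
    have dom: "pt s 0 \<in> shift_dom h" using flat[OF s] by blast
    have lin: "linear (KW h (pt s 0))" by (rule C2_data_linear[OF C2_data_W dom])
    have "((\<lambda>t. gW h (t *\<^sub>R pt 1 0)) has_derivative (\<lambda>x. KW h (pt s 0) (x *\<^sub>R pt 1 0))) (at s)"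
      by (rule has_derivative_compose[where f="\<lambda>t. t *\<^sub>R pt 1 0" and g="gW h"])
        (use C2_dataD(2)[OF C2_data_W dom] in \<open>auto intro!: derivative_eq_intros simp del: pt_arith(3)\<close>, simp)
    then have 1: "((\<lambda>t. gW h (pt t 0)) has_derivative (\<lambda>x. KW h (pt s 0) (pt x 0))) (at s)" by simp
    have "((\<lambda>t. 0) has_derivative (\<lambda>x. 0)) (at s)" by simp
    from has_derivative_transform_within_open[OF this, of "{a<..<b}" "\<lambda>t. gW h (pt t 0)"]
    have "((\<lambda>t. gW h (pt t 0)) has_derivative (\<lambda>x. 0)) (at s)" using g0 s by auto
    from has_derivative_unique[OF 1 this] have "KW h (pt s 0) (pt x 0) = 0" for x by meson
    then have e1: "KW h (pt s 0) (axis 1 1) = 0" using pt_collapse[of "axis 1 1" 1 0] by simp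
    have e21: "KW h (pt s 0) (axis 2 1) $ 1 = 0"
      using hessian_symmetric[OF C2_data_W open_shift_dom dom, of "axis 2 1" "axis 1 1"] e1 by (simp add: inner2)
    have "f (U (pt s 0 + pt h 0)) = f (U (pt s 0))" using flat[OF s] by (simp add: W_def)
    then have "trace2 (KW h (pt s 0)) = 0" using trace2_KW[OF dom] by simp
    then have e2: "KW h (pt s 0) (axis 2 1) = 0" using e1 e21 by (simp add: trace2_def vec2_eq)
    have "v = v$1 *\<^sub>R axis 1 1 + v$2 *\<^sub>R axis 2 1" by (simp add: vec2_eq)
    then have "KW h (pt s 0) v = KW h (pt s 0) (v$1 *\<^sub>R axis 1 1 + v$2 *\<^sub>R axis 2 1)" by simp
    also have "\<dots> = 0" using e1 e2 by (simp only: linear_add[OF lin] linear_cmul[OF lin]) simp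
    finally show ?thesis .
  qed
  define z where "z = pt m 0"
  have "z \<in> shift_dom h" using flat m by (simp add: z_def)
  then obtain r0 where r0: "r0 > 0" "ball z r0 \<subseteq> shift_dom h" using open_shift_dom[of h] open_contains_ball by blast
  define r where "r = min r0 (min (m - a) (b - m))"
  have r: "r > 0" "ball z r \<subseteq> shift_dom h" using r0 m by (auto simp: r_def)
  have absle: "\<bar>x$1 - m\<bar> \<le> dist z x" for x
    using component_le_norm_cart[of "x - z" 1] by (simp add: z_def dist_norm norm_minus_commute)
  have inab: "a < x$1" "x$1 < b" if "x \<in> ball z r" for x
    using absle[of x] that by (auto simp: r_def)
  \<comment> \<open>Clamping to the closed upper half plane realises the extension by zero, since
    all data vanish on the axis; continuity of \<open>F'\<close> then comes from a
    composition.\<close>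
  define cl where "cl x = pt (x$1) (max 0 (x$2))" for x :: "real^2"
  have cl_in: "cl x \<in> ball z r" if "x \<in> ball z r" for x
  proof -
    have "(dist z (cl x))\<^sup>2 \<le> (dist z x)\<^sup>2"
      unfolding dist_norm norm2_sq by (auto simp: cl_def z_def max_def)
    then have "dist z (cl x) \<le> dist z x" by (rule power2_le_imp_le) simp
    then show ?thesis using that by simp
  qed
  have contcl: "continuous_on X cl" for X unfolding cl_def by (intro continuous_intros)
  define F where "F c x = W_pair h c (cl x)" for c x
  define F' where "F' c x v = (if x$2 > 0 then W_pair' h c x v else 0)" for c x v
  have ax: "W_pair h c x = 0" "W_pair' h c x v = 0" if "x \<in> ball z r" "x$2 = 0" for x c v
  proof -
    have x: "x = pt (x$1) 0" using that(2) by (simp add: vec2_eq)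
    have "W h x = 0" "gW h x = 0" "KW h x v = 0"
      using flat[OF inab[OF that(1)]] g0[OF inab[OF that(1)]] K0[OF inab[OF that(1)]] x by metis+
    then show "W_pair h c x = 0" "W_pair' h c x v = 0" by (auto simp: W_pair_def W_pair'_def complex_eq_iff)
  qed
  have F'cl: "F' c x v = W_pair' h c (cl x) v" if "x \<in> ball z r" for c x v
  proof (cases "x$2 > 0")
    case True
    then show ?thesis by (simp add: F'_def cl_def max_def)
  next
    case False
    then show ?thesis using ax(2)[OF cl_in[OF that]] by (simp add: F'_def cl_def)
  qed
  have F_up: "F c x = W_pair h c x" if "x$2 \<ge> 0" for c x using that by (simp add: F_def cl_def max_def)
  have F_low: "F c x = 0" if "x \<in> ball z r" "x$2 \<le> 0" for c x
    using ax(1)[OF cl_in[OF that(1)]] that by (simp add: F_def cl_def max_def)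
  obtain C where C: "C > 0" "\<And>h b x. x \<in> shift_dom h \<Longrightarrow>
    norm (W_pair' h b x (axis 1 1) + \<i> * W_pair' h b x (axis 2 1)) \<le> C * norm (W_pair h (\<not> b) x)" using W_pair_dbar by blast
  \<comment> \<open>The centre \<open>z - pt 0 r\<close> belongs to a ball below the axis that
    touches it at \<open>z\<close>; the extension is zero there.\<close>
  have "\<exists>e>0. \<forall>x\<in>ball z e. \<forall>c. F c x = 0"
  proof (rule dbar_unique_continuation[where F'=F' and C=C and \<eta>="z - pt 0 r" and \<rho>=r and r=r])
    fix c x assume x: "x \<in> ball z r"
    have xd: "x \<in> shift_dom h" using x r by blast
    consider "x$2 > 0" | "x$2 < 0" | "x$2 = 0" by linarith
    then show "(F c has_derivative F' c x) (at x)"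
    proof cases
      case 1
      have op: "open {y::real^2. y$2 > 0}" by (rule open_halfspace_component_gt_cart)
      from has_derivative_transform_within_open[OF W_pair_derivative[OF xd, of c] op, of "F c"]
      show ?thesis using 1 F_up by (simp add: F'_def[abs_def])
    next
      case 2
      have op: "open ({y::real^2. y$2 < 0} \<inter> ball z r)"
        by (intro open_Int open_halfspace_component_lt_cart open_ball)
      have "((\<lambda>y. 0) has_derivative (\<lambda>v. 0)) (at x)" by simp
      from has_derivative_transform_within_open[OF this op, of "F c"]
      show ?thesis using 2 F_low x by (simp add: F'_def[abs_def])
    next
      case 3
      have "F' c x = (\<lambda>v. 0)" using 3 by (auto simp: F'_def)
      have "W_pair' h c x = (\<lambda>v. 0)" using ax(2)[OF x 3] by auto
      then have "((\<lambda>y. norm (W_pair h c y - W_pair h c x) / norm (y - x)) \<longlongrightarrow> 0) (at x)"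
        using W_pair_derivative[OF xd, of c] by (simp add: has_derivative_iff_norm)
      moreover have "\<forall>\<^sub>F y in at x. norm (norm (F c y - F c x) / norm (y - x)) \<le> norm (W_pair h c y - W_pair h c x) / norm (y - x)"
      proof -
        have "\<forall>\<^sub>F y in at x. y \<in> ball z r" using x eventually_at_ball' by (intro eventually_at_in_open') auto
        then show ?thesis
        proof eventually_elim
          case (elim y)
          have "norm (F c y - F c x) \<le> norm (W_pair h c y - W_pair h c x)"
            using F_up[of y c] F_low[OF elim, of c] F_low[OF x, of c] ax(1)[OF x 3, of c] 3
            by (cases "y$2 \<ge> 0") auto
          then show ?case by (simp add: divide_right_mono)
        qed
      qed
      ultimately have "((\<lambda>y. norm (F c y - F c x) / norm (y - x)) \<longlongrightarrow> 0) (at x)"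
        by (rule Lim_null_comparison[rotated])
      then show ?thesis unfolding \<open>F' c x = (\<lambda>v. 0)\<close> by (simp add: has_derivative_iff_norm)
    qed
  next
    fix c v
    have "continuous_on (ball z r) (\<lambda>x. W_pair' h c (cl x) v)"
      by (rule continuous_on_compose2[OF continuous_W_pair' contcl]) (use cl_in r in blast)
    then show "continuous_on (ball z r) (\<lambda>x. F' c x v)"
      by (rule continuous_on_eq) (simp add: F'cl)
  next
    fix c x assume "x \<in> ball z r"
    then show "norm (F' c x (axis 1 1) + \<i> * F' c x (axis 2 1)) \<le> C * norm (F (\<not> c) x)"
      using C(2)[of "cl x" h c] cl_in r by (simp add: F'cl F_def subset_iff)
  next
    fix c x assume x: "x \<in> ball z r" "dist (z - pt 0 r) x < r"
    have "\<bar>x$2 + r\<bar> \<le> dist (z - pt 0 r) x"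
      using component_le_norm_cart[of "x - (z - pt 0 r)" 2] by (simp add: z_def dist_norm norm_minus_commute)
    then have "x$2 < 0" using x(2) by linarith
    then show "F c x = 0" using F_low[OF x(1)] by simp
  next
    show "dist (z - pt 0 r) z = r" using r by (simp add: dist_norm norm_eq_sqrt_inner inner2)
  qed (use r C in auto)
  then obtain e where e: "e > 0" "\<forall>x\<in>ball z e. \<forall>c. F c x = 0" by blast
  have W0: "W h x = 0" if x: "x \<in> ball z e" for x
  proof -
    have "(dist z (fold_up x))\<^sup>2 = (dist z x)\<^sup>2" unfolding dist_norm norm2_sq by (simp add: fold_up_def z_def)
    then have "dist z (fold_up x) = dist z x" by (rule power2_eq_imp_eq) auto
    then have "F False (fold_up x) = 0" using e(2) x by simp
    moreover have "(fold_up x)$2 \<ge> 0" by (simp add: fold_up_def)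
    ultimately have "W h (fold_up x) = 0" using F_up[of "fold_up x" False] by (simp add: W_pair_def)
    then show ?thesis by (simp add: W_fold_up)
  qed
  then have "ball z e \<subseteq> {x. W h x = 0}" by blast
  then show ?thesis unfolding z_def[symmetric] using e(1) by (meson centre_in_ball interior_maximal open_ball subsetD)
qed

text \<open>With \<open>h\<close> half the length of the flat piece, \<open>W h\<close> vanishes
  over its first half, hence near it, and then along the axis up to the end \<open>p\<close>. There
  \<open>U\<close> is zero, so it would also be zero at the interior point
  \<open>p + h\<close>.\<close>

lemma no_flat_segment:
  assumes seg: "\<And>s. p < s \<Longrightarrow> s < q \<Longrightarrow> pt s 0 \<in> E - H" and end0: "U (pt p 0) = 0"
    and "p < s1" "s1 < s2" "s2 < q"
    and flat: "\<And>s. s1 \<le> s \<Longrightarrow> s \<le> s2 \<Longrightarrow> g (pt s 0) $ 1 = 0"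
  shows False
proof -
  define h where "h = (s2 - s1) / 2"
  have h: "h > 0" "s1 + h < s2" "s1 + 2 * h = s2" using assms by (auto simp: h_def field_simps)
  have W0: "W h (pt s 0) = 0" if "s1 \<le> s" "s + h \<le> s2" for s
  proof -
    have "\<exists>t. 0 < t \<and> t < h \<and> W h (pt s 0) = h * g (pt s 0 + pt t 0) $ 1"
      by (rule W_mean_value[OF h(1)]) (use seg that assms in auto)
    then obtain t where "0 < t" "t < h" "W h (pt s 0) = h * g (pt (s + t) 0) $ 1" by auto
    then show ?thesis using flat[of "s + t"] that by simp
  qed
  define m where "m = s1 + h/2"
  have m: "pt m 0 \<in> interior {x. W h x = 0}"
  proof (rule W_zero_near_axis[where a=s1 and b="s1 + h"])
    fix s assume s: "s1 < s" "s < s1 + h"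
    then show "pt s 0 \<in> shift_dom h \<and> W h (pt s 0) = 0 \<and> g (pt s 0) $ 1 = 0 \<and> g (pt (s + h) 0) $ 1 = 0"
      using W0[of s] flat[of s] flat[of "s + h"] seg[of s] seg[of "s + h"] assms h by (auto simp: shift_dom_def)
  qed (use h in \<open>auto simp: m_def\<close>)
  define S where "S = (\<lambda>s. pt s 0) ` {p<..<q - h}"
  have "connected S" unfolding S_def by (intro connected_continuous_image continuous_intros) auto
  moreover have "S \<subseteq> shift_dom h" using seg h by (auto simp: S_def shift_dom_def)
  moreover have "pt m 0 \<in> S" using assms h by (auto simp: S_def m_def)
  ultimately have S0: "S \<subseteq> {x. W h x = 0}" using W_continuation m interior_subset by blast
  have c: "((\<lambda>s. W h (pt s 0)) \<longlongrightarrow> W h (pt p 0)) (at_right p)"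
  proof -
    have "continuous_on UNIV (\<lambda>s. W h (pt s 0))"
      by (rule continuous_on_compose2[OF continuous_W[of UNIV h]]) (auto intro!: continuous_intros)
    then show ?thesis
      by (simp add: continuous_on_eq_continuous_at continuous_at filterlim_at_split)
  qed
  have "p < q - h" using assms h by simp
  moreover have "W h (pt s 0) = 0" if "p < s" "s < q - h" for s
    using S0 that unfolding S_def by (auto simp: image_subset_iff)
  ultimately have "\<forall>\<^sub>F s in at_right p. W h (pt s 0) = 0"
    by (intro eventually_at_rightI[of p "q - h"]) auto
  then have "((\<lambda>s. W h (pt s 0)) \<longlongrightarrow> 0) (at_right p)" by (rule tendsto_eventually)
  then have "W h (pt p 0) = 0" using c tendsto_unique trivial_limit_at_right_real by blast
  then have "U (pt (p + h) 0) = 0" using end0 by (simp add: W_def)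
  moreover have "U (pt (p + h) 0) > 0" by (rule U_pos, rule seg) (use assms h in auto)
  ultimately show False by simp
qed

section \<open>Sign changes of the derivative on an axis segment\<close>

lemma dist_pt_shift [simp]: "dist x (x + pt t 0) = \<bar>t\<bar>"
  by (simp add: dist_norm norm_eq_sqrt_inner inner2)

lemma W_upper_ball:
  assumes "ball z r1 \<subseteq> E - H" "\<And>x. x \<in> ball z r1 \<Longrightarrow> g x $ 1 < \<mu>"
    and "x \<in> ball z r" "h > 0" "r + h \<le> r1"
  shows "W h x < \<mu> * h"
proof -
  have inb: "x + pt t 0 \<in> ball z r1" if "0 \<le> t" "t \<le> h" for t
    using dist_triangle[of z "x + pt t 0" x] assms that by simp
  have "\<exists>t. 0 < t \<and> t < h \<and> W h x = h * g (x + pt t 0) $ 1"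
    by (rule W_mean_value[OF \<open>h > 0\<close>]) (use inb assms(1) in blast)
  then obtain t where "0 < t" "t < h" "W h x = h * g (x + pt t 0) $ 1" by blast
  then show ?thesis using assms(2)[OF inb[of t]] assms(4) by simp
qed

lemma W_lower_ball:
  assumes "ball z r1 \<subseteq> E - H" "\<And>x. x \<in> ball z r1 \<Longrightarrow> \<mu> < g x $ 1"
    and "x \<in> ball z r" "h > 0" "r + h \<le> r1"
  shows "\<mu> * h < W h x"
proof -
  have inb: "x + pt t 0 \<in> ball z r1" if "0 \<le> t" "t \<le> h" for t
    using dist_triangle[of z "x + pt t 0" x] assms that by simp
  have "\<exists>t. 0 < t \<and> t < h \<and> W h x = h * g (x + pt t 0) $ 1"
    by (rule W_mean_value[OF \<open>h > 0\<close>]) (use inb assms(1) in blast)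
  then obtain t where "0 < t" "t < h" "W h x = h * g (x + pt t 0) $ 1" by blast
  then show ?thesis using assms(2)[OF inb[of t]] assms(4) by simp
qed

lemma g_less_ball:
  assumes "z \<in> E - H" "g z $ 1 < \<mu>"
  shows "\<exists>r>0. ball z r \<subseteq> E - H \<and> (\<forall>x\<in>ball z r. g x $ 1 < \<mu>)"
proof -
  obtain r1 where "r1 > 0" "ball z r1 \<subseteq> E - H" using assms(1) open_dom open_contains_ball by blast
  moreover obtain d where "d > 0" "\<And>x. dist x z < d \<Longrightarrow> \<bar>g x $ 1 - g z $ 1\<bar> < \<mu> - g z $ 1"
    using isCont_g[OF assms(1)] assms(2) unfolding continuous_at_eps_delta dist_real_def
    by (metis diff_gt_0_iff_gt)
  ultimately show ?thesis
    by (intro exI[of _ "min r1 d"]) (force simp: dist_commute abs_less_iff)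
qed

lemma g_greater_ball:
  assumes "z \<in> E - H" "\<mu> < g z $ 1"
  shows "\<exists>r>0. ball z r \<subseteq> E - H \<and> (\<forall>x\<in>ball z r. \<mu> < g x $ 1)"
proof -
  obtain r1 where "r1 > 0" "ball z r1 \<subseteq> E - H" using assms(1) open_dom open_contains_ball by blast
  moreover obtain d where "d > 0" "\<And>x. dist x z < d \<Longrightarrow> \<bar>g x $ 1 - g z $ 1\<bar> < g z $ 1 - \<mu>"
    using isCont_g[OF assms(1)] assms(2) unfolding continuous_at_eps_delta dist_real_def
    by (metis diff_gt_0_iff_gt)
  ultimately show ?thesis
    by (intro exI[of _ "min r1 d"]) (force simp: dist_commute abs_less_iff)
qed

lemma small_shift: "\<exists>d>0. \<forall>h. 0 < h \<longrightarrow> h < d \<longrightarrow> (\<forall>x\<in>H. x + pt h 0 \<in> E \<and> x - pt h 0 \<in> E)"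
proof -
  obtain d where d: "d > 0" "(\<Union>x\<in>H. ball x d) \<subseteq> E"
    using compact_subset_open_imp_ball_epsilon_subset[OF compH openE HE] by blast
  have "x + pt h 0 \<in> E \<and> x - pt h 0 \<in> E" if "0 < h" "h < d" "x \<in> H" for h x
  proof -
    have "dist x (x + pt h 0) < d" "dist x (x + pt (- h) 0) < d" using that unfolding dist_pt_shift by auto
    moreover have "x - pt h 0 = x + pt (- h) 0" by (simp add: vec2_eq)
    ultimately have "x + pt h 0 \<in> ball x d" "x - pt h 0 \<in> ball x d" by (simp_all only: mem_ball)
    then show ?thesis using d(2) that(3) by blast
  qed
  then show ?thesis using d(1) by blast
qed

text \<open>Bounds in a ball centred on the axis hold on the feet of its points, as
  \<open>no_crossing\<close> requires.\<close>

lemma vertical_in_ball: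
  assumes "n \<in> ball (pt z 0) r" "0 \<le> s" "s \<le> \<bar>n$2\<bar>"
  shows "pt (n$1) s \<in> ball (pt z 0) r"
proof -
  have "s\<^sup>2 \<le> (n$2)\<^sup>2" using power_mono[OF assms(3,2), of 2] by simp
  then have "(dist (pt z 0) (pt (n$1) s))\<^sup>2 \<le> (dist (pt z 0) n)\<^sup>2"
    unfolding dist_norm norm2_sq by simp
  then have "dist (pt z 0) (pt (n$1) s) \<le> dist (pt z 0) n" by (rule power2_le_imp_le) simp
  then show ?thesis using assms(1) by simp
qed

lemma ball_component1: "n \<in> ball (pt z 0) r \<Longrightarrow> \<bar>n$1 - z\<bar> < r"
  using component_le_norm_cart[of "n - pt z 0" 1] by (simp add: dist_norm norm_minus_commute)

context
  fixes p q :: real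
  assumes seg: "\<And>s. p < s \<Longrightarrow> s < q \<Longrightarrow> pt s 0 \<in> E - H"
    and side: "(\<forall>x. pt x 0 \<in> H \<longrightarrow> x \<le> p) \<or> (\<forall>x. pt x 0 \<in> H \<longrightarrow> q \<le> x)"
begin

text \<open>A negative point \<open>n\<close> near \<open>z\<close> contradicts
  \<open>no_crossing\<close> with the thresholds 0 and \<open>\<kappa> * h\<close>, where
  \<open>\<kappa>\<close> separates the derivative near \<open>z\<close> from its value at
  \<open>b\<close>. The gap between them is what allows \<open>n\<close> to lie off the
  axis.\<close>

lemma nonneg_left_of_positive:
  assumes zb: "p < z" "z < b" "b < q" and gb: "g (pt b 0) $ 1 > 0" and gz: "g (pt z 0) $ 1 \<le> 0"
  shows "\<exists>r>0. ball (pt z 0) r \<subseteq> E - H \<and> (\<forall>x\<in>ball (pt z 0) r. 0 \<le> g x $ 1)"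
proof -
  define \<kappa> where "\<kappa> = g (pt b 0) $ 1 / 2"
  have \<kappa>: "\<kappa> > 0" "\<kappa> < g (pt b 0) $ 1" using gb by (auto simp: \<kappa>_def)
  have dom: "pt z 0 \<in> E - H" "pt b 0 \<in> E - H" using seg zb by auto
  obtain r1 where r1: "r1 > 0" "ball (pt z 0) r1 \<subseteq> E - H" "\<And>x. x \<in> ball (pt z 0) r1 \<Longrightarrow> g x $ 1 < \<kappa>"
    using g_less_ball[OF dom(1), of \<kappa>] gz \<kappa> by auto
  obtain r2 where r2: "r2 > 0" "ball (pt b 0) r2 \<subseteq> E - H" "\<And>x. x \<in> ball (pt b 0) r2 \<Longrightarrow> \<kappa> < g x $ 1"
    using g_greater_ball[OF dom(2) \<kappa>(2)] by auto
  \<comment> \<open>Half of \<open>r1\<close> leaves room for the shift by \<open>h\<close>; the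
    other bounds keep the abscissa of \<open>n\<close> between \<open>p\<close> and
    \<open>b\<close>.\<close>
  define r where "r = min (r1/2) (min (z - p) (b - z))"
  have r: "r > 0" "r \<le> r1/2" "r \<le> z - p" "r \<le> b - z" using r1 zb by (auto simp: r_def simp del: le_divide_eq_numeral1)
  have "0 \<le> g n $ 1" if n: "n \<in> ball (pt z 0) r" for n
  proof (rule ccontr)
    assume "\<not> 0 \<le> g n $ 1"
    moreover have "n \<in> E - H" using n r r1 by (auto simp: subset_eq)
    ultimately obtain r3 where r3: "r3 > 0" "ball n r3 \<subseteq> E - H" "\<And>x. x \<in> ball n r3 \<Longrightarrow> g x $ 1 < 0"
      using g_less_ball[of n 0] by auto
    obtain d where d: "d > 0" "\<And>h x. 0 < h \<Longrightarrow> h < d \<Longrightarrow> x \<in> H \<Longrightarrow> x + pt h 0 \<in> E \<and> x - pt h 0 \<in> E"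
      using small_shift by blast
    define h where "h = min (min (r1/2) (r2/2)) (min (r3/2) (min d (q - b))) / 2"
    have h: "h > 0" "h < r1/2" "h < r2/2" "h < r3/2" "h < d" "h < q - b"
      using r1 r2 r3 d zb by (auto simp: h_def)
    have n1: "p < n$1" "n$1 < b" using ball_component1[OF n] r by auto
    show False
    proof (rule no_crossing[where h=h and e=0 and d="\<kappa> * h" and n=n and p="pt b 0"])
      show "W h n < - 0" using W_upper_ball[OF r3(2,3), of n "r3/2" h] r3 h by simp
      show "\<kappa> * h < W h (pt b 0)" using W_lower_ball[OF r2(2,3), of "pt b 0" "r2/2" h] r2 h by simp
      show "pt (n$1) s \<in> E - H \<and> pt (n$1 + h) s \<in> E - H \<and> W h (pt (n$1) s) \<le> \<kappa> * h"
        if s: "0 \<le> s" "s \<le> \<bar>n$2\<bar>" for s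
      proof -
        have v: "pt (n$1) s \<in> ball (pt z 0) r" by (rule vertical_in_ball[OF n s])
        then have "dist (pt z 0) (pt (n$1) s + pt h 0) < r1"
          using dist_triangle[of "pt z 0" "pt (n$1) s + pt h 0" "pt (n$1) s"] dist_pt_shift[of "pt (n$1) s" h] h r by auto
        then have "pt (n$1) s \<in> E - H" "pt (n$1 + h) s \<in> E - H" using v r r1(2) by (auto simp: subset_eq)
        moreover have "W h (pt (n$1) s) < \<kappa> * h" by (rule W_upper_ball[OF r1(2,3) v]) (use h r in auto)
        ultimately show ?thesis by simp
      qed
      show "pt (pt b 0 $ 1) s \<in> E - H \<and> pt (pt b 0 $ 1 + h) s \<in> E - H \<and> - 0 \<le> W h (pt (pt b 0 $ 1) s)"
        if s: "0 \<le> s" "s \<le> \<bar>pt b 0 $ 2\<bar>" for s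
      proof -
        have "s = 0" using s by simp
        moreover have "\<kappa> * h < W h (pt b 0)" using W_lower_ball[OF r2(2,3), of "pt b 0" "r2/2" h] r2 h by simp
        moreover have "0 < \<kappa> * h" using \<kappa> h by simp
        ultimately show ?thesis using dom(2) seg[of "b + h"] h zb by auto
      qed
      show "(\<forall>x. pt x 0 \<in> H \<longrightarrow> x < n$1) \<or> (\<forall>x. pt x 0 \<in> H \<longrightarrow> pt b 0 $ 1 + h < x)"
        using side n1 h by force
    qed (use h d n1 \<kappa> in auto)
  qed
  moreover have "ball (pt z 0) r \<subseteq> E - H" using r1 r by (auto simp: subset_eq)
  ultimately show ?thesis using r(1) by blast
qed

text \<open>The counterpart of \<open>nonneg_left_of_positive\<close>: now the negative point sits
  on the axis and the positive one is near \<open>z\<close>, so the thresholds become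
  \<open>\<kappa> * h\<close> and 0.\<close>

lemma nonpos_right_of_negative:
  assumes az: "p < a" "a < z" "z < q" and ga: "g (pt a 0) $ 1 < 0" and gz: "g (pt z 0) $ 1 \<ge> 0"
  shows "\<exists>r>0. ball (pt z 0) r \<subseteq> E - H \<and> (\<forall>x\<in>ball (pt z 0) r. g x $ 1 \<le> 0)"
proof -
  define \<kappa> where "\<kappa> = - g (pt a 0) $ 1 / 2"
  have \<kappa>: "\<kappa> > 0" "g (pt a 0) $ 1 < - \<kappa>" using ga by (auto simp: \<kappa>_def)
  have dom: "pt z 0 \<in> E - H" "pt a 0 \<in> E - H" using seg az by auto
  obtain r1 where r1: "r1 > 0" "ball (pt z 0) r1 \<subseteq> E - H" "\<And>x. x \<in> ball (pt z 0) r1 \<Longrightarrow> - \<kappa> < g x $ 1"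
    using g_greater_ball[OF dom(1), of "- \<kappa>"] gz \<kappa> by auto
  obtain r2 where r2: "r2 > 0" "ball (pt a 0) r2 \<subseteq> E - H" "\<And>x. x \<in> ball (pt a 0) r2 \<Longrightarrow> g x $ 1 < - \<kappa>"
    using g_less_ball[OF dom(2) \<kappa>(2)] by auto
  \<comment> \<open>The shift moves towards the end \<open>q\<close>, so half of
    \<open>q - z\<close> is reserved for the ball and half for \<open>h\<close>.\<close>
  define r where "r = min (r1/2) (min (z - a) ((q - z) / 2))"
  have r: "r > 0" "r \<le> r1/2" "r \<le> z - a" "r \<le> (q - z) / 2" using r1 az by (auto simp: r_def simp del: le_divide_eq_numeral1)
  have "g n $ 1 \<le> 0" if n: "n \<in> ball (pt z 0) r" for n
  proof (rule ccontr)
    assume "\<not> g n $ 1 \<le> 0"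
    moreover have "n \<in> E - H" using n r r1 by (auto simp: subset_eq)
    ultimately obtain r3 where r3: "r3 > 0" "ball n r3 \<subseteq> E - H" "\<And>x. x \<in> ball n r3 \<Longrightarrow> 0 < g x $ 1"
      using g_greater_ball[of n 0] by auto
    obtain d where d: "d > 0" "\<And>h x. 0 < h \<Longrightarrow> h < d \<Longrightarrow> x \<in> H \<Longrightarrow> x + pt h 0 \<in> E \<and> x - pt h 0 \<in> E"
      using small_shift by blast
    define m where "m = min (min (r1/2) (r2/2)) (min (r3/2) (min d ((q - z) / 2)))"
    have m: "m > 0" "m \<le> r1/2" "m \<le> r2/2" "m \<le> r3/2" "m \<le> d" "m \<le> (q - z) / 2"
      using r1(1) r2(1) r3(1) d(1) az unfolding m_def by (auto simp del: le_divide_eq_numeral1)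
    define h where "h = m / 2"
    have h: "h > 0" "h < r1/2" "h < r2/2" "h < r3/2" "h < d" "h < (q - z) / 2"
      using m by (auto simp: h_def)
    have n1: "a < n$1" "n$1 + h < q" using ball_component1[OF n] r h by auto
    have Wa: "W h (pt a 0) < - \<kappa> * h" using W_upper_ball[OF r2(2,3), of "pt a 0" "r2/2" h] r2 h by simp
    have "0 < \<kappa> * h" using \<kappa> h by simp
    show False
    proof (rule no_crossing[where h=h and e="\<kappa> * h" and d=0 and n="pt a 0" and p=n])
      show "W h (pt a 0) < - (\<kappa> * h)" using Wa by simp
      show "0 < W h n" using W_lower_ball[OF r3(2,3), of n "r3/2" h] r3 h by simp
      show "pt (n$1) s \<in> E - H \<and> pt (n$1 + h) s \<in> E - H \<and> - (\<kappa> * h) \<le> W h (pt (n$1) s)"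
        if s: "0 \<le> s" "s \<le> \<bar>n$2\<bar>" for s
      proof -
        have v: "pt (n$1) s \<in> ball (pt z 0) r" by (rule vertical_in_ball[OF n s])
        then have "dist (pt z 0) (pt (n$1) s + pt h 0) < r1"
          using dist_triangle[of "pt z 0" "pt (n$1) s + pt h 0" "pt (n$1) s"] dist_pt_shift[of "pt (n$1) s" h] h r by auto
        then have "pt (n$1) s \<in> E - H" "pt (n$1 + h) s \<in> E - H" using v r r1(2) by (auto simp: subset_eq)
        moreover have "- \<kappa> * h < W h (pt (n$1) s)" by (rule W_lower_ball[OF r1(2,3) v]) (use h r in auto)
        ultimately show ?thesis by simp
      qed
      show "pt (pt a 0 $ 1) s \<in> E - H \<and> pt (pt a 0 $ 1 + h) s \<in> E - H \<and> W h (pt (pt a 0 $ 1) s) \<le> 0"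
        if s: "0 \<le> s" "s \<le> \<bar>pt a 0 $ 2\<bar>" for s
      proof -
        have "s = 0" using s by simp
        then show ?thesis using dom(2) seg[of "a + h"] h az n1 Wa \<open>0 < \<kappa> * h\<close> by auto
      qed
      show "(\<forall>x. pt x 0 \<in> H \<longrightarrow> x < pt a 0 $ 1) \<or> (\<forall>x. pt x 0 \<in> H \<longrightarrow> n$1 + h < x)"
        using side n1 az by force
    qed (use h d n1 \<kappa> in auto)
  qed
  moreover have "ball (pt z 0) r \<subseteq> E - H" using r1 r by (auto simp: subset_eq)
  ultimately show ?thesis using r(1) by blast
qed

context
  assumes pq: "p < q" and ends: "U (pt p 0) = 0" "U (pt q 0) = 0"
begin

text \<open>The strong maximum principle spreads the zero to a ball of half the radius, hence to a
  piece of the axis, which \<open>no_flat_segment\<close> excludes.\<close>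

lemma not_touching:
  assumes "p < z" "z < q" "r > 0" "ball (pt z 0) r \<subseteq> E - H" "sg = 1 \<or> sg = - 1"
    "\<And>x. x \<in> ball (pt z 0) r \<Longrightarrow> 0 \<le> sg * g x $ 1" "g (pt z 0) $ 1 = 0"
  shows False
proof -
  define d where "d = min (r/4) (min ((z - p)/2) ((q - z)/2))"
  have d: "d > 0" "d \<le> r/4" "d \<le> (z - p)/2" "d \<le> (q - z)/2" using assms(1-3) by (auto simp: d_def simp del: le_divide_eq_numeral1)
  have flat: "g (pt s 0) $ 1 = 0" if s: "z - d \<le> s" "s \<le> z + d" for s
  proof -
    have "dist (pt z 0) (pt z 0 + pt (s - z) 0) < r/2" using s d(1,2) assms(3) unfolding dist_pt_shift by linarith
    then have "pt s 0 \<in> ball (pt z 0) (r/2)" by simp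
    then show ?thesis using gradient_strong_maximum_principle[OF assms(3-7)] by blast
  qed
  show False
    by (rule no_flat_segment[OF seg ends(1), where ?s1.0="z - d" and ?s2.0="z + d"])
      (use flat d assms(1,2) in auto)
qed

text \<open>Existence is Rolle's theorem. A positive value forces positive values everywhere to its
  left, a negative one negative values everywhere to its right; so between two zeros the derivative
  can have neither sign and the segment is flat.\<close>

lemma unique_critical_on_segment: "\<exists>!s. p < s \<and> s < q \<and> g (pt s 0) $ 1 = 0"
proof -
  have dU: "((\<lambda>s. U (pt s 0)) has_real_derivative g (pt s 0) $ 1) (at s)" if "p < s" "s < q" for s
    using dU_line[of 0 s] seg[OF that] by simp
  have "continuous_on {p..q} (\<lambda>s. U (pt s 0))" by (intro continuous_intros)
  then obtain s where s: "p < s" "s < q" "((\<lambda>s. U (pt s 0)) has_real_derivative 0) (at s)"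
    using Rolle[OF pq, of "\<lambda>s. U (pt s 0)"] ends dU real_differentiable_def by metis
  then have ex: "g (pt s 0) $ 1 = 0" using dU[OF s(1,2)] DERIV_unique by blast
  have pos: "g (pt z 0) $ 1 > 0" if t: "p < z" "z < b" "b < q" "g (pt b 0) $ 1 > 0" for z b
  proof (rule ccontr)
    assume "\<not> g (pt z 0) $ 1 > 0"
    then obtain r where r: "r > 0" "ball (pt z 0) r \<subseteq> E - H" "\<forall>x\<in>ball (pt z 0) r. 0 \<le> g x $ 1"
      using nonneg_left_of_positive[OF t] by auto
    moreover have "pt z 0 \<in> ball (pt z 0) r" using r by simp
    ultimately have "0 \<le> g (pt z 0) $ 1" by blast
    then have "g (pt z 0) $ 1 = 0" using \<open>\<not> g (pt z 0) $ 1 > 0\<close> by linarith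
    then show False using not_touching[of z r 1] r t by auto
  qed
  have neg: "g (pt z 0) $ 1 < 0" if t: "p < a" "a < z" "z < q" "g (pt a 0) $ 1 < 0" for z a
  proof (rule ccontr)
    assume "\<not> g (pt z 0) $ 1 < 0"
    then obtain r where r: "r > 0" "ball (pt z 0) r \<subseteq> E - H" "\<forall>x\<in>ball (pt z 0) r. g x $ 1 \<le> 0"
      using nonpos_right_of_negative[OF t] by auto
    moreover have "pt z 0 \<in> ball (pt z 0) r" using r by simp
    ultimately have "g (pt z 0) $ 1 \<le> 0" by blast
    then have "g (pt z 0) $ 1 = 0" using \<open>\<not> g (pt z 0) $ 1 < 0\<close> by linarith
    then show False using not_touching[of z r "- 1"] r t by auto
  qed
  have uniq: False if t: "p < z1" "z1 < z2" "z2 < q" "g (pt z1 0) $ 1 = 0" "g (pt z2 0) $ 1 = 0" for z1 z2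
  proof -
    have "g (pt s 0) $ 1 = 0" if "z1 \<le> s" "s \<le> z2" for s
    proof (rule ccontr)
      assume nz: "g (pt s 0) $ 1 \<noteq> 0"
      then have "z1 < s" "s < z2" using that \<open>g (pt z1 0) $ 1 = 0\<close> \<open>g (pt z2 0) $ 1 = 0\<close> by (auto simp: le_less)
      then show False using pos[of z1 s] neg[of s z2] nz \<open>p < z1\<close> \<open>z2 < q\<close> \<open>g (pt z1 0) $ 1 = 0\<close> \<open>g (pt z2 0) $ 1 = 0\<close>
        by (cases "g (pt s 0) $ 1 > 0") auto
    qed
    then show False using no_flat_segment[OF seg ends(1) t(1-3)] by blast
  qed
  show ?thesis
  proof (rule ex1I[of _ s])
    show "p < s \<and> s < q \<and> g (pt s 0) $ 1 = 0" using s ex by simp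
    fix t assume "p < t \<and> t < q \<and> g (pt t 0) $ 1 = 0"
    then show "t = s" using uniq[of s t] uniq[of t s] s ex by (cases s t rule: linorder_cases) auto
  qed
qed

end

end

section \<open>Counting critical points and transport by rigid motions\<close>

lemma GDERIV_zero_iff: assumes "x \<in> E - H" shows "GDERIV U x :> 0 \<longleftrightarrow> g x = 0"
proof
  assume "GDERIV U x :> 0"
  then have "(U has_derivative (\<lambda>v. 0)) (at x)" by (simp add: gderiv_def)
  then have "(\<lambda>v. 0) = (\<bullet>) (g x)" using has_derivative_unique C2_dataD(1)[OF C2 assms] by blast
  then show "g x = 0" by (metis inner_eq_zero_iff)
next
  assume "g x = 0"
  then have "(\<lambda>v. v \<bullet> 0) = (\<bullet>) (g x)" by auto
  then show "GDERIV U x :> 0" unfolding gderiv_def using C2_dataD(1)[OF C2 assms] by simp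
qed

lemma axis_section_E: "\<exists>\<rho>. \<forall>s. pt s 0 \<in> E \<longleftrightarrow> \<bar>s - c\<bar> < \<rho>"
proof -
  define S where "S = {s. pt s 0 \<in> E}"
  have "open ((\<lambda>s. pt s 0) -` E)" by (intro open_vimage openE continuous_intros)
  then have "open S" by (simp add: S_def vimage_def)
  have "k \<in> S" using center_in_H HE by (auto simp: S_def)
  obtain B where "\<And>x. x \<in> E \<Longrightarrow> norm x \<le> B" using bddE bounded_iff by blast
  then have "s \<le> B" if "s \<in> S" for s
    using that component_le_norm_cart[of "pt s 0" 1] unfolding S_def by force
  then have bdd: "bdd_above S" unfolding bdd_above_def by blast
  have "pt s 0 \<in> E \<longleftrightarrow> \<bar>s - c\<bar> < Sup S - c" for s
  proof
    assume "pt s 0 \<in> E"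
    then have "pt (c + \<bar>s - c\<bar>) 0 \<in> E" using xE[of "pt s 0" "c + \<bar>s - c\<bar>"] by simp
    then obtain e where "e > 0" "ball (c + \<bar>s - c\<bar>) e \<subseteq> S"
      using \<open>open S\<close> open_contains_ball unfolding S_def by blast
    then have "c + \<bar>s - c\<bar> + e/2 \<in> S" by (auto simp: subset_eq dist_real_def)
    from cSup_upper[OF this bdd] show "\<bar>s - c\<bar> < Sup S - c" using \<open>e > 0\<close> by simp
  next
    assume "\<bar>s - c\<bar> < Sup S - c"
    then have "\<bar>s - c\<bar> + c < Sup S" by simp
    moreover have "S \<noteq> {}" using \<open>k \<in> S\<close> by blast
    ultimately obtain t where "t \<in> S" "\<bar>s - c\<bar> + c < t" using less_cSup_iff[of S] bdd by blast
    then show "pt s 0 \<in> E" using xE[of "pt t 0" s] by (simp add: S_def)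
  qed
  then show ?thesis by blast
qed

lemma axis_section_H: "\<exists>\<eta>\<ge>0. \<forall>s. pt s 0 \<in> H \<longleftrightarrow> \<bar>s - k\<bar> \<le> \<eta>"
proof -
  define S where "S = {s. pt s 0 \<in> H}"
  have "closed ((\<lambda>s. pt s 0) -` H)"
    by (intro closed_vimage compact_imp_closed compH continuous_intros)
  then have "closed S" by (simp add: S_def vimage_def)
  have "k \<in> S" using center_in_H by (auto simp: S_def)
  obtain B where "\<And>x. x \<in> H \<Longrightarrow> norm x \<le> B" using compact_imp_bounded[OF compH] bounded_iff by blast
  then have "s \<le> B" if "s \<in> S" for s
    using that component_le_norm_cart[of "pt s 0" 1] unfolding S_def by force
  then have bdd: "bdd_above S" unfolding bdd_above_def by blast
  have SupS: "pt (Sup S) 0 \<in> H" using closed_contains_Sup[OF _ bdd \<open>closed S\<close>] \<open>k \<in> S\<close> by (auto simp: S_def)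
  have "pt s 0 \<in> H \<longleftrightarrow> \<bar>s - k\<bar> \<le> Sup S - k" for s
  proof
    assume "pt s 0 \<in> H"
    then have "pt (k + \<bar>s - k\<bar>) 0 \<in> H" using xH[of "pt s 0" "k + \<bar>s - k\<bar>"] by simp
    then show "\<bar>s - k\<bar> \<le> Sup S - k" using cSup_upper[OF _ bdd, of "k + \<bar>s - k\<bar>"] by (simp add: S_def)
  next
    assume "\<bar>s - k\<bar> \<le> Sup S - k"
    then show "pt s 0 \<in> H" using xH[OF SupS, of s] by simp
  qed
  moreover have "Sup S - k \<ge> 0" using cSup_upper[OF \<open>k \<in> S\<close> bdd] by simp
  ultimately show ?thesis by blast
qed

lemma two_critical_points_C2: "card {x \<in> E - H. GDERIV U x :> 0 \<and> x$2 = 0} = 2"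
proof -
  obtain \<rho> where \<rho>: "\<And>s. pt s 0 \<in> E \<longleftrightarrow> \<bar>s - c\<bar> < \<rho>" using axis_section_E by blast
  obtain \<eta> where \<eta>: "\<eta> \<ge> 0" "\<And>s. pt s 0 \<in> H \<longleftrightarrow> \<bar>s - k\<bar> \<le> \<eta>" using axis_section_H by blast
  have "pt (k + \<eta>) 0 \<in> H" "pt (k - \<eta>) 0 \<in> H" using \<eta> by auto
  then have ineq: "k + \<eta> < c + \<rho>" "c - \<rho> < k - \<eta>" using HE \<rho>[of "k + \<eta>"] \<rho>[of "k - \<eta>"] by auto
  have 1: "\<exists>!s. k + \<eta> < s \<and> s < c + \<rho> \<and> g (pt s 0) $ 1 = 0"
  proof (rule unique_critical_on_segment)
    show "U (pt (k + \<eta>) 0) = 0" by (rule U0) (use \<eta> in simp)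
    show "U (pt (c + \<rho>) 0) = 0" by (rule U0) (use abs_ge_self[of \<rho>] in \<open>simp add: \<rho>\<close>)
    show "pt s 0 \<in> E - H" if "k + \<eta> < s" "s < c + \<rho>" for s
      unfolding Diff_iff \<rho> \<eta>(2) using that ineq \<eta>(1) by linarith
    have "x \<le> k + \<eta>" if "pt x 0 \<in> H" for x using that unfolding \<eta>(2) by linarith
    then show "(\<forall>x. pt x 0 \<in> H \<longrightarrow> x \<le> k + \<eta>) \<or> (\<forall>x. pt x 0 \<in> H \<longrightarrow> c + \<rho> \<le> x)" by blast
  qed (rule ineq)
  have 2: "\<exists>!s. c - \<rho> < s \<and> s < k - \<eta> \<and> g (pt s 0) $ 1 = 0"
  proof (rule unique_critical_on_segment)
    show "U (pt (k - \<eta>) 0) = 0" by (rule U0) (use \<eta> in simp)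
    show "U (pt (c - \<rho>) 0) = 0" by (rule U0) (use abs_ge_self[of \<rho>] in \<open>simp add: \<rho>\<close>)
    show "pt s 0 \<in> E - H" if "c - \<rho> < s" "s < k - \<eta>" for s
      unfolding Diff_iff \<rho> \<eta>(2) using that ineq \<eta>(1) by linarith
    have "k - \<eta> \<le> x" if "pt x 0 \<in> H" for x using that unfolding \<eta>(2) by linarith
    then show "(\<forall>x. pt x 0 \<in> H \<longrightarrow> x \<le> c - \<rho>) \<or> (\<forall>x. pt x 0 \<in> H \<longrightarrow> k - \<eta> \<le> x)" by blast
  qed (rule ineq)
  obtain s1 where s1: "k + \<eta> < s1" "s1 < c + \<rho>" "g (pt s1 0) $ 1 = 0"
    and u1: "\<And>s. k + \<eta> < s \<Longrightarrow> s < c + \<rho> \<Longrightarrow> g (pt s 0) $ 1 = 0 \<Longrightarrow> s = s1" using 1 by blast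
  obtain s2 where s2: "c - \<rho> < s2" "s2 < k - \<eta>" "g (pt s2 0) $ 1 = 0"
    and u2: "\<And>s. c - \<rho> < s \<Longrightarrow> s < k - \<eta> \<Longrightarrow> g (pt s 0) $ 1 = 0 \<Longrightarrow> s = s2" using 2 by blast
  have crit: "pt s 0 \<in> E - H \<and> GDERIV U (pt s 0) :> 0 \<longleftrightarrow> s = s1 \<or> s = s2" for s
  proof
    assume *: "pt s 0 \<in> E - H \<and> GDERIV U (pt s 0) :> 0"
    then have "g (pt s 0) $ 1 = 0" using GDERIV_zero_iff[of "pt s 0"] by simp
    moreover have "\<bar>s - c\<bar> < \<rho>" "\<not> \<bar>s - k\<bar> \<le> \<eta>" using * \<rho>[of s] \<eta>(2)[of s] by auto
    then have "(k + \<eta> < s \<and> s < c + \<rho>) \<or> (c - \<rho> < s \<and> s < k - \<eta>)" by linarith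
    ultimately show "s = s1 \<or> s = s2" using u1 u2 by blast
  next
    assume "s = s1 \<or> s = s2"
    moreover have "\<bar>s1 - c\<bar> < \<rho>" "\<not> \<bar>s1 - k\<bar> \<le> \<eta>" "\<bar>s2 - c\<bar> < \<rho>" "\<not> \<bar>s2 - k\<bar> \<le> \<eta>"
      using s1(1,2) s2(1,2) ineq \<eta>(1) by linarith+
    ultimately have "pt s 0 \<in> E - H" "g (pt s 0) $ 1 = 0" using s1(3) s2(3) \<rho>[of s] \<eta>(2)[of s] by auto
    then show "pt s 0 \<in> E - H \<and> GDERIV U (pt s 0) :> 0"
      using GDERIV_zero_iff[of "pt s 0"] gradient_on_axis[of s] by (simp add: vec2_eq)
  qed
  have "{x \<in> E - H. GDERIV U x :> 0 \<and> x$2 = 0} = {pt s1 0, pt s2 0}"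
  proof (intro subset_antisym subsetI)
    fix x assume "x \<in> {x \<in> E - H. GDERIV U x :> 0 \<and> x$2 = 0}"
    moreover from this have "x = pt (x$1) 0" by (simp add: vec2_eq)
    ultimately show "x \<in> {pt s1 0, pt s2 0}" using crit[of "x$1"] by auto
  qed (use crit in auto)
  moreover have "s1 \<noteq> s2" using s1 s2 \<eta> by auto
  ultimately show ?thesis by simp
qed

end

lemma (in annulus) two_critical_points: "card {x \<in> E - H. GDERIV U x :> 0 \<and> x$2 = 0} = 2"
proof -
  obtain g K where "C2_data U g K (E - H)" "\<And>x. x \<in> E - H \<Longrightarrow> trace2 (K x) = - f (U x)"
    using solU unfolding solves_def by metis
  then interpret annulus_C2 E H c k f U g K by unfold_locales
  show ?thesis by (rule two_critical_points_C2)
qed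

text \<open>The shape required by \<open>annulus\<close>, without the normalisation \<open>k \<le> c\<close>.\<close>

definition axial :: "(real^2) set \<Rightarrow> (real^2) set \<Rightarrow> real \<Rightarrow> real \<Rightarrow> bool" where
  "axial E H c k \<longleftrightarrow>
     (\<forall>x\<in>E. pt (x$1) (- x$2) \<in> E) \<and>
     (\<forall>x\<in>E. \<forall>s. \<bar>s - c\<bar> \<le> \<bar>x$1 - c\<bar> \<longrightarrow> pt s (x$2) \<in> E) \<and>
     (\<forall>x\<in>H. \<forall>s. \<bar>s - k\<bar> \<le> \<bar>x$1 - k\<bar> \<longrightarrow> pt s (x$2) \<in> H) \<and>
     (\<forall>x\<in>H. \<forall>s. \<bar>s\<bar> \<le> \<bar>x$2\<bar> \<longrightarrow> pt (x$1) s \<in> H)"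

lemma axial_flip:
  assumes "axial E H c k"
  shows "axial {x. pt (- x$1) (x$2) \<in> E} {x. pt (- x$1) (x$2) \<in> H} (- c) (- k)"
  using assms unfolding axial_def
proof (elim conjE, intro conjI ballI allI impI)
  fix x :: "real^2" and s
  assume *: "\<forall>x\<in>E. \<forall>s. \<bar>s - c\<bar> \<le> \<bar>x$1 - c\<bar> \<longrightarrow> pt s (x$2) \<in> E"
    "x \<in> {x. pt (- x$1) (x$2) \<in> E}" "\<bar>s - - c\<bar> \<le> \<bar>x$1 - - c\<bar>"
  have "pt (- s) (pt (- x$1) (x$2) $ 2) \<in> E"
    by (rule *(1)[rule_format]) (use *(2,3) in auto)
  then show "pt s (x$2) \<in> {x. pt (- x$1) (x$2) \<in> E}" by simp
next
  fix x :: "real^2" and s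
  assume *: "\<forall>x\<in>H. \<forall>s. \<bar>s - k\<bar> \<le> \<bar>x$1 - k\<bar> \<longrightarrow> pt s (x$2) \<in> H"
    "x \<in> {x. pt (- x$1) (x$2) \<in> H}" "\<bar>s - - k\<bar> \<le> \<bar>x$1 - - k\<bar>"
  have "pt (- s) (pt (- x$1) (x$2) $ 2) \<in> H"
    by (rule *(1)[rule_format]) (use *(2,3) in auto)
  then show "pt s (x$2) \<in> {x. pt (- x$1) (x$2) \<in> H}" by simp
qed auto

lemma GDERIV_zero_isometry:
  fixes A :: "real^2 \<Rightarrow> real^2" and U :: "real^2 \<Rightarrow> real"
  assumes A: "orthogonal_transformation A"
  shows "GDERIV (\<lambda>x. U (A x + b)) x :> 0 \<longleftrightarrow> GDERIV U (A x + b) :> 0"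
proof -
  have *: "GDERIV (\<lambda>x. U (B x + b)) x :> 0" if B: "orthogonal_transformation B" and d: "GDERIV U (B x + b) :> 0"
    for B :: "real^2 \<Rightarrow> real^2" and U :: "real^2 \<Rightarrow> real" and x b
  proof -
    have "bounded_linear B" using B by (simp add: orthogonal_transformation_def linear_conv_bounded_linear)
    from bounded_linear_imp_has_derivative[OF this]
    have "((\<lambda>x. B x + b) has_derivative B) (at x)" by (auto intro!: derivative_eq_intros)
    from has_derivative_compose[OF this, of U "\<lambda>v. 0"] d show ?thesis by (simp add: gderiv_def)
  qed
  show ?thesis
  proof
    assume d: "GDERIV (\<lambda>x. U (A x + b)) x :> 0"
    define B where "B = inv A"
    have B: "orthogonal_transformation B" unfolding B_def by (rule orthogonal_transformation_inv[OF A])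
    have AB: "A (B y) = y" "B (A y) = y" for y
      unfolding B_def using orthogonal_transformation_bij[OF A]
      by (auto simp: bij_def surj_f_inv_f inv_f_f)
    have lB: "linear B" "linear A" using A B by (auto simp: orthogonal_transformation_def)
    have inv: "B y + (- B b) = B (y - b)" for y using linear_diff[OF lB(1)] by simp
    have "GDERIV (\<lambda>y. U (A (B y + (- B b)) + b)) (A x + b) :> 0"
    proof (rule *[OF B, where U="\<lambda>x. U (A x + b)"])
      have "B (A x + b) + (- B b) = x" unfolding inv by (simp add: AB)
      then show "GDERIV (\<lambda>x. U (A x + b)) (B (A x + b) + - B b) :> 0" using d by (simp only:)
    qed
    then show "GDERIV U (A x + b) :> 0" by (simp only: inv AB diff_add_cancel)
  qed (rule *[OF A])
qed

text \<open>The count is carried over by the isometry. If \<open>k > c\<close>, the frame is first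
  composed with a flip of the first coordinate, which negates both centres and maps the axis to
  itself.\<close>

lemma two_critical_points_on_axis:
  fixes A :: "real^2 \<Rightarrow> real^2"
  assumes A: "orthogonal_transformation A"
    and ax: "axial {x. A x + b \<in> E} {x. A x + b \<in> H} c k"
    and dom: "open E" "bounded E" "compact H" "H \<subseteq> E" "H \<noteq> {}"
    and f: "\<And>s t. s \<le> t \<Longrightarrow> f t \<le> f s" "\<And>s. f s \<ge> 0" "f 0 > 0"
      "\<And>M. \<exists>C>0. \<forall>s\<in>{0..M}. \<forall>t\<in>{0..M}. \<bar>f s - f t\<bar> \<le> C * \<bar>s - t\<bar>"
    and U: "continuous_on UNIV U" "\<And>x. x \<notin> E - H \<Longrightarrow> U x = 0" "solves (E - H) f U"
  shows "card {x \<in> E - H. GDERIV U x :> 0 \<and> x \<in> (\<lambda>x. A x + b) ` {x. x$2 = 0}} = 2"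
proof -
  have main: "card {x \<in> E - H. GDERIV U x :> 0 \<and> x \<in> (\<lambda>x. B x + b) ` {x. x$2 = 0}} = 2"
    if B: "orthogonal_transformation B"
    and ax: "axial {x. B x + b \<in> E} {x. B x + b \<in> H} c k" and "k \<le> c" for B :: "real^2 \<Rightarrow> real^2" and c k
  proof -
    define T where "T x = B x + b" for x
    have lin: "linear B" using B by (simp add: orthogonal_transformation_def)
    have bl: "bounded_linear B" using lin by (simp add: linear_conv_bounded_linear)
    have contT: "continuous_on X T" for X
      unfolding T_def by (intro continuous_intros bounded_linear.continuous_on[OF bl])
    have surjB: "surj B" and injB: "inj B"
      using orthogonal_transformation_bij[OF B] by (auto simp: bij_def)
    have bijT: "bij T"
    proof (rule bijI)
      show "inj T" using injB by (auto simp: T_def inj_def)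
      show "surj T"
      proof (rule surjI[where f="\<lambda>y. inv B (y - b)"])
        show "T (inv B (y - b)) = y" for y using surj_f_inv_f[OF surjB] by (simp add: T_def)
      qed
    qed
    have bddT: "bounded {x. T x \<in> X}" if X: "bounded X" for X
    proof -
      obtain M where M: "\<And>x. x \<in> X \<Longrightarrow> norm x \<le> M" using X unfolding bounded_iff by blast
      have "norm x \<le> M + norm b" if "T x \<in> X" for x
      proof -
        have "norm x = norm (B x)" using B by (simp add: orthogonal_transformation)
        also have "B x = T x - b" by (simp add: T_def)
        also have "norm (T x - b) \<le> M + norm b" using M[OF that] norm_triangle_ineq4[of "T x" b] by simp
        finally show ?thesis .
      qed
      then show ?thesis using bounded_iff by blast
    qed
    define E' H' where "E' = {x. T x \<in> E}" and "H' = {x. T x \<in> H}"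
    have ax': "axial E' H' c k" using ax by (simp add: E'_def H'_def T_def)
    have EH: "E' - H' = {x. T x \<in> E - H}" by (auto simp: E'_def H'_def)
    interpret annulus E' H' c k f "\<lambda>x. U (T x)"
    proof
      show "open E'" unfolding E'_def
        using open_vimage[OF dom(1) contT[of UNIV]] by (simp add: vimage_def)
      show "bounded E'" unfolding E'_def by (rule bddT[OF dom(2)])
      have "closed H'" unfolding H'_def
        using closed_vimage[OF compact_imp_closed[OF dom(3)] contT[of UNIV]] by (simp add: vimage_def)
      moreover have "bounded H'" unfolding H'_def by (rule bddT[OF compact_imp_bounded[OF dom(3)]])
      ultimately show "compact H'" by (simp add: compact_eq_bounded_closed)
      show "H' \<subseteq> E'" using dom(4) by (auto simp: E'_def H'_def)
      obtain y where "y \<in> H" using dom(5) by blast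
      then show "H' \<noteq> {}" using bijT unfolding H'_def bij_def by (metis (mono_tags, lifting) empty_iff mem_Collect_eq surjD)
      show "continuous_on UNIV (\<lambda>x. U (T x))" by (rule continuous_on_compose2[OF U(1) contT]) auto
      show "U (T x) = 0" if "x \<notin> E' - H'" for x using that U(2) by (auto simp: EH)
      show "solves (E' - H') f (\<lambda>x. U (T x))"
        using solves_isometry[OF B U(3), of b] by (simp add: EH T_def)
      show "f t \<le> f s" if "s \<le> t" for s t using that by (rule f(1))
      show "f s \<ge> 0" for s by (rule f(2))
      show "f 0 > 0" by (rule f(3))
      show "\<exists>C>0. \<forall>s\<in>{0..M}. \<forall>t\<in>{0..M}. \<bar>f s - f t\<bar> \<le> C * \<bar>s - t\<bar>" for M by (rule f(4))
      show "k \<le> c" by fact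
    qed (use ax' in \<open>auto simp: axial_def\<close>)
    have dT: "GDERIV (\<lambda>x. U (T x)) x :> 0 \<longleftrightarrow> GDERIV U (T x) :> 0" for x
      unfolding T_def by (rule GDERIV_zero_isometry[OF B])
    have "{x \<in> E - H. GDERIV U x :> 0 \<and> x \<in> T ` {x. x$2 = 0}} =
        T ` {x \<in> E' - H'. GDERIV (\<lambda>x. U (T x)) x :> 0 \<and> x$2 = 0}"
      unfolding EH dT by blast
    then have "card {x \<in> E - H. GDERIV U x :> 0 \<and> x \<in> T ` {x. x$2 = 0}} =
        card {x \<in> E' - H'. GDERIV (\<lambda>x. U (T x)) x :> 0 \<and> x$2 = 0}"
      using card_image[OF inj_on_subset[OF bij_is_inj[OF bijT] subset_UNIV]] by simp
    then show ?thesis using two_critical_points by (simp add: T_def)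
  qed
  show ?thesis
  proof (cases "k \<le> c")
    case True
    then show ?thesis by (rule main[OF A ax])
  next
    case False
    define B where "B x = A (pt (- x$1) (x$2))" for x :: "real^2"
    have "orthogonal_transformation (A \<circ> (\<lambda>x::real^2. pt (- x$1) (x$2)))"
      by (intro orthogonal_transformation_compose A orthogonal_flips)
    then have B: "orthogonal_transformation B" by (simp add: B_def[abs_def] comp_def)
    have "axial {x. B x + b \<in> E} {x. B x + b \<in> H} (- c) (- k)"
      using axial_flip[OF ax] by (simp add: B_def)
    from main[OF B this] False have "card {x \<in> E - H. GDERIV U x :> 0 \<and> x \<in> (\<lambda>x. B x + b) ` {x. x$2 = 0}} = 2"
      by simp
    moreover have "(\<lambda>x. B x + b) ` {x. x$2 = 0} = (\<lambda>x. A x + b) ` {x. x$2 = 0}"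
    proof -
      have "(\<lambda>x::real^2. pt (- x$1) (x$2)) ` {x. x$2 = 0} = {x. x$2 = 0}"
      proof (intro subset_antisym subsetI)
        fix x :: "real^2" assume "x \<in> {x. x$2 = 0}"
        then show "x \<in> (\<lambda>x::real^2. pt (- x$1) (x$2)) ` {x. x$2 = 0}"
          by (intro image_eqI[of _ _ "pt (- x$1) 0"]) (auto simp: vec2_eq)
      qed auto
      then have "(\<lambda>x. A x + b) ` {x. x$2 = 0} = (\<lambda>x. A x + b) ` (\<lambda>x::real^2. pt (- x$1) (x$2)) ` {x. x$2 = 0}"
        by (rule arg_cong[OF sym])
      also have "\<dots> = (\<lambda>x. B x + b) ` {x. x$2 = 0}" unfolding image_image B_def ..
      finally show ?thesis by (rule sym)
    qed
    ultimately show ?thesis by simp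
  qed
qed

section \<open>Symmetry axes of annular domains\<close>

lemma line_reflection_eq:
  assumes "v \<noteq> 0"
  shows "dist (line_reflection p v x) (line_reflection p v y) = dist x y"
    and "line_reflection p v (line_reflection p v x) = x"
proof -
  have vv: "v \<bullet> v > 0" using assms by simp
  have n: "(norm ((2 * (w \<bullet> v) / (v \<bullet> v)) *\<^sub>R v - w))\<^sup>2 = (norm w)\<^sup>2" for w
    unfolding power2_norm_eq_inner using vv
    by (simp add: inner_diff_left inner_diff_right inner_commute field_simps)
  have "line_reflection p v x - line_reflection p v y =
      (2 * ((x - y) \<bullet> v) / (v \<bullet> v)) *\<^sub>R v - (x - y)"
    by (simp add: line_reflection_def inner_diff_left diff_divide_distrib algebra_simps)
  then show "dist (line_reflection p v x) (line_reflection p v y) = dist x y"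
    unfolding dist_norm using n[of "x - y"] by (metis norm_ge_zero power2_eq_iff_nonneg)
  have e: "line_reflection p v x - p = (2 * ((x - p) \<bullet> v) / (v \<bullet> v)) *\<^sub>R v - (x - p)"
    by (simp add: line_reflection_def)
  have i: "(line_reflection p v x - p) \<bullet> v = (x - p) \<bullet> v"
    unfolding e using vv by (simp add: inner_diff_left)
  have "line_reflection p v (line_reflection p v x)
      = p + (2 * ((line_reflection p v x - p) \<bullet> v) / (v \<bullet> v)) *\<^sub>R v - (line_reflection p v x - p)"
    by (rule line_reflection_def)
  then show "line_reflection p v (line_reflection p v x) = x"
    unfolding i unfolding e by simp
qed

lemma continuous_line_reflection: assumes "v \<noteq> 0" shows "continuous_on S (line_reflection p v)"
  unfolding line_reflection_def using assms by (intro continuous_intros) auto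

lemma line_reflection_image_iff:
  assumes "v \<noteq> 0" "line_reflection p v ` S = S"
  shows "line_reflection p v x \<in> S \<longleftrightarrow> x \<in> S"
proof
  assume "line_reflection p v x \<in> S"
  then have "line_reflection p v (line_reflection p v x) \<in> line_reflection p v ` S" by (rule imageI)
  then show "x \<in> S" by (simp only: line_reflection_eq(2)[OF assms(1)] assms(2))
next
  assume "x \<in> S"
  then have "line_reflection p v x \<in> line_reflection p v ` S" by (rule imageI)
  then show "line_reflection p v x \<in> S" by (simp only: assms(2))
qed

lemma line_reflection_bounded_image:
  assumes "v \<noteq> 0" "bounded (line_reflection p v ` S)" shows "bounded S"
proof -
  obtain B where B: "\<And>x. x \<in> S \<Longrightarrow> dist (line_reflection p v p) (line_reflection p v x) \<le> B"
    using assms(2) unfolding bounded_any_center[where a="line_reflection p v p"] by blast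
  then show ?thesis unfolding line_reflection_eq(1)[OF assms(1)] bounded_def by blast
qed

text \<open>Reflections are involutions, so one inclusion yields the other.\<close>

lemma line_reflection_preserves_subset:
  assumes "v \<noteq> 0" "line_reflection p v ` S \<subseteq> S"
  shows "line_reflection p v ` S = S"
proof (rule subset_antisym[OF assms(2)], rule subsetI)
  fix x assume "x \<in> S"
  then have "line_reflection p v x \<in> S" using assms(2) by blast
  then show "x \<in> line_reflection p v ` S" by (rule rev_image_eqI) (simp add: line_reflection_eq(2)[OF assms(1)])
qed

lemma line_reflection_compl:
  assumes "v \<noteq> 0" "line_reflection p v ` S = S"
  shows "line_reflection p v ` (- S) = - S"
proof (rule line_reflection_preserves_subset[OF assms(1)])
  show "line_reflection p v ` (- S) \<subseteq> - S" using line_reflection_image_iff[OF assms] by auto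
qed

text \<open>The set \<open>- E\<close> is the only unbounded part of the complement of \<open>E - H\<close>.\<close>

lemma reflection_preserves_boundary_components:
  assumes v: "v \<noteq> 0" and E: "open E" "bounded E" "connected (- E)" and H: "compact H" "H \<subseteq> E"
    and sym: "line_reflection p v ` (E - H) = E - H"
  shows "line_reflection p v ` E = E" "line_reflection p v ` H = H"
proof -
  define \<sigma> where "\<sigma> = line_reflection p v"
  have "\<sigma> ` (- E) \<subseteq> - E \<union> H"
    using line_reflection_compl[OF v sym] by (auto simp: \<sigma>_def)
  moreover have "connected (\<sigma> ` (- E))" unfolding \<sigma>_def
    by (rule connected_continuous_image[OF continuous_line_reflection[OF v] E(3)])
  moreover have "closed (- E)" "closed H" using E(1) H(1) compact_imp_closed by auto
  moreover have "- E \<inter> H = {}" using H(2) by auto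
  ultimately have "- E \<inter> \<sigma> ` (- E) = {} \<or> H \<inter> \<sigma> ` (- E) = {}"
    using connected_closedD[of "\<sigma> ` (- E)" "- E" H] by blast
  moreover have "\<not> \<sigma> ` (- E) \<subseteq> H"
  proof
    assume "\<sigma> ` (- E) \<subseteq> H"
    then have "bounded (- E)" using line_reflection_bounded_image[OF v] compact_imp_bounded[OF H(1)] bounded_subset
      unfolding \<sigma>_def by blast
    then show False using cobounded_imp_unbounded[of E] E(2) by (metis cobounded_imp_unbounded double_complement)
  qed
  ultimately have "\<sigma> ` (- E) \<subseteq> - E" using \<open>\<sigma> ` (- E) \<subseteq> - E \<union> H\<close> by blast
  then have "\<sigma> ` (- E) = - E" unfolding \<sigma>_def by (rule line_reflection_preserves_subset[OF v])
  from line_reflection_compl[OF v this[unfolded \<sigma>_def]] show E': "line_reflection p v ` E = E" by simp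
  show "line_reflection p v ` H = H"
  proof (rule line_reflection_preserves_subset[OF v])
    show "line_reflection p v ` H \<subseteq> H"
      using line_reflection_image_iff[OF v E'] line_reflection_image_iff[OF v sym] H(2) by blast
  qed
qed

text \<open>The passage from the region back to its bounding curve, on which
  \<open>symmetry_axes\<close> is evaluated.\<close>

lemma reflection_preserves_frontier:
  assumes v: "v \<noteq> 0" and "open E" "line_reflection p v ` E = E"
  shows "line_reflection p v ` frontier E = frontier E"
proof (rule line_reflection_preserves_subset[OF v])
  have "line_reflection p v ` closure E \<subseteq> closure (line_reflection p v ` E)"
    by (rule image_closure_subset[OF continuous_line_reflection[OF v]]) (auto simp: closure_subset)
  then show "line_reflection p v ` frontier E \<subseteq> frontier E"
    using line_reflection_image_iff[OF v assms(3)] assms(2,3) by (auto simp: frontier_def interior_open)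
qed

text \<open>Axes of a petal are given for the curve, while the comparison needs the region. The
  image of the outside is connected, unbounded and disjoint from the curve, hence lies in the
  outside again.\<close>

lemma reflection_preserves_inside:
  fixes \<gamma> :: "(real^2) set"
  assumes v: "v \<noteq> 0" and "bounded \<gamma>" "closed \<gamma>" "line_reflection p v ` \<gamma> = \<gamma>"
  shows "line_reflection p v ` inside \<gamma> = inside \<gamma>"
proof -
  define \<sigma> where "\<sigma> = line_reflection p v"
  have con: "connected (\<sigma> ` outside \<gamma>)" unfolding \<sigma>_def
    by (rule connected_continuous_image[OF continuous_line_reflection[OF v]])
      (rule connected_outside, use assms in auto)
  have sub: "\<sigma> ` outside \<gamma> \<subseteq> - \<gamma>"
    using line_reflection_image_iff[OF v assms(4)] unfolding \<sigma>_def by (auto simp: outside_def)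
  have "\<not> \<sigma> ` outside \<gamma> \<subseteq> inside \<gamma>"
    using line_reflection_bounded_image[OF v, of p "outside \<gamma>"] unbounded_outside[OF assms(2)]
      bounded_inside[OF assms(2)] bounded_subset unfolding \<sigma>_def by blast
  then have "\<sigma> ` outside \<gamma> \<inter> outside \<gamma> \<noteq> {}" using sub by (auto simp: inside_outside)
  then have "inside \<gamma> \<inter> \<sigma> ` outside \<gamma> = {}"
    using inside_outside_intersect_connected[OF con, of \<gamma>] sub by blast
  then have "\<sigma> ` outside \<gamma> \<subseteq> outside \<gamma>" using sub by (auto simp: inside_outside)
  then have "\<sigma> ` outside \<gamma> = outside \<gamma>" unfolding \<sigma>_def by (rule line_reflection_preserves_subset[OF v])
  then have "\<sigma> ` (\<gamma> \<union> outside \<gamma>) = \<gamma> \<union> outside \<gamma>" using assms(4) by (simp add: \<sigma>_def image_Un)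
  from line_reflection_compl[OF v this[unfolded \<sigma>_def]] show ?thesis by (simp add: union_with_outside)
qed

text \<open>The columns of \<open>A\<close> are the unit direction of the line and its quarter turn.
  The formula is exported because petals need the second column as the direction of the
  perpendicular axis.\<close>

lemma line_adapted_frame:
  assumes v: "v \<noteq> 0"
  shows "\<exists>A. orthogonal_transformation A \<and>
    (\<forall>x. A x = (x$1 / norm v) *\<^sub>R v + (x$2 / norm v) *\<^sub>R pt (- v$2) (v$1)) \<and>
    line_through p v = (\<lambda>x. A x + p) ` {x. x$2 = 0} \<and>
    (\<forall>x. line_reflection p v (A x + p) = A (pt (x$1) (- x$2)) + p)"
proof -
  define A where "A x = (x$1 / norm v) *\<^sub>R v + (x$2 / norm v) *\<^sub>R pt (- v$2) (v$1)" for x :: "real^2"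
  have nv: "norm v > 0" using v by simp
  have nn: "v$1 * v$1 + v$2 * v$2 = norm v * norm v"
    using norm2_sq[of v] by (simp add: power2_eq_square)
  have "A x \<bullet> A y = x \<bullet> y" for x y
  proof -
    have "A x \<bullet> A y = (x$1 * y$1 + x$2 * y$2) * (v$1 * v$1 + v$2 * v$2) / (norm v * norm v)"
      using nv by (simp add: A_def inner2 field_simps)
    then show ?thesis unfolding nn using nv by (simp add: inner2)
  qed
  moreover have "linear A" unfolding A_def by (simp add: linear_iff vec2_eq field_simps add_divide_distrib)
  ultimately have "orthogonal_transformation A" by (simp add: orthogonal_transformation_def)
  moreover have "line_through p v = (\<lambda>x. A x + p) ` {x. x$2 = 0}"
  proof (intro subset_antisym subsetI)
    fix y assume "y \<in> line_through p v"
    then obtain t where "y = p + t *\<^sub>R v" by (auto simp: line_through_def)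
    then show "y \<in> (\<lambda>x. A x + p) ` {x. x$2 = 0}"
      using nv by (intro image_eqI[of _ _ "pt (t * norm v) 0"]) (auto simp: A_def)
  qed (auto simp: line_through_def A_def)
  moreover have "line_reflection p v (A x + p) = A (pt (x$1) (- x$2)) + p" for x
  proof -
    have "A x \<bullet> v = x$1 * norm v"
    proof -
      have "A x \<bullet> v = x$1 / norm v * (v$1 * v$1 + v$2 * v$2)"
        by (simp add: A_def inner2 algebra_simps add_divide_distrib)
      then show ?thesis unfolding nn using nv by simp
    qed
    moreover have "v \<bullet> v = norm v * norm v" unfolding inner2 nn ..
    ultimately have "line_reflection p v (A x + p) = p + (2 * x$1 / norm v) *\<^sub>R v - A x"
      using nv by (simp add: line_reflection_def)
    also have "\<dots> = A (pt (x$1) (- x$2)) + p" unfolding A_def by (simp add: vec2_eq field_simps)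
    finally show ?thesis .
  qed
  ultimately show ?thesis using A_def by blast
qed

text \<open>By \<open>Jordan_Brouwer_frontier\<close> each component of the complement has the whole
  curve as frontier. So the curve lies in the closure of the outside, which connects the complement
  of the inside.\<close>

lemma simple_closed_curve_facts:
  fixes \<gamma> :: "(real^2) set"
  assumes "simple_closed_curve \<gamma>"
  shows "compact \<gamma>" "\<gamma> \<noteq> {}" "connected (- inside \<gamma>)" "inside \<gamma> \<noteq> {} \<Longrightarrow> frontier (inside \<gamma>) = \<gamma>"
proof -
  obtain g where g: "simple_path g" "pathfinish g = pathstart g" "path_image g = \<gamma>"
    using assms unfolding simple_closed_curve_def by blast
  show c: "compact \<gamma>" "\<gamma> \<noteq> {}" using g by (auto simp: compact_simple_path_image simple_path_imp_path)
  have "\<gamma> homeomorphic sphere (0::complex) 1"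
    using homeomorphic_simple_path_image_circle[OF g(1,2), of 1 0] g(3) by simp
  also have "sphere (0::complex) 1 homeomorphic sphere (0::real^2) 1"
    by (rule homeomorphic_spheres_gen) auto
  finally have hom: "\<gamma> homeomorphic sphere (0::real^2) 1" .
  have fr: "frontier T = \<gamma>" if "T \<in> components (- \<gamma>)" for T
    by (rule Jordan_Brouwer_frontier[OF hom that]) simp
  have con: "connected (outside \<gamma>)" using connected_outside[of \<gamma>] compact_imp_bounded[OF c(1)] by simp
  have "outside \<gamma> \<in> components (- \<gamma>)"
    unfolding outside_in_components using con outside_bounded_nonempty compact_imp_bounded[OF c(1)] by blast
  from fr[OF this] have "\<gamma> \<subseteq> closure (outside \<gamma>)" by (auto simp: frontier_def)
  then have "connected (\<gamma> \<union> outside \<gamma>)"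
    by (intro connected_intermediate_closure[OF con]) (auto simp: closure_subset)
  then show "connected (- inside \<gamma>)" by (simp add: union_with_outside)
  assume "inside \<gamma> \<noteq> {}"
  then obtain x where x: "x \<in> inside \<gamma>" by blast
  define T where "T = connected_component_set (- \<gamma>) x"
  have xc: "x \<notin> \<gamma>" using x by (auto simp: inside_def)
  have "T \<in> components (- \<gamma>)" using xc by (auto simp: T_def components_def)
  then have "\<gamma> \<subseteq> closure T" using fr[of T] by (auto simp: frontier_def)
  moreover have "T \<subseteq> inside \<gamma>"
    using inside_same_component[of \<gamma> x] x unfolding T_def by blast
  ultimately have "\<gamma> \<subseteq> closure (inside \<gamma>)" using closure_mono[of T "inside \<gamma>"] by blast
  moreover have "closure (inside \<gamma>) \<subseteq> \<gamma> \<union> inside \<gamma>"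
  proof (rule closure_minimal)
    show "closed (\<gamma> \<union> inside \<gamma>)" unfolding union_with_inside
      by (rule closed_Compl[OF open_outside[OF compact_imp_closed[OF c(1)]]])
    show "inside \<gamma> \<subseteq> \<gamma> \<union> inside \<gamma>" by blast
  qed
  moreover have "inside \<gamma> \<inter> \<gamma> = {}" by (rule inside_no_overlap)
  ultimately show "frontier (inside \<gamma>) = \<gamma>"
    unfolding frontier_def interior_open[OF open_inside[OF compact_imp_closed[OF c(1)]]] by blast
qed

lemma annular_domain_facts:
  assumes "annular_domain \<gamma>\<^sub>I \<gamma>\<^sub>E \<Omega>"
  defines "E \<equiv> inside \<gamma>\<^sub>E" and "H \<equiv> \<gamma>\<^sub>I \<union> inside \<gamma>\<^sub>I"
  shows "\<Omega> = E - H" "open E" "bounded E" "connected (- E)" "compact H" "H \<subseteq> E" "H \<noteq> {}"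
    "frontier E = \<gamma>\<^sub>E" "bounded \<gamma>\<^sub>E" "closed \<gamma>\<^sub>E"
proof -
  have I: "simple_closed_curve \<gamma>\<^sub>I" and Ec: "simple_closed_curve \<gamma>\<^sub>E" and sub: "\<gamma>\<^sub>I \<subseteq> E"
    and \<Omega>: "\<Omega> = inside \<gamma>\<^sub>E \<inter> outside \<gamma>\<^sub>I"
    using assms unfolding annular_domain_def by auto
  note fI = simple_closed_curve_facts[OF I] and fE = simple_closed_curve_facts[OF Ec]
  show "bounded \<gamma>\<^sub>E" "closed \<gamma>\<^sub>E" using fE(1) compact_imp_bounded compact_imp_closed by auto
  then show op: "open E" "bounded E" unfolding E_def by (auto intro: open_inside bounded_inside)
  show con: "connected (- E)" unfolding E_def by (rule fE(3))
  show "\<Omega> = E - H" unfolding \<Omega> E_def H_def by (auto simp: outside_inside)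
  have "closed H" unfolding H_def union_with_inside using fI(1) by (simp add: closed_Compl open_outside compact_imp_closed)
  moreover have "bounded H" unfolding H_def using fI(1) by (simp add: bounded_inside compact_imp_bounded)
  ultimately show "compact H" by (simp add: compact_eq_bounded_closed)
  show "H \<noteq> {}" using fI(2) by (simp add: H_def)
  have "E \<noteq> {}" using sub fI(2) by blast
  then show "frontier E = \<gamma>\<^sub>E" unfolding E_def by (rule fE(4))
  \<comment> \<open>The set \<open>- E\<close> is connected, misses the inner curve and, being
    unbounded, meets its outside; so it cannot meet its inside.\<close>
  have "\<not> - E \<subseteq> inside \<gamma>\<^sub>I"
  proof
    assume "- E \<subseteq> inside \<gamma>\<^sub>I"
    then have "bounded (- E)" using bounded_inside compact_imp_bounded[OF fI(1)] bounded_subset by blast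
    then show False using cobounded_imp_unbounded[of "- E"] op(2) by simp
  qed
  then have "outside \<gamma>\<^sub>I \<inter> - E \<noteq> {}" using sub by (auto simp: inside_outside)
  then have "inside \<gamma>\<^sub>I \<inter> - E = {}"
    using inside_outside_intersect_connected[OF con, of \<gamma>\<^sub>I] sub by blast
  then show "H \<subseteq> E" using sub by (auto simp: H_def)
qed

section \<open>Classical solutions and analytic nonlinearities\<close>

lemma laplacian_eq_trace2:
  assumes C: "C2_data u g H D" and "open D" "x \<in> D"
  shows "laplacian u x = trace2 (H x)"
proof -
  have du: "(u has_derivative (\<lambda>v. g y \<bullet> v)) (at y)" if "y \<in> D" for y by (rule C2_dataD(1)[OF C that])
  have "deriv (deriv (\<lambda>t. u (x + t *\<^sub>R b))) 0 = H x b \<bullet> b" for b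
  proof -
    obtain d where d: "d > 0" "\<And>t. \<bar>t\<bar> < d \<Longrightarrow> x + t *\<^sub>R b \<in> D"
      and d1: "\<And>t. \<bar>t\<bar> < d \<Longrightarrow> ((\<lambda>t. u (x + t *\<^sub>R b)) has_real_derivative g (x + t *\<^sub>R b) \<bullet> b) (at t)"
      and d2: "((\<lambda>t. g (x + t *\<^sub>R b) \<bullet> b) has_real_derivative H x b \<bullet> b) (at 0)"
      using directional_derivatives[OF assms(2,3) du C2_dataD(2)[OF C assms(3)], where b=b] by blast
    have "(deriv (\<lambda>t. u (x + t *\<^sub>R b)) has_real_derivative H x b \<bullet> b) (at 0)"
      by (rule has_field_derivative_transform_within_open[OF d2, where S="ball 0 d"])
        (use d(1) DERIV_imp_deriv[OF d1] in auto)
    then show ?thesis by (rule DERIV_imp_deriv)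
  qed
  moreover have "sum F Basis = F (axis 1 1) + F (axis 2 1)" for F :: "real^2 \<Rightarrow> real"
  proof -
    have B: "(Basis :: (real^2) set) = {axis 1 1, axis 2 1}"
      by (auto simp: Basis_vec_def) (metis exhaust_2)
    have "axis 1 1 \<noteq> (axis 2 1 :: real^2)" by (simp add: vec2_eq)
    then show ?thesis unfolding B by simp
  qed
  ultimately show ?thesis by (simp add: laplacian_def trace2_inner)
qed

lemma classical_solution_extension:
  assumes sol: "classical_solution \<Omega> f u" and "open \<Omega>"
  defines "U \<equiv> \<lambda>x. if x \<in> \<Omega> then u x else 0"
  shows "continuous_on UNIV U" "solves \<Omega> f U"
proof -
  have "continuous_on (closure \<Omega> \<union> - \<Omega>) (\<lambda>x. if x \<in> \<Omega> then u x else 0)"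
  proof (rule continuous_on_cases)
    show "continuous_on (closure \<Omega>) u" using sol by (simp add: classical_solution_def)
    show "\<forall>x. x \<in> closure \<Omega> \<and> x \<notin> \<Omega> \<or> x \<in> - \<Omega> \<and> x \<in> \<Omega> \<longrightarrow> u x = 0"
      using sol \<open>open \<Omega>\<close> by (auto simp: classical_solution_def frontier_def interior_open)
  qed (use \<open>open \<Omega>\<close> in auto)
  moreover have "closure \<Omega> \<union> - \<Omega> = UNIV" using closure_subset by blast
  ultimately show "continuous_on UNIV U" by (simp add: U_def)
  obtain g H where gH: "\<And>x. x \<in> \<Omega> \<Longrightarrow> GDERIV u x :> g x" "\<And>x. x \<in> \<Omega> \<Longrightarrow> (g has_derivative H x) (at x)"
    "\<And>v. continuous_on \<Omega> (\<lambda>x. H x v)"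
    using sol unfolding classical_solution_def C2_on_def by blast
  have C: "C2_data u g H \<Omega>" unfolding C2_data_def
  proof (intro conjI ballI allI)
    fix x assume "x \<in> \<Omega>"
    moreover have "(\<lambda>h. h \<bullet> g x) = (\<bullet>) (g x)" by (auto simp: inner_commute)
    ultimately show "(u has_derivative (\<bullet>) (g x)) (at x)" using gH(1)[of x] by (simp add: gderiv_def)
  qed (use gH in auto)
  have "trace2 (H x) = - f (u x)" if "x \<in> \<Omega>" for x
  proof -
    have "laplacian u x + f (u x) = 0" using sol that by (simp add: classical_solution_def)
    then show ?thesis using laplacian_eq_trace2[OF C \<open>open \<Omega>\<close> that] by simp
  qed
  then have "solves \<Omega> f u" unfolding solves_def using C by blast
  then show "solves \<Omega> f U" by (rule solves_cong[OF \<open>open \<Omega>\<close>, rotated]) (simp add: U_def)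
qed

text \<open>Termwise differentiation of the local power series, on a ball strictly inside its disc
  of convergence.\<close>

lemma real_analytic_C1:
  assumes "real_analytic f"
  shows "(f has_real_derivative deriv f x) (at x)" "isCont (deriv f) x"
proof -
  obtain F where F: "(\<lambda>h. f (x + h)) has_fps_expansion F" using assms unfolding real_analytic_def by blast
  then have "0 < fps_conv_radius F" and ev: "eventually (\<lambda>z. eval_fps F z = f (x + z)) (nhds 0)"
    by (auto simp: has_fps_expansion_def)
  obtain r where r: "r > 0" "ereal r < fps_conv_radius F"
    using ereal_dense2[OF \<open>0 < fps_conv_radius F\<close>] by auto
  obtain d0 where d0: "d0 > 0" "\<And>z. dist z 0 < d0 \<Longrightarrow> eval_fps F z = f (x + z)"
    using ev unfolding eventually_nhds_metric by blast
  define d where "d = min r d0"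
  have d: "d > 0" using r d0 by (simp add: d_def)
  have D: "(f has_real_derivative eval_fps (fps_deriv F) (y - x)) (at y)" if y: "y \<in> ball x d" for y
  proof -
    have "ereal (norm (y - x)) < ereal r" using y by (simp add: d_def dist_real_def abs_minus_commute)
    then have "norm (y - x) < fps_conv_radius F" using r(2) less_trans by blast
    from has_field_derivative_eval_fps[OF this, where A=UNIV]
    have "((\<lambda>y. eval_fps F (y - x)) has_real_derivative eval_fps (fps_deriv F) (y - x)) (at y)"
      using DERIV_shift[of "eval_fps F" _ y "- x"] by simp
    then show ?thesis
      by (rule has_field_derivative_transform_within_open[where S="ball x d"])
        (use y d0(2)[of "_ - x"] in \<open>auto simp: d_def dist_real_def abs_minus_commute\<close>)
  qed
  have dD: "deriv f y = eval_fps (fps_deriv F) (y - x)" if "y \<in> ball x d" for y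
    using DERIV_imp_deriv[OF D[OF that]] .
  show "(f has_real_derivative deriv f x) (at x)" using D[of x] dD[of x] d by simp
  have "continuous_on (ball x d) (\<lambda>y. eval_fps (fps_deriv F) (y - x))"
  proof (rule continuous_on_eval_fps')
    show "continuous_on (ball x d) (\<lambda>y. y - x)" by (intro continuous_intros)
    show "(\<lambda>y. y - x) ` ball x d \<subseteq> eball 0 (fps_conv_radius (fps_deriv F))"
    proof
      fix z assume "z \<in> (\<lambda>y. y - x) ` ball x d"
      then have "ereal (norm z) < ereal r" by (auto simp: d_def dist_real_def abs_minus_commute)
      also have "ereal r < fps_conv_radius (fps_deriv F)"
        using r(2) fps_conv_radius_deriv[of F] by (rule less_le_trans)
      finally show "z \<in> eball 0 (fps_conv_radius (fps_deriv F))" by (simp add: in_eball_iff)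
    qed
  qed
  then have "continuous_on (ball x d) (deriv f)" by (rule continuous_on_eq) (simp add: dD)
  then show "isCont (deriv f) x" using d by (simp add: continuous_on_eq_continuous_at)
qed

lemma real_analytic_lipschitz:
  assumes "real_analytic f"
  shows "\<exists>C>0. \<forall>s\<in>{0..M}. \<forall>t\<in>{0..M}. \<bar>f s - f t\<bar> \<le> C * \<bar>s - t\<bar>"
proof -
  have "continuous_on {0..M} (deriv f)"
    using real_analytic_C1(2)[OF assms] by (simp add: continuous_at_imp_continuous_on)
  then have "bounded (deriv f ` {0..M})" by (intro compact_imp_bounded compact_continuous_image) auto
  then obtain C where C: "C > 0" "\<And>s. s \<in> {0..M} \<Longrightarrow> norm (deriv f s) \<le> C" unfolding bounded_pos by blast
  have "norm (f s - f t) \<le> C * norm (s - t)" if "s \<in> {0..M}" "t \<in> {0..M}" for s t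
  proof (rule field_differentiable_bound[where S="{0..M}" and f'="deriv f"])
    show "(f has_real_derivative deriv f z) (at z within {0..M})" for z
      by (rule has_field_derivative_at_within[OF real_analytic_C1(1)[OF assms]])
  qed (use that C in auto)
  then show ?thesis using C(1) by auto
qed

lemma real_analytic_antimono:
  assumes "real_analytic f" "\<forall>s. deriv f s \<le> 0" "s \<le> t"
  shows "f t \<le> f s"
proof (rule DERIV_nonpos_imp_nonincreasing[OF assms(3)])
  fix x show "\<exists>y. (f has_real_derivative y) (at x) \<and> y \<le> 0"
    using real_analytic_C1(1)[OF assms(1), of x] assms(2) by blast
qed

section \<open>Ellipses and petals\<close>

text \<open>The image of the closed ball is compact and convex, and the inside of the frontier of
  such a set is its interior.\<close>

lemma linear_image_sphere_inside:
  fixes L :: "real^2 \<Rightarrow> real^2" and b :: "real^2"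
  assumes L: "linear L" "inj L"
  defines "G \<equiv> \<lambda>x. b + L x"
  shows "inside (G ` sphere 0 1) = G ` ball 0 1"
proof -
  have "G ` S = (+) b ` L ` S" for S by (simp add: G_def image_image)
  moreover have "convex (L ` cball 0 1)" using L by (intro convex_linear_image) auto
  ultimately have cv: "convex (G ` cball 0 1)" by (simp add: convex_translation)
  have lin: "bounded_linear L" using L by (simp add: linear_conv_bounded_linear)
  have cp: "compact (G ` cball 0 1)" unfolding G_def
    by (intro compact_continuous_image continuous_intros bounded_linear.continuous_on[OF lin]) auto
  have int: "interior (G ` cball 0 1) = G ` ball 0 1"
  proof -
    have "interior (G ` cball 0 1) = (+) b ` interior (L ` cball 0 1)"
      unfolding G_def image_image[symmetric, of "(+) b" L] interior_translation ..
    also have "interior (L ` cball 0 1) = L ` ball 0 1"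
      using interior_injective_linear_image[OF L, of "cball 0 1"] by simp
    finally show ?thesis by (simp add: G_def image_image)
  qed
  have injG: "inj G" using L(2) by (auto simp: G_def inj_def)
  have "frontier (G ` cball 0 1) = G ` cball 0 1 - G ` ball 0 1"
    using cp int by (simp add: frontier_def compact_imp_closed)
  also have "\<dots> = G ` sphere 0 1"
    using inj_on_image_set_diff[OF injG, of "cball 0 1" "ball 0 1"] by (simp add: cball_diff_eq_sphere)
  finally show ?thesis using inside_frontier_eq_interior[OF compact_imp_bounded[OF cp] cv] int by simp
qed

text \<open>An ellipse is an affine image of the unit circle; \<open>B\<close> inverts its linear
  part in the frame of \<open>A\<close>, and \<open>m\<close> is its centre there. The open region
  and the closed hole thus take the same form.\<close>

lemma ellipse_in_frame:
  fixes A :: "real^2 \<Rightarrow> real^2"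
  assumes "is_ellipse S" and A: "orthogonal_transformation A"
  shows "\<exists>(B :: real^2 \<Rightarrow> real^2) m. linear B \<and> inj B \<and> (\<forall>x. A x + p \<in> inside S \<longleftrightarrow> norm (B (x - m)) < 1) \<and>
    (\<forall>x. A x + p \<in> S \<union> inside S \<longleftrightarrow> norm (B (x - m)) \<le> 1)"
proof -
  obtain A0 :: "real^2 \<Rightarrow> real^2" and t a b where A0: "orthogonal_transformation A0" and ab: "a > 0" "b > 0"
    and S: "S = (\<lambda>x. A0 x + t) ` {x::real^2. (x$1 / a)\<^sup>2 + (x$2 / b)\<^sup>2 = 1}"
    using assms(1) unfolding is_ellipse_def rigid_motion_def by blast
  define D where "D x = pt (a * x$1) (b * x$2)" for x :: "real^2"
  have lD: "linear D" by (simp add: D_def linear_iff vec2_eq algebra_simps)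
  have iD: "inj D" using ab by (auto simp: D_def inj_def vec2_eq)
  have set: "{x::real^2. (x$1 / a)\<^sup>2 + (x$2 / b)\<^sup>2 = 1} = D ` sphere 0 1"
  proof (intro subset_antisym subsetI)
    fix x :: "real^2" assume "x \<in> {x. (x$1 / a)\<^sup>2 + (x$2 / b)\<^sup>2 = 1}"
    then have "(norm (pt (x$1 / a) (x$2 / b)))\<^sup>2 = 1" by (simp add: norm2_sq)
    then have "norm (pt (x$1 / a) (x$2 / b)) = 1" by (simp add: power2_eq_1_iff) (use norm_ge_zero[of "pt (x$1 / a) (x$2 / b)"] in linarith)
    then show "x \<in> D ` sphere 0 1"
      using ab by (intro image_eqI[of _ _ "pt (x$1 / a) (x$2 / b)"]) (auto simp: D_def)
  next
    fix x :: "real^2" assume "x \<in> D ` sphere 0 1"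
    then obtain y where y: "x = D y" "norm y = 1" by auto
    then have "(y$1)\<^sup>2 + (y$2)\<^sup>2 = 1" using norm2_sq[of y] by simp
    then show "x \<in> {x. (x$1 / a)\<^sup>2 + (x$2 / b)\<^sup>2 = 1}" using ab y by (simp add: D_def)
  qed
  define L where "L x = A0 (D x)" for x
  have lA0: "linear A0" and iA0: "inj A0" using A0 orthogonal_transformation_inj by (auto simp: orthogonal_transformation_def)
  have lL: "linear L" using linear_compose[OF lD lA0] by (simp add: L_def[abs_def] comp_def)
  have iL: "inj L" using inj_compose[OF iA0 iD] unfolding L_def[abs_def] comp_def .
  define G where "G x = t + L x" for x
  have SG: "S = G ` sphere 0 1"
  proof -
    have "S = (\<lambda>x. A0 x + t) ` D ` sphere 0 1" using S unfolding set .
    also have "\<dots> = G ` sphere 0 1" unfolding image_image G_def L_def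
      by (rule image_cong[OF refl add.commute])
    finally show ?thesis .
  qed
  have inS: "inside S = G ` ball 0 1"
    using linear_image_sphere_inside[OF lL iL, of t] by (simp add: SG G_def[abs_def])
  have "sphere (0::real^2) 1 \<union> ball 0 1 = cball 0 1" by auto
  then have clS: "S \<union> inside S = G ` cball 0 1" using image_Un[of G "sphere 0 1" "ball 0 1"] inS SG by simp
  have bL: "bij L" using iL linear_injective_imp_surjective[OF lL iL] by (simp add: bij_def)
  have bA: "bij A" using A by (rule orthogonal_transformation_bij)
  have lA: "linear A" using A by (simp add: orthogonal_transformation_def)
  define B where "B x = inv L (A x)" for x
  define m where "m = inv A (t - p)"
  have LB: "L (B x) = A x" for x unfolding B_def using bL by (simp add: bij_def surj_f_inv_f)
  have Am: "A m = t - p" unfolding m_def using bA by (simp add: bij_def surj_f_inv_f)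
  have "linear (inv L)" by (rule inj_linear_imp_inv_linear[OF lL iL])
  then have lB: "linear B" using linear_compose[OF lA] by (simp add: B_def[abs_def] comp_def)
  have iB: "inj B"
  proof (rule injI)
    fix x y assume "B x = B y"
    then have "A x = A y" using LB[of x] LB[of y] by simp
    then show "x = y" using bA by (simp add: bij_def inj_eq)
  qed
  have mem: "A x + p \<in> G ` X \<longleftrightarrow> B (x - m) \<in> X" for x X
  proof -
    have "G (B (x - m)) = A x + p" unfolding G_def LB linear_diff[OF lA] Am by simp
    moreover have "inj G" by (rule injI) (use iL in \<open>simp add: G_def inj_eq\<close>)
    ultimately show ?thesis using inj_image_mem_iff[of G "B (x - m)" X] by simp
  qed
  have "A x + p \<in> inside S \<longleftrightarrow> norm (B (x - m)) < 1" for x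
    unfolding inS using mem[of x "ball 0 1"] by simp
  moreover have "A x + p \<in> S \<union> inside S \<longleftrightarrow> norm (B (x - m)) \<le> 1" for x
    unfolding clS using mem[of x "cball 0 1"] by simp
  ultimately show ?thesis using lB iB by blast
qed

text \<open>\<open>R\<close> is a threshold at 1, undecided at 1 itself. Scaling by
  \<open>2 / (P + Q)\<close> would put the smaller of two distinct values below 1 and the larger
  above.\<close>

lemma radius_predicate_eq:
  assumes R: "\<And>r. r < 1 \<Longrightarrow> R r" "\<And>r. R r \<Longrightarrow> r \<le> (1::real)"
    and "P > 0" "Q > 0" and eq: "\<And>t. t \<ge> 0 \<Longrightarrow> R (t * P) \<longleftrightarrow> R (t * Q)"
  shows "P = Q"
proof -
  have *: False if "P > 0" "P < Q" and eq: "\<And>t. t \<ge> 0 \<Longrightarrow> R (t * P) \<longleftrightarrow> R (t * Q)" for P Q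
  proof -
    define t where "t = 2 / (P + Q)"
    have "t \<ge> 0" "t * P < 1" "t * Q > 1" using that(1,2) by (auto simp: t_def field_simps)
    then show False using eq[of t] R(1)[of "t * P"] R(2)[of "t * Q"] by auto
  qed
  show ?thesis using *[of P Q] *[of Q P] assms by (cases P Q rule: linorder_cases) auto
qed

text \<open>With \<open>R r\<close> standing for \<open>r < 1\<close> or \<open>r \<le> 1\<close>, \<open>D\<close> is an open or a closed ellipse.\<close>

lemma symmetric_ellipse:
  fixes B :: "real^2 \<Rightarrow> real^2"
  assumes B: "linear B" "inj B"
    and R: "\<And>r. r < 1 \<Longrightarrow> R r" "\<And>r. R r \<Longrightarrow> r \<le> (1::real)" "\<And>r s. R s \<Longrightarrow> r \<le> s \<Longrightarrow> R r"
    and D: "\<And>x. x \<in> D \<longleftrightarrow> R (norm (B (x - m)))"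
    and sym: "\<And>x. x \<in> D \<Longrightarrow> pt (x$1) (- x$2) \<in> D"
  shows "x \<in> D \<Longrightarrow> \<bar>s - m$1\<bar> \<le> \<bar>x$1 - m$1\<bar> \<Longrightarrow> pt s (x$2) \<in> D"
    and "x \<in> D \<Longrightarrow> \<bar>s\<bar> \<le> \<bar>x$2\<bar> \<Longrightarrow> pt (x$1) s \<in> D"
proof -
  have B0: "norm (B x) > 0" if "x \<noteq> 0" for x
    using that linear_injective_0[OF B(1)] B(2) by auto
  have sym': "pt (x$1) (- x$2) \<in> D \<longleftrightarrow> x \<in> D" for x
    using sym[of x] sym[of "pt (x$1) (- x$2)"] by auto
  have m2: "m$2 = 0"
  proof (rule ccontr)
    assume "m$2 \<noteq> 0"
    \<comment> \<open>\<open>m + \<delta>\<close> is the mirror image of the centre. In the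
      parameter of the line through both points, \<open>D\<close> would be symmetric about 0 and
      about 1/2, which is impossible for a bounded nonempty set.\<close>
    define \<delta> where "\<delta> = pt 0 (- 2 * m$2)"
    define \<beta> where "\<beta> = norm (B \<delta>)"
    have \<beta>: "\<beta> > 0" unfolding \<beta>_def using B0[of \<delta>] \<open>m$2 \<noteq> 0\<close> by (simp add: \<delta>_def vec2_eq)
    have mem: "m + t *\<^sub>R \<delta> \<in> D \<longleftrightarrow> R (\<bar>t\<bar> * \<beta>)" for t
      unfolding D by (simp add: linear_cmul[OF B(1)] \<beta>_def)
    have "pt ((m + t *\<^sub>R \<delta>)$1) (- (m + t *\<^sub>R \<delta>)$2) = m + (1 - t) *\<^sub>R \<delta>" for t
      by (simp add: \<delta>_def vec2_eq algebra_simps)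
    then have eq: "R (\<bar>t\<bar> * \<beta>) \<longleftrightarrow> R (\<bar>1 - t\<bar> * \<beta>)" for t
      using sym'[of "m + t *\<^sub>R \<delta>"] mem[of t] mem[of "1 - t"] by simp
    \<comment> \<open>Chosen with \<open>s * \<beta> < 1 < (1 + s) * \<beta>\<close>: the parameter
      \<open>- s\<close> belongs to \<open>D\<close>, its mirror image \<open>1 + s\<close> does
      not.\<close>
    define s where "s = max 0 (1 / \<beta> - 1 / 2)"
    have "s \<ge> 0" by (simp add: s_def)
    moreover have "s * \<beta> < 1" using \<beta> by (auto simp: s_def max_def field_simps)
    moreover have "(1 + s) * \<beta> > 1" using \<beta> by (auto simp: s_def max_def field_simps)
    ultimately show False using eq[of "- s"] R(1)[of "s * \<beta>"] R(2)[of "(1 + s) * \<beta>"] by auto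
  qed
  define a b where "a = B (axis 1 1)" and "b = B (axis 2 1)"
  have Bx: "B x = x$1 *\<^sub>R a + x$2 *\<^sub>R b" for x
  proof -
    have "x = x$1 *\<^sub>R axis 1 1 + x$2 *\<^sub>R axis 2 1" by (simp add: vec2_eq)
    then have "B x = B (x$1 *\<^sub>R axis 1 1 + x$2 *\<^sub>R axis 2 1)" by (rule arg_cong)
    then show ?thesis by (simp only: linear_add[OF B(1)] linear_cmul[OF B(1)] a_def b_def)
  qed
  \<comment> \<open>The two diagonals are mirror images. Equal length of their images makes
    \<open>a\<close> and \<open>b\<close> orthogonal: the principal axes are parallel to the
    coordinate axes.\<close>
  have "norm (B (pt 1 1)) = norm (B (pt 1 (- 1)))"
  proof (rule radius_predicate_eq[of R, OF R(1,2)])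
    show "norm (B (pt 1 1)) > 0" "norm (B (pt 1 (- 1))) > 0" by (auto intro!: B0 simp del: zero_less_norm_iff simp: vec2_eq)
    fix t :: real assume "t \<ge> 0"
    have 1: "m + t *\<^sub>R w \<in> D \<longleftrightarrow> R (t * norm (B w))" for w
      unfolding D using \<open>t \<ge> 0\<close> by (simp add: linear_cmul[OF B(1)])
    have 2: "pt ((m + t *\<^sub>R pt 1 1)$1) (- (m + t *\<^sub>R pt 1 1)$2) = m + t *\<^sub>R pt 1 (- 1)"
      using m2 by (simp add: vec2_eq)
    show "R (t * norm (B (pt 1 1))) \<longleftrightarrow> R (t * norm (B (pt 1 (- 1))))"
      using sym'[of "m + t *\<^sub>R pt 1 1"] unfolding 2 1 by blast
  qed
  then have "(norm (a + b))\<^sup>2 = (norm (a - b))\<^sup>2" unfolding Bx by simp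
  then have ab: "a \<bullet> b = 0"
    unfolding power2_norm_eq_inner by (simp add: inner_add_left inner_add_right inner_diff_left inner_diff_right inner_commute)
  have nB: "(norm (B (x - m)))\<^sup>2 = (x$1 - m$1)\<^sup>2 * (norm a)\<^sup>2 + (x$2)\<^sup>2 * (norm b)\<^sup>2" for x
    unfolding Bx power2_norm_eq_inner using m2 ab
    by (simp add: inner_add_left inner_add_right inner_commute power2_eq_square algebra_simps)
  have le: "pt s' t' \<in> D" if "x \<in> D" "\<bar>s' - m$1\<bar> \<le> \<bar>x$1 - m$1\<bar>" "\<bar>t'\<bar> \<le> \<bar>x$2\<bar>" for x s' t'
  proof -
    have "(s' - m$1)\<^sup>2 \<le> (x$1 - m$1)\<^sup>2" "t'\<^sup>2 \<le> (x$2)\<^sup>2" using that(2,3) by (auto simp: abs_le_square_iff)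
    then have "(norm (B (pt s' t' - m)))\<^sup>2 \<le> (norm (B (x - m)))\<^sup>2"
      unfolding nB by (auto intro!: add_mono mult_right_mono)
    then have "norm (B (pt s' t' - m)) \<le> norm (B (x - m))" by (rule power2_le_imp_le) simp
    then show ?thesis using R(3) that(1) unfolding D by blast
  qed
  show "x \<in> D \<Longrightarrow> \<bar>s - m$1\<bar> \<le> \<bar>x$1 - m$1\<bar> \<Longrightarrow> pt s (x$2) \<in> D" by (rule le) auto
  show "x \<in> D \<Longrightarrow> \<bar>s\<bar> \<le> \<bar>x$2\<bar> \<Longrightarrow> pt (x$1) s \<in> D" by (rule le) auto
qed

text \<open>An axis of the domain is an axis of the outer region and of the hole, so in its frame
  both ellipses have their centres on the axis and their principal directions along the
  coordinates.\<close>

lemma ellipse_annulus_axis_frame: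
  assumes dom: "annular_domain \<gamma>\<^sub>I \<gamma>\<^sub>E \<Omega>" and ell: "is_ellipse \<gamma>\<^sub>I" "is_ellipse \<gamma>\<^sub>E"
    and l: "symmetry_axis l \<Omega>"
  shows "\<exists>A p c k. orthogonal_transformation A \<and> l = (\<lambda>x. A x + p) ` {x. x$2 = 0} \<and>
    axial {x. A x + p \<in> inside \<gamma>\<^sub>E} {x. A x + p \<in> \<gamma>\<^sub>I \<union> inside \<gamma>\<^sub>I} c k"
proof -
  note facts = annular_domain_facts[OF dom]
  obtain p v where v: "v \<noteq> 0" "l = line_through p v" "line_reflection p v ` \<Omega> = \<Omega>"
    using l unfolding symmetry_axis_def by blast
  obtain A where A: "orthogonal_transformation A" "line_through p v = (\<lambda>x. A x + p) ` {x. x$2 = 0}"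
    "\<And>x. line_reflection p v (A x + p) = A (pt (x$1) (- x$2)) + p"
    using line_adapted_frame[OF v(1), of p] by blast
  note sym = reflection_preserves_boundary_components[OF v(1) facts(2-6), of p] v(3)[unfolded facts(1)]
  have symE: "A (pt (x$1) (- x$2)) + p \<in> inside \<gamma>\<^sub>E \<longleftrightarrow> A x + p \<in> inside \<gamma>\<^sub>E" for x
    using line_reflection_image_iff[OF v(1) sym(1)[OF sym(3)], of "A x + p"] A(3) by simp
  have symH: "A (pt (x$1) (- x$2)) + p \<in> \<gamma>\<^sub>I \<union> inside \<gamma>\<^sub>I \<longleftrightarrow> A x + p \<in> \<gamma>\<^sub>I \<union> inside \<gamma>\<^sub>I" for x
    using line_reflection_image_iff[OF v(1) sym(2)[OF sym(3)], of "A x + p"] A(3) by simp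
  obtain B :: "real^2 \<Rightarrow> real^2" and m where B: "linear B" "inj B" "\<And>x. A x + p \<in> inside \<gamma>\<^sub>E \<longleftrightarrow> norm (B (x - m)) < 1"
    using ellipse_in_frame[OF ell(2) A(1), of p] by blast
  obtain B' :: "real^2 \<Rightarrow> real^2" and m' where B': "linear B'" "inj B'"
    "\<And>x. A x + p \<in> \<gamma>\<^sub>I \<union> inside \<gamma>\<^sub>I \<longleftrightarrow> norm (B' (x - m')) \<le> 1"
    using ellipse_in_frame[OF ell(1) A(1), of p] by blast
  define E' where "E' = {x. A x + p \<in> inside \<gamma>\<^sub>E}"
  define H' where "H' = {x. A x + p \<in> \<gamma>\<^sub>I \<union> inside \<gamma>\<^sub>I}"
  have E1: "x \<in> E' \<longleftrightarrow> norm (B (x - m)) < 1" for x unfolding E'_def mem_Collect_eq by (rule B(3))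
  have H1: "x \<in> H' \<longleftrightarrow> norm (B' (x - m')) \<le> 1" for x unfolding H'_def mem_Collect_eq by (rule B'(3))
  have E2: "pt (x$1) (- x$2) \<in> E'" if "x \<in> E'" for x
    using that unfolding E'_def mem_Collect_eq symE .
  have H2: "pt (x$1) (- x$2) \<in> H'" if "x \<in> H'" for x
    using that unfolding H'_def mem_Collect_eq symH .
  have ax: "axial E' H' (m$1) (m'$1)" unfolding axial_def
  proof (intro conjI ballI allI impI)
    show "pt s (x$2) \<in> E'" if "x \<in> E'" "\<bar>s - m$1\<bar> \<le> \<bar>x$1 - m$1\<bar>" for x s
      by (rule symmetric_ellipse(1)[where R="\<lambda>r. r < 1" and B=B and m=m and D=E'])
        (use B(1,2) E1 E2 that in auto)
    show "pt s (x$2) \<in> H'" if "x \<in> H'" "\<bar>s - m'$1\<bar> \<le> \<bar>x$1 - m'$1\<bar>" for x s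
      by (rule symmetric_ellipse(1)[where R="\<lambda>r. r \<le> 1" and B=B' and m=m' and D=H'])
        (use B'(1,2) H1 H2 that in auto)
    show "pt (x$1) s \<in> H'" if "x \<in> H'" "\<bar>s\<bar> \<le> \<bar>x$2\<bar>" for x s
      by (rule symmetric_ellipse(2)[where R="\<lambda>r. r \<le> 1" and B=B' and m=m' and D=H'])
        (use B'(1,2) H1 H2 that in auto)
  qed (rule E2)
  have "l = (\<lambda>x. A x + p) ` {x. x$2 = 0}" unfolding v(2) by (rule A(2))
  then show ?thesis using A(1) ax[unfolded E'_def H'_def] by (intro exI conjI)
qed

text \<open>Reduces the eccentric circles to the case of two ellipses.\<close>

lemma eccentric_circles_are_ellipses:
  assumes "eccentric_circle_annular_domain \<gamma>\<^sub>I \<gamma>\<^sub>E \<Omega>"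
  shows "annular_domain \<gamma>\<^sub>I \<gamma>\<^sub>E \<Omega>" "is_ellipse \<gamma>\<^sub>I" "is_ellipse \<gamma>\<^sub>E"
proof -
  obtain T a r R where T: "rigid_motion T" and ar: "a > 0" "r > 0" "a + r < R"
    and \<gamma>: "\<gamma>\<^sub>I = T ` sphere (vector [a, 0]) r" "\<gamma>\<^sub>E = T ` sphere 0 R"
    using assms unfolding eccentric_circle_annular_domain_def by blast
  show "annular_domain \<gamma>\<^sub>I \<gamma>\<^sub>E \<Omega>" using assms unfolding eccentric_circle_annular_domain_def by blast
  have circle: "is_ellipse (T ` sphere q \<rho>)" if "\<rho> > 0" for q \<rho>
  proof -
    obtain A b where A: "orthogonal_transformation A" "T = (\<lambda>x. A x + b)"
      using T unfolding rigid_motion_def by blast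
    then have lA: "linear A" by (simp add: orthogonal_transformation_def)
    have "(x$1 / \<rho>)\<^sup>2 + (x$2 / \<rho>)\<^sup>2 = 1 \<longleftrightarrow> norm x = \<rho>" for x :: "real^2"
    proof -
      have "(x$1 / \<rho>)\<^sup>2 + (x$2 / \<rho>)\<^sup>2 = (norm x)\<^sup>2 / \<rho>\<^sup>2" by (simp add: norm2_sq power_divide add_divide_distrib)
      then show ?thesis using that by (auto simp: field_simps)
    qed
    then have E: "{x::real^2. (x$1 / \<rho>)\<^sup>2 + (x$2 / \<rho>)\<^sup>2 = 1} = sphere 0 \<rho>"
      by (intro set_eqI) (simp only: mem_Collect_eq mem_sphere_0)
    have "T ` sphere q \<rho> = (\<lambda>x. A x + (A q + b)) ` sphere 0 \<rho>"
    proof -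
      have "sphere q \<rho> = (+) q ` sphere 0 \<rho>" using sphere_translation[of q 0 \<rho>] unfolding add_0_right .
      then have "T ` sphere q \<rho> = T ` (+) q ` sphere 0 \<rho>" by (rule arg_cong[where f="image T"])
      also have "\<dots> = (\<lambda>x. A x + (A q + b)) ` sphere 0 \<rho>"
        unfolding A(2) image_image by (rule image_cong[OF refl]) (simp add: linear_add[OF lA])
      finally show ?thesis .
    qed
    moreover have "rigid_motion (\<lambda>x. A x + (A q + b))" unfolding rigid_motion_def using A(1) by blast
    ultimately show ?thesis unfolding is_ellipse_def using that E
      by (intro exI[of _ "\<lambda>x. A x + (A q + b)"] exI[of _ \<rho>]) (simp only:)
  qed
  show "is_ellipse \<gamma>\<^sub>I" "is_ellipse \<gamma>\<^sub>E" unfolding \<gamma> by (rule circle; use ar in linarith)+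
qed

lemma line_reflection_reparam:
  assumes "w \<noteq> 0" "s \<noteq> 0"
  shows "line_reflection (q + t *\<^sub>R w) (s *\<^sub>R w) = line_reflection q w"
proof
  fix x
  have ww: "w \<bullet> w \<noteq> 0" using assms(1) by simp
  have "2 * ((x - (q + t *\<^sub>R w)) \<bullet> (s *\<^sub>R w)) / ((s *\<^sub>R w) \<bullet> (s *\<^sub>R w)) * s = 2 * ((x - q) \<bullet> w) / (w \<bullet> w) - 2 * t"
    using ww assms(2) by (simp add: inner_diff_left inner_add_left field_simps)
  then have "(2 * ((x - (q + t *\<^sub>R w)) \<bullet> (s *\<^sub>R w)) / ((s *\<^sub>R w) \<bullet> (s *\<^sub>R w))) *\<^sub>R (s *\<^sub>R w) =
      (2 * ((x - q) \<bullet> w) / (w \<bullet> w) - 2 * t) *\<^sub>R w"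
    unfolding scaleR_scaleR by simp
  moreover have "(2 * ((x - q) \<bullet> w) / (w \<bullet> w) - 2 * t) *\<^sub>R w = (2 * ((x - q) \<bullet> w) / (w \<bullet> w)) *\<^sub>R w - t *\<^sub>R w - t *\<^sub>R w"
    by (simp only: scaleR_left_diff_distrib mult_2 scaleR_left_distrib diff_diff_eq)
  ultimately show "line_reflection (q + t *\<^sub>R w) (s *\<^sub>R w) x = line_reflection q w x"
    unfolding line_reflection_def by simp
qed

text \<open>The reflection depends on the line alone. This reconciles the base point hidden in
  \<open>symmetry_axis\<close> with the common centre through which the axes of a petal are
  described.\<close>

lemma line_reflection_cong:
  assumes eq: "line_through p v = line_through q w" and v: "v \<noteq> 0" "w \<noteq> 0"
  shows "line_reflection p v = line_reflection q w"
proof -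
  have "p + 0 *\<^sub>R v \<in> line_through q w" "p + 1 *\<^sub>R v \<in> line_through q w"
    unfolding eq[symmetric] unfolding line_through_def by (rule rangeI)+
  then obtain t t' where t: "p + 0 *\<^sub>R v = q + t *\<^sub>R w" "p + 1 *\<^sub>R v = q + t' *\<^sub>R w"
    unfolding line_through_def by blast
  have p: "p = q + t *\<^sub>R w" using t(1) by simp
  have vs: "v = (t' - t) *\<^sub>R w" using t(2) unfolding p by (simp add: scaleR_left_diff_distrib algebra_simps)
  then have "t' - t \<noteq> 0" using v(1) by auto
  from line_reflection_reparam[OF v(2) this] show ?thesis unfolding p vs .
qed

lemma line_through_perp:
  assumes "perpendicular_lines (line_through p v) (line_through q w)"
  shows "v \<bullet> w = 0"
proof -
  have "p \<in> line_through p v" "p + v \<in> line_through p v" for p v :: "real^2"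
    unfolding line_through_def by (rule range_eqI[of _ _ 0], simp, rule range_eqI[of _ _ 1], simp)
  then have "(p + v - p) \<bullet> (q + w - q) = 0" using assms unfolding perpendicular_lines_def by blast
  then show ?thesis by simp
qed

text \<open>An axis of the domain is an axis of the outer curve, and the one perpendicular to it
  passes through the same centre \<open>q\<close>. Reflection in the latter makes chords parallel to
  \<open>l\<close> symmetric, convexity along \<open>l\<close> makes them intervals, and the hole is
  a disc about \<open>q\<close>; so both centres are 0.\<close>

lemma petal_axis_frame:
  assumes petal: "exterior_petal_like_domain \<gamma>\<^sub>I \<gamma>\<^sub>E \<Omega>" and perp: "axes_perpendicular_in_pairs \<gamma>\<^sub>E"
    and l: "symmetry_axis l \<Omega>"
  shows "\<exists>A p c k. orthogonal_transformation A \<and> l = (\<lambda>x. A x + p) ` {x. x$2 = 0} \<and>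
    axial {x. A x + p \<in> inside \<gamma>\<^sub>E} {x. A x + p \<in> \<gamma>\<^sub>I \<union> inside \<gamma>\<^sub>I} c k"
proof -
  have dom: "annular_domain \<gamma>\<^sub>I \<gamma>\<^sub>E \<Omega>" using petal by (simp add: exterior_petal_like_domain_def)
  note facts = annular_domain_facts[OF dom]
  obtain q n r where eqi: "equiangular_lines q n (symmetry_axes \<gamma>\<^sub>E)" and r: "r > 0" "\<gamma>\<^sub>I = sphere q r"
    using petal unfolding exterior_petal_like_domain_def by blast
  have conv: "convex_in_direction m (inside \<gamma>\<^sub>E)" if "m \<in> symmetry_axes \<gamma>\<^sub>E" for m
    using petal that by (simp add: exterior_petal_like_domain_def)
  have dir: "\<exists>w. w \<noteq> 0 \<and> m = line_through q w \<and> line_reflection q w ` inside \<gamma>\<^sub>E = inside \<gamma>\<^sub>E"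
    if m: "m \<in> symmetry_axes \<gamma>\<^sub>E" for m
  proof -
    obtain \<theta> where "symmetry_axes \<gamma>\<^sub>E = (\<lambda>i. line_through q (pt (cos (\<theta> + real i * pi / real n)) (sin (\<theta> + real i * pi / real n)))) ` {..<n}"
      using eqi unfolding equiangular_lines_def by blast
    then obtain \<phi> where \<phi>: "m = line_through q (pt (cos \<phi>) (sin \<phi>))" using m by blast
    define w where "w = pt (cos \<phi>) (sin \<phi>)"
    have "w \<noteq> 0"
    proof
      assume "w = 0"
      then have "cos \<phi> = 0" "sin \<phi> = 0" by (simp_all add: w_def vec2_eq)
      then show False using sin_cos_squared_add[of \<phi>] by simp
    qed
    moreover obtain p' v' where v': "v' \<noteq> 0" "m = line_through p' v'" "line_reflection p' v' ` \<gamma>\<^sub>E = \<gamma>\<^sub>E"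
      using m unfolding symmetry_axes_def symmetry_axis_def by blast
    moreover have "line_reflection p' v' = line_reflection q w"
      using line_reflection_cong[OF _ v'(1) \<open>w \<noteq> 0\<close>] v'(2) \<phi> w_def by simp
    ultimately show ?thesis
      using reflection_preserves_inside[OF _ facts(9,10), of w q] \<phi> w_def by metis
  qed
  obtain p0 v0 where v0: "v0 \<noteq> 0" "l = line_through p0 v0" "line_reflection p0 v0 ` \<Omega> = \<Omega>"
    using l unfolding symmetry_axis_def by blast
  have "line_reflection p0 v0 ` inside \<gamma>\<^sub>E = inside \<gamma>\<^sub>E"
    by (rule reflection_preserves_boundary_components[OF v0(1) facts(2-6)]) (use v0(3) facts(1) in simp)
  from reflection_preserves_frontier[OF v0(1) facts(2) this]
  have ls: "l \<in> symmetry_axes \<gamma>\<^sub>E" using v0(1,2) unfolding facts(8) symmetry_axes_def symmetry_axis_def by blast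
  then obtain w where w: "w \<noteq> 0" "l = line_through q w" "line_reflection q w ` inside \<gamma>\<^sub>E = inside \<gamma>\<^sub>E"
    using dir by blast
  obtain m where m: "m \<in> symmetry_axes \<gamma>\<^sub>E" "perpendicular_lines l m"
    using perp ls unfolding axes_perpendicular_in_pairs_def by blast
  obtain w' where w': "w' \<noteq> 0" "m = line_through q w'" "line_reflection q w' ` inside \<gamma>\<^sub>E = inside \<gamma>\<^sub>E"
    using dir[OF m(1)] by blast
  define J where "J = pt (- w$2) (w$1)"
  have J0: "J \<noteq> 0" using w(1) by (auto simp: J_def vec2_eq)
  have wJ: "w \<bullet> J = 0" and JJ: "J \<bullet> J = w \<bullet> w" by (simp_all add: J_def inner2)
  obtain A where A: "orthogonal_transformation A" "\<And>x. A x = (x$1 / norm w) *\<^sub>R w + (x$2 / norm w) *\<^sub>R J"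
    "line_through q w = (\<lambda>x. A x + q) ` {x. x$2 = 0}"
    "\<And>x. line_reflection q w (A x + q) = A (pt (x$1) (- x$2)) + q"
    using line_adapted_frame[OF w(1), of q] unfolding J_def by blast
  have "w \<bullet> w' = 0" using m(2) unfolding w(2) w'(2) by (rule line_through_perp)
  then have orth: "w$1 * w'$1 + w$2 * w'$2 = 0" by (simp add: inner2)
  have nw: "w$1 * w$1 + w$2 * w$2 \<noteq> 0" using w(1) by (simp add: vec2_eq sum_squares_eq_zero_iff)
  define \<tau> where "\<tau> = (w$1 * w'$2 - w$2 * w'$1) / (w$1 * w$1 + w$2 * w$2)"
  have w'J: "w' = \<tau> *\<^sub>R J"
  proof -
    have "(w$1 * w'$2 - w$2 * w'$1) * (- w$2) = w'$1 * (w$1 * w$1 + w$2 * w$2)"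
      "(w$1 * w'$2 - w$2 * w'$1) * w$1 = w'$2 * (w$1 * w$1 + w$2 * w$2)" using orth by algebra+
    then show ?thesis using nw by (simp add: vec2_eq J_def \<tau>_def nonzero_divide_eq_eq) (simp add: field_simps)
  qed
  then have "\<tau> \<noteq> 0" using w'(1) by auto
  then have "line_reflection q w' = line_reflection q J"
    using line_reflection_reparam[OF J0, of \<tau> q 0] by (simp add: w'J)
  moreover have "line_reflection q J (A x + q) = A (pt (- x$1) (x$2)) + q" for x
  proof -
    have "2 * (A x \<bullet> J) / (J \<bullet> J) = 2 * (x$2 / norm w)"
      using w(1) by (simp add: A(2) inner_add_left wJ JJ)
    then have "line_reflection q J (A x + q) = q + (2 * (x$2 / norm w)) *\<^sub>R J - A x"
      by (simp add: line_reflection_def)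
    also have "\<dots> = A (pt (- x$1) (x$2)) + q"
      by (simp add: A(2) algebra_simps scaleR_2[symmetric])
    finally show ?thesis .
  qed
  ultimately have flip: "A (pt (- x$1) (x$2)) + q \<in> inside \<gamma>\<^sub>E \<longleftrightarrow> A x + q \<in> inside \<gamma>\<^sub>E" for x
    using line_reflection_image_iff[OF w'(1,3), of "A x + q"] by simp
  have inI: "\<gamma>\<^sub>I \<union> inside \<gamma>\<^sub>I = cball q r"
  proof -
    have "inside (sphere q r) = ball q r"
      using inside_frontier_eq_interior[of "cball q r"] r(1) by (simp add: frontier_cball interior_cball)
    then show ?thesis unfolding r(2) by auto
  qed
  have lA: "linear A" using A(1) by (simp add: orthogonal_transformation_def)
  have H': "A x + q \<in> \<gamma>\<^sub>I \<union> inside \<gamma>\<^sub>I \<longleftrightarrow> norm x \<le> r" for x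
    unfolding inI using orthogonal_transformation_norm[OF A(1), of x] by (simp add: dist_norm)
  have nle: "norm y \<le> norm x" if "\<bar>y$1\<bar> \<le> \<bar>x$1\<bar>" "\<bar>y$2\<bar> \<le> \<bar>x$2\<bar>" for x y :: "real^2"
  proof -
    have "(norm y)\<^sup>2 \<le> (norm x)\<^sup>2" unfolding norm2_sq using that by (intro add_mono) (simp_all add: abs_le_square_iff)
    then show ?thesis by (rule power2_le_imp_le) simp
  qed
  have "axial {x. A x + q \<in> inside \<gamma>\<^sub>E} {x. A x + q \<in> \<gamma>\<^sub>I \<union> inside \<gamma>\<^sub>I} 0 0" unfolding axial_def
  proof (intro conjI ballI allI impI)
    fix x assume "x \<in> {x. A x + q \<in> inside \<gamma>\<^sub>E}"
    then show "pt (x$1) (- x$2) \<in> {x. A x + q \<in> inside \<gamma>\<^sub>E}"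
      using line_reflection_image_iff[OF w(1,3), of "A x + q"] A(4) by simp
  next
    fix x s assume *: "x \<in> {x. A x + q \<in> inside \<gamma>\<^sub>E}" "\<bar>s - 0\<bar> \<le> \<bar>x$1 - 0\<bar>"
    define y where "y = pt (- x$1) (x$2)"
    have xy: "A x + q \<in> inside \<gamma>\<^sub>E" "A y + q \<in> inside \<gamma>\<^sub>E" using * flip by (simp_all add: y_def)
    \<comment> \<open>The weight that writes \<open>pt s (x$2)\<close> as a convex combination of
      \<open>x\<close> and its mirror image \<open>y\<close>. For \<open>x$1 = 0\<close> the two
      coincide and \<open>s\<close> is 0.\<close>
    define \<mu> where "\<mu> = (if x$1 = 0 then 0 else (x$1 - s) / (2 * x$1))"
    have \<mu>: "0 \<le> \<mu>" "\<mu> \<le> 1" using *(2) by (cases "x$1" "0 :: real" rule: linorder_cases; simp add: \<mu>_def field_simps)+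
    have "pt s (x$2) = (1 - \<mu>) *\<^sub>R x + \<mu> *\<^sub>R y"
      using *(2) by (cases "x$1 = 0") (simp_all add: vec2_eq y_def \<mu>_def field_simps)
    then have "A (pt s (x$2)) = (1 - \<mu>) *\<^sub>R A x + \<mu> *\<^sub>R A y"
      by (simp only: linear_add[OF lA] linear_cmul[OF lA])
    then have "A (pt s (x$2)) + q = (1 - \<mu>) *\<^sub>R (A x + q) + \<mu> *\<^sub>R (A y + q)"
      by (simp add: algebra_simps)
    then have seg: "A (pt s (x$2)) + q \<in> closed_segment (A x + q) (A y + q)"
      unfolding in_segment using \<mu> by blast
    have "(A y + q) - (A x + q) = (q + (- 2 * x$1 / norm w) *\<^sub>R w) - (q + 0 *\<^sub>R w)"
      by (simp add: A(2) y_def vec2_eq)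
    then have "\<exists>p\<in>l. \<exists>q'\<in>l. (A y + q) - (A x + q) = q' - p" unfolding w(2) line_through_def by blast
    then have "closed_segment (A x + q) (A y + q) \<subseteq> inside \<gamma>\<^sub>E"
      using conv[OF ls] xy unfolding convex_in_direction_def by blast
    then show "pt s (x$2) \<in> {x. A x + q \<in> inside \<gamma>\<^sub>E}" using seg by blast
  next
    fix x s assume "x \<in> {x. A x + q \<in> \<gamma>\<^sub>I \<union> inside \<gamma>\<^sub>I}" "\<bar>s - 0\<bar> \<le> \<bar>x$1 - 0\<bar>"
    then show "pt s (x$2) \<in> {x. A x + q \<in> \<gamma>\<^sub>I \<union> inside \<gamma>\<^sub>I}"
      unfolding mem_Collect_eq H' using nle[of "pt s (x$2)" x] by simp
  next
    fix x s assume "x \<in> {x. A x + q \<in> \<gamma>\<^sub>I \<union> inside \<gamma>\<^sub>I}" "\<bar>s\<bar> \<le> \<bar>x$2\<bar>"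
    then show "pt (x$1) s \<in> {x. A x + q \<in> \<gamma>\<^sub>I \<union> inside \<gamma>\<^sub>I}"
      unfolding mem_Collect_eq H' using nle[of "pt (x$1) s" x] by simp
  qed
  moreover have "l = (\<lambda>x. A x + q) ` {x. x$2 = 0}" unfolding w(2) by (rule A(3))
  ultimately show ?thesis using A(1) by (intro exI conjI)
qed


text \<open>If \<open>f 0 = 0\<close>, the zero function solves the same problem, and comparison in
  both directions makes \<open>U\<close> vanish.\<close>

lemma rhs_positive_at_zero:
  assumes "open D" "bounded D" and U: "continuous_on UNIV U" "\<And>x. x \<notin> D \<Longrightarrow> U x = 0" "solves D f U"
    and f: "\<And>s t. s \<le> t \<Longrightarrow> f t \<le> f s" "\<And>s. f s \<ge> 0"
    and "\<not> U constant_on D"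
  shows "f 0 > 0"
proof (rule ccontr)
  assume "\<not> f 0 > 0"
  then have "f 0 = 0" using f(2)[of 0] by simp
  then have 0: "solves D f (\<lambda>_. 0)" unfolding solves_def
    by (intro exI[of _ "\<lambda>_. 0"] exI[of _ "\<lambda>_ _. 0"]) (simp add: C2_data_def trace2_def)
  have bd: "U x = 0" if "x \<in> frontier D" for x
    using U(2) that \<open>open D\<close> by (simp add: frontier_def interior_open)
  have cU: "continuous_on (closure D) U" by (rule continuous_on_subset[OF U(1)]) simp
  have "U x = 0" if x: "x \<in> D" for x
  proof (rule antisym)
    show "U x \<le> 0"
      using comparison[OF assms(1,2) cU _ U(3) 0 f(1) _ _ x, of 0] bd by simp
    show "0 \<le> U x"
      using comparison[OF assms(1,2) _ cU 0 U(3) f(1) _ _ x, of 0] bd by simp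
  qed
  then show False using assms(8) unfolding constant_on_def by blast
qed

theorem theoremB:
  fixes \<Omega> \<gamma>\<^sub>I \<gamma>\<^sub>E :: "(real^2) set"
    and f :: "real \<Rightarrow> real" and u :: "real^2 \<Rightarrow> real"
  assumes domain:
    "eccentric_circle_annular_domain \<gamma>\<^sub>I \<gamma>\<^sub>E \<Omega> \<or>
     (exterior_petal_like_domain \<gamma>\<^sub>I \<gamma>\<^sub>E \<Omega> \<and>
        even (card (symmetry_axes \<gamma>\<^sub>E)) \<and> axes_perpendicular_in_pairs \<gamma>\<^sub>E \<and>
        smooth_nonzero_curvature \<gamma>\<^sub>E) \<or>
     (annular_domain \<gamma>\<^sub>I \<gamma>\<^sub>E \<Omega> \<and> is_ellipse \<gamma>\<^sub>I \<and> is_ellipse \<gamma>\<^sub>E)"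
    and f_nonneg: "\<forall>s. f s \<ge> 0"
    and f_analytic: "real_analytic f"
    and f_decreasing: "\<forall>s. deriv f s \<le> 0"
    and solution: "classical_solution \<Omega> f u"
    and nonconstant: "\<not> u constant_on \<Omega>"
  shows "\<forall>l. symmetry_axis l \<Omega> \<longrightarrow> card (critical_points u \<Omega> \<inter> l) = 2"
proof (intro allI impI)
  fix l assume l: "symmetry_axis l \<Omega>"
  have dom: "annular_domain \<gamma>\<^sub>I \<gamma>\<^sub>E \<Omega>"
    using domain eccentric_circles_are_ellipses(1) unfolding exterior_petal_like_domain_def by blast
  note facts = annular_domain_facts[OF dom]
  have op: "open \<Omega>" unfolding facts(1) by (rule open_Diff[OF facts(2) compact_imp_closed[OF facts(5)]])
  have bd: "bounded \<Omega>" unfolding facts(1) by (rule bounded_subset[OF facts(3)]) blast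
  define E H where "E = inside \<gamma>\<^sub>E" and "H = \<gamma>\<^sub>I \<union> inside \<gamma>\<^sub>I"
  have \<Omega>: "\<Omega> = E - H" unfolding E_def H_def by (rule facts(1))
  have frame: "\<exists>A p c k. orthogonal_transformation A \<and> l = (\<lambda>x. A x + p) ` {x. x$2 = 0} \<and>
    axial {x. A x + p \<in> E} {x. A x + p \<in> H} c k"
    unfolding E_def H_def
    using domain ellipse_annulus_axis_frame[OF dom _ _ l] petal_axis_frame[OF _ _ l]
      eccentric_circles_are_ellipses(2,3) by (elim disjE conjE) simp_all
  then obtain A p c k where A: "orthogonal_transformation A" "l = (\<lambda>x. A x + p) ` {x. x$2 = 0}"
    "axial {x. A x + p \<in> E} {x. A x + p \<in> H} c k" by (elim exE conjE)
  define U where "U x = (if x \<in> \<Omega> then u x else 0)" for x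
  have U: "continuous_on UNIV U" "solves \<Omega> f U"
    using classical_solution_extension[OF solution op] unfolding U_def[abs_def] .
  have U0: "U x = 0" if "x \<notin> \<Omega>" for x using that by (simp add: U_def)
  have anti: "f t \<le> f s" if "s \<le> t" for s t
    by (rule real_analytic_antimono[OF f_analytic f_decreasing that])
  have "\<not> U constant_on \<Omega>" using nonconstant unfolding constant_on_def U_def by simp
  then have f0: "f 0 > 0"
    using rhs_positive_at_zero[OF op bd U(1) U0 U(2) anti] f_nonneg by blast
  have crit: "GDERIV U x :> 0 \<longleftrightarrow> GDERIV u x :> 0" if "x \<in> \<Omega>" for x
    unfolding gderiv_def
    using has_derivative_transform_within_open[OF _ op that, of U _ UNIV u]
      has_derivative_transform_within_open[OF _ op that, of u _ UNIV U] by (auto simp: U_def)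
  have "critical_points u \<Omega> \<inter> l = {x \<in> E - H. GDERIV U x :> 0 \<and> x \<in> (\<lambda>x. A x + p) ` {x. x$2 = 0}}"
    unfolding critical_points_def A(2)[symmetric] \<Omega>[symmetric] using crit by blast
  then show "card (critical_points u \<Omega> \<inter> l) = 2"
    using two_critical_points_on_axis[OF A(1,3) facts(2,3,5-7)[folded E_def H_def] anti _ f0 _ U(1) _ U(2)[unfolded \<Omega>]]
      real_analytic_lipschitz[OF f_analytic] f_nonneg U0[unfolded \<Omega>] by simp
qed

end
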